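(* Let $F_I^\circ$ be an open face that is accessible for $g_\Pi$, so that $A_I<2$. For every $p\in F_I^\circ$ there exist a relatively compact neighbourhood $V\Subset F_I^\circ$ of $p$ and constants $0<c\le C<\infty$ such that for all sufficiently close $z,z'\in V$ (i.e. for all $z,z'\in V$ with $d_{F_I}(z,z')<\eta$, for some $\eta>0$), $$c\,d_{F_I}(z,z')^{1-A_I/2}\le d_{\partial,\Pi}(z,z')\le C\,d_{F_I}(z,z')^{1-A_I/2}.$$
   Context: Let $X$ be a compact smooth $n$-dimensional manifold with corners (locally modelled on $[0,\infty)^k\times\mathbb R^{n-k}$, $0\le k\le n$) whose boundary hypersurfaces $H_1,\dots,H_N$ are globally embedded, and let $X^\circ=X\setminus\partial X$. For each $i$ let $\rho_i:X\to[0,\infty)$ be a smooth boundary-defining function of $H_i$: $H_i=\rho_i^{-1}(0)$, $d\rho_i\neq0$ on $H_i$, and $\rho_i>0$ on $X\setminus H_i$. Let $g_0$ be a smooth Riemannian metric on $X$ (up to the boundary), and let $\alpha_1,\dots,\alpha_N\ge 0$. On $X^\circ$ put $g_\Pi=\bigl(\prod_{i=1}^N\rho_i^{-\alpha_i}\bigr)g_0$, with Riemannian distance $d_{g_\Pi}$. For $p\in X$, $I(p)=\{i: p\in H_i\}$; for nonempty $I\subseteq\{1,\dots,N\}$, the open face is $F_I^\circ=\{p\in X: I(p)=I\}$, a smooth manifold without boundary of codimension $|I|$ when nonempty, and $A_I=\sum_{i\in I}\alpha_i$. A point $p\in\partial X$ is accessible for $g_\Pi$ if there is a $d_{g_\Pi}$-Cauchy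 sequence in $X^\circ$ converging to $p$ in the topology of $X$; an open face is accessible if all its points are; for a nonempty open face this is equivalent to $A_I<2$. $d_{F_I}$ is the Riemannian distance on $F_I^\circ$ induced by the restriction of $g_0$. For $z$ in an accessible open face, all sequences in $X^\circ$ converging to $z$ in the topology of $X$ are $d_{g_\Pi}$-Cauchy and equivalent; $\overline z$ denotes the resulting point of the metric completion of $(X^\circ,d_{g_\Pi})$. The induced boundary distance $d_{\partial,\Pi}(z,z')$ is the distance in that completion between $\overline z$ and $\overline{z'}$. *)

theory Defs
  imports "HOL-Analysis.Analysis"
begin

section \<open>Smooth maps on subsets of Euclidean space\<close>

primrec Ck_on :: "nat \<Rightarrow> ('a::euclidean_space \<Rightarrow> 'b::real_normed_vector) \<Rightarrow> 'a set \<Rightarrow> bool" where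
  "Ck_on 0 = (\<lambda>f U. continuous_on U f)"
| "Ck_on (Suc k) = (\<lambda>f U. (\<forall>x\<in>U. f differentiable (at x)) \<and>
      (\<forall>v. Ck_on k (\<lambda>x. frechet_derivative f (at x) v) U))"

text \<open>\<open>Ck_on\<close> is meant for open sets. On an arbitrary set \<open>S\<close> (here: relatively open subsets of
  a corner), smoothness means local extendability to smooth maps on open sets.\<close>

definition smooth_on :: "('a::euclidean_space \<Rightarrow> 'b::real_normed_vector) \<Rightarrow> 'a set \<Rightarrow> bool" where
  "smooth_on f S \<longleftrightarrow>
     (\<forall>x\<in>S. \<exists>W F. open W \<and> x \<in> W \<and> (\<forall>k. Ck_on k F W) \<and> (\<forall>y\<in>S \<inter> W. F y = f y))"


section \<open>Manifolds with corners\<close>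

text \<open>The corner \<open>[0,\<infinity>)\<^sup>k \<times> \<real>\<^sup>n\<^sup>-\<^sup>k\<close>, with \<open>K\<close> the set of the \<open>k\<close> constrained coordinates.\<close>

definition corner :: "'n set \<Rightarrow> (real ^ 'n::finite) set" where
  "corner K = {x. \<forall>j\<in>K. 0 \<le> x $ j}"

record ('a, 'n) chart =
  chart_dom :: "'a set"
  chart_faces :: "'n set"
  chart_map :: "'a \<Rightarrow> real ^ 'n"

definition chart_image :: "('a, 'n::finite) chart \<Rightarrow> (real ^ 'n) set" where
  "chart_image c = chart_map c ` chart_dom c"

definition chart_inv :: "('a, 'n::finite) chart \<Rightarrow> real ^ 'n \<Rightarrow> 'a" where
  "chart_inv c = inv_into (chart_dom c) (chart_map c)"

definition corner_chart :: "'a topology \<Rightarrow> ('a, 'n::finite) chart \<Rightarrow> bool" where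
  "corner_chart X c \<longleftrightarrow>
     openin X (chart_dom c) \<and>
     openin (top_of_set (corner (chart_faces c))) (chart_image c) \<and>
     homeomorphic_map (subtopology X (chart_dom c)) (top_of_set (chart_image c)) (chart_map c)"

definition manifold_with_corners :: "'a topology \<Rightarrow> ('a, 'n::finite) chart set \<Rightarrow> bool" where
  "manifold_with_corners X \<A> \<longleftrightarrow>
     Hausdorff_space X \<and> second_countable X \<and>
     (\<forall>c\<in>\<A>. corner_chart X c) \<and> (\<Union>c\<in>\<A>. chart_dom c) = topspace X \<and>
     (\<forall>c\<in>\<A>. \<forall>c'\<in>\<A>.
        smooth_on (chart_map c' \<circ> chart_inv c) (chart_map c ` (chart_dom c \<inter> chart_dom c')))"

definition vanishing_faces :: "('a, 'n::finite) chart \<Rightarrow> 'a \<Rightarrow> 'n set" where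
  "vanishing_faces c p = {j \<in> chart_faces c. chart_map c p $ j = 0}"

definition mf_boundary :: "('a, 'n::finite) chart set \<Rightarrow> 'a set" where
  "mf_boundary \<A> = {p. \<exists>c\<in>\<A>. p \<in> chart_dom c \<and> vanishing_faces c p \<noteq> {}}"

definition mf_interior :: "'a topology \<Rightarrow> ('a, 'n::finite) chart set \<Rightarrow> 'a set" where
  "mf_interior X \<A> = topspace X - mf_boundary \<A>"

definition codim1_stratum :: "('a, 'n::finite) chart set \<Rightarrow> 'a set" where
  "codim1_stratum \<A> = {p. \<exists>c\<in>\<A>. p \<in> chart_dom c \<and> card (vanishing_faces c p) = 1}"

text \<open>Boundary hypersurfaces are the closures of the connected components of the codimension one
  stratum.\<close>

definition boundary_hypersurfaces :: "'a topology \<Rightarrow> ('a, 'n::finite) chart set \<Rightarrow> 'a set set" where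
  "boundary_hypersurfaces X \<A> =
     {X closure_of C | C. C \<in> connected_components_of (subtopology X (codim1_stratum \<A>))}"

text \<open>Embeddedness: near each of its points the hypersurface is a single coordinate hyperplane
  \<open>x\<^sub>j = 0\<close>, so that it does not meet itself at a corner.\<close>

definition embedded_hypersurface :: "'a topology \<Rightarrow> ('a, 'n::finite) chart set \<Rightarrow> 'a set \<Rightarrow> bool" where
  "embedded_hypersurface X \<A> S \<longleftrightarrow>
     (\<forall>p\<in>S. \<exists>c\<in>\<A>. \<exists>j\<in>chart_faces c. \<exists>W. openin X W \<and> p \<in> W \<and> W \<subseteq> chart_dom c \<and>
        S \<inter> W = {q \<in> W. chart_map c q $ j = 0})"

definition smooth_function :: "('a, 'n::finite) chart set \<Rightarrow> ('a \<Rightarrow> real) \<Rightarrow> bool" where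
  "smooth_function \<A> f \<longleftrightarrow> (\<forall>c\<in>\<A>. smooth_on (f \<circ> chart_inv c) (chart_image c))"

text \<open>The differential of \<open>\<rho>\<close> being nonzero is expressed in charts; derivatives within a relatively
  open subset of a corner are unique.\<close>

definition boundary_defining_function ::
    "'a topology \<Rightarrow> ('a, 'n::finite) chart set \<Rightarrow> 'a set \<Rightarrow> ('a \<Rightarrow> real) \<Rightarrow> bool" where
  "boundary_defining_function X \<A> S \<rho> \<longleftrightarrow>
     smooth_function \<A> \<rho> \<and>
     (\<forall>p\<in>topspace X. 0 \<le> \<rho> p) \<and>
     S = {p \<in> topspace X. \<rho> p = 0} \<and>
     (\<forall>p\<in>S. \<forall>c\<in>\<A>. p \<in> chart_dom c \<longrightarrow>
        \<not> ((\<rho> \<circ> chart_inv c) has_derivative (\<lambda>v. 0)) (at (chart_map c p) within chart_image c))"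

definition face_index :: "nat \<Rightarrow> (nat \<Rightarrow> 'a set) \<Rightarrow> 'a \<Rightarrow> nat set" where
  "face_index N H p = {i \<in> {1..N}. p \<in> H i}"

definition open_face :: "'a topology \<Rightarrow> nat \<Rightarrow> (nat \<Rightarrow> 'a set) \<Rightarrow> nat set \<Rightarrow> 'a set" where
  "open_face X N H I = {p \<in> topspace X. face_index N H p = I}"


section \<open>Riemannian metrics and distances\<close>

text \<open>A covariant 2-tensor is given by its local expressions: \<open>g c p u v\<close> is its value at \<open>p\<close> on the
  tangent vectors with components \<open>u\<close>, \<open>v\<close> in the chart \<open>c\<close>, subject to the usual
  transformation law under change of charts.\<close>

type_synonym ('a, 'n) tensor2 =
  "('a, 'n) chart \<Rightarrow> 'a \<Rightarrow> real ^ 'n \<Rightarrow> real ^ 'n \<Rightarrow> real"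

definition smooth_riemannian_metric ::
    "('a, 'n::finite) chart set \<Rightarrow> ('a, 'n) tensor2 \<Rightarrow> bool" where
  "smooth_riemannian_metric \<A> g \<longleftrightarrow>
     (\<forall>c\<in>\<A>. \<forall>p\<in>chart_dom c.
        bilinear (g c p) \<and> (\<forall>u v. g c p u v = g c p v u) \<and> (\<forall>v. v \<noteq> 0 \<longrightarrow> 0 < g c p v v)) \<and>
     (\<forall>c\<in>\<A>. \<forall>u v. smooth_on (\<lambda>x. g c (chart_inv c x) u v) (chart_image c)) \<and>
     (\<forall>c\<in>\<A>. \<forall>c'\<in>\<A>. \<forall>p\<in>chart_dom c \<inter> chart_dom c'. \<forall>T.
        ((chart_map c' \<circ> chart_inv c) has_derivative T)
          (at (chart_map c p) within chart_map c ` (chart_dom c \<inter> chart_dom c')) \<longrightarrow>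
        (\<forall>u v. g c p u v = g c' p (T u) (T v)))"

definition C1_curve_on ::
    "'a topology \<Rightarrow> ('a, 'n::finite) chart set \<Rightarrow> real \<Rightarrow> real \<Rightarrow> (real \<Rightarrow> 'a) \<Rightarrow> bool" where
  "C1_curve_on X \<A> a b \<gamma> \<longleftrightarrow>
     continuous_map (top_of_set {a..b}) X \<gamma> \<and>
     (\<forall>c\<in>\<A>. \<exists>w. continuous_on {t \<in> {a..b}. \<gamma> t \<in> chart_dom c} w \<and>
        (\<forall>t\<in>{a..b}. \<gamma> t \<in> chart_dom c \<longrightarrow>
           ((chart_map c \<circ> \<gamma>) has_vector_derivative w t) (at t within {a..b})))"

definition piecewise_C1_curve ::
    "'a topology \<Rightarrow> ('a, 'n::finite) chart set \<Rightarrow> (real \<Rightarrow> 'a) \<Rightarrow> bool" where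
  "piecewise_C1_curve X \<A> \<gamma> \<longleftrightarrow>
     continuous_map (top_of_set {0..1}) X \<gamma> \<and>
     (\<exists>B. finite B \<and>
        (\<forall>a b. 0 \<le> a \<and> a < b \<and> b \<le> 1 \<and> {a<..<b} \<inter> B = {} \<longrightarrow> C1_curve_on X \<A> a b \<gamma>))"

text \<open>By the transformation law the choice of the chart is immaterial wherever \<open>\<gamma>\<close> is
  differentiable, i.e. up to finitely many \<open>t\<close>, which do not affect the length.\<close>

definition curve_speed ::
    "('a, 'n::finite) chart set \<Rightarrow> ('a, 'n) tensor2 \<Rightarrow> (real \<Rightarrow> 'a) \<Rightarrow> real \<Rightarrow> real" where
  "curve_speed \<A> g \<gamma> t =
     (let c = (SOME c. c \<in> \<A> \<and> \<gamma> t \<in> chart_dom c);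
          v = vector_derivative (chart_map c \<circ> \<gamma>) (at t within {0..1})
      in sqrt (g c (\<gamma> t) v v))"

definition curve_length ::
    "('a, 'n::finite) chart set \<Rightarrow> ('a, 'n) tensor2 \<Rightarrow> (real \<Rightarrow> 'a) \<Rightarrow> ennreal" where
  "curve_length \<A> g \<gamma> = (\<integral>\<^sup>+t\<in>{0..1}. ennreal (curve_speed \<A> g \<gamma> t) \<partial>lborel)"

text \<open>Riemannian distance on \<open>S\<close>, where \<open>S\<close> is the interior or an open face: a curve is piecewise
  \<open>C\<^sup>1\<close> in the embedded submanifold \<open>S\<close> iff it is so in \<open>X\<close> and runs in \<open>S\<close>, and its length for
  the restricted metric is its length for \<open>g\<close>. The distance is \<open>\<infinity>\<close> between different
  components of \<open>S\<close>.\<close>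

definition riemannian_distance ::
    "'a topology \<Rightarrow> ('a, 'n::finite) chart set \<Rightarrow> ('a, 'n) tensor2 \<Rightarrow> 'a set \<Rightarrow> 'a \<Rightarrow> 'a \<Rightarrow> ennreal"
  where
  "riemannian_distance X \<A> g S p q =
     (INF \<gamma>\<in>{\<gamma>. piecewise_C1_curve X \<A> \<gamma> \<and> \<gamma> ` {0..1} \<subseteq> S \<and> \<gamma> 0 = p \<and> \<gamma> 1 = q}.
        curve_length \<A> g \<gamma>)"

definition product_conformal_metric ::
    "nat \<Rightarrow> (nat \<Rightarrow> 'a \<Rightarrow> real) \<Rightarrow> (nat \<Rightarrow> real) \<Rightarrow> ('a, 'n::finite) tensor2 \<Rightarrow> ('a, 'n) tensor2" where
  "product_conformal_metric N \<rho> \<alpha> g c p u v = (\<Prod>i=1..N. \<rho> i p powr (- \<alpha> i)) * g c p u v"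


section \<open>Metric completion\<close>

text \<open>The completion of a set \<open>M\<close> with an extended metric \<open>d\<close>, as the set of Cauchy sequences
  modulo sequences at distance tending to zero.\<close>

definition cauchy_seq :: "'a set \<Rightarrow> ('a \<Rightarrow> 'a \<Rightarrow> ennreal) \<Rightarrow> (nat \<Rightarrow> 'a) \<Rightarrow> bool" where
  "cauchy_seq M d s \<longleftrightarrow>
     range s \<subseteq> M \<and> (\<forall>\<epsilon>>0. \<exists>n0. \<forall>m\<ge>n0. \<forall>n\<ge>n0. d (s m) (s n) < \<epsilon>)"

definition cauchy_equiv :: "'a set \<Rightarrow> ('a \<Rightarrow> 'a \<Rightarrow> ennreal) \<Rightarrow> ((nat \<Rightarrow> 'a) \<times> (nat \<Rightarrow> 'a)) set" where
  "cauchy_equiv M d =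
     {(s, t). cauchy_seq M d s \<and> cauchy_seq M d t \<and> (\<lambda>n. d (s n) (t n)) \<longlonglongrightarrow> 0}"

definition completion :: "'a set \<Rightarrow> ('a \<Rightarrow> 'a \<Rightarrow> ennreal) \<Rightarrow> (nat \<Rightarrow> 'a) set set" where
  "completion M d = {s. cauchy_seq M d s} // cauchy_equiv M d"

definition completion_dist ::
    "('a \<Rightarrow> 'a \<Rightarrow> ennreal) \<Rightarrow> (nat \<Rightarrow> 'a) set \<Rightarrow> (nat \<Rightarrow> 'a) set \<Rightarrow> ennreal" where
  "completion_dist d P Q = (THE r. \<forall>s\<in>P. \<forall>t\<in>Q. (\<lambda>n. d (s n) (t n)) \<longlonglongrightarrow> r)"

definition completion_point ::
    "'a topology \<Rightarrow> 'a set \<Rightarrow> ('a \<Rightarrow> 'a \<Rightarrow> ennreal) \<Rightarrow> 'a \<Rightarrow> (nat \<Rightarrow> 'a) set" where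
  "completion_point X M d z =
     (THE P. P \<in> completion M d \<and>
        (\<forall>s. range s \<subseteq> M \<and> limitin X s z sequentially \<longrightarrow> s \<in> P))"

definition boundary_dist ::
    "'a topology \<Rightarrow> 'a set \<Rightarrow> ('a \<Rightarrow> 'a \<Rightarrow> ennreal) \<Rightarrow> 'a \<Rightarrow> 'a \<Rightarrow> ennreal" where
  "boundary_dist X M d z z' =
     completion_dist d (completion_point X M d z) (completion_point X M d z')"

definition accessible_point ::
    "'a topology \<Rightarrow> 'a set \<Rightarrow> ('a \<Rightarrow> 'a \<Rightarrow> ennreal) \<Rightarrow> 'a \<Rightarrow> bool" where
  "accessible_point X M d p \<longleftrightarrow> (\<exists>s. cauchy_seq M d s \<and> limitin X s p sequentially)"

definition accessible_face ::
    "'a topology \<Rightarrow> 'a set \<Rightarrow> ('a \<Rightarrow> 'a \<Rightarrow> ennreal) \<Rightarrow> 'a set \<Rightarrow> bool" where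
  "accessible_face X M d F \<longleftrightarrow> (\<forall>p\<in>F. accessible_point X M d p)"

end

theory Submission
  imports Defs
begin

text \<open>
  In a chart \<open>x\<close> around \<open>p\<close> the face \<open>F\<^sub>I\<close> is the linear stratum where all the coordinates \<open>x\<^sub>j\<close> that vanish at \<open>p\<close>
  are zero, and \<open>g0\<close> is comparable to the Euclidean metric. Every \<open>\<rho> i\<close> with \<open>i \<in> I\<close> is Lipschitz
  and vanishes on the face, so the conformal factor is at least a multiple of \<open>s powr (- A)\<close> at distance
  at most \<open>s\<close> from a point \<open>z\<close> of the face. A curve that starts close to \<open>z\<close> and leaves the
  \<open>s\<close>-ball around \<open>z\<close> therefore has length at least a multiple of \<open>s powr (1 - A / 2)\<close>. With \<open>s\<close>
  comparable to the distance of \<open>z\<close> and \<open>z'\<close> this is the lower bound; letting \<open>s\<close> tend to zero, it also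
  shows that accessibility forces \<open>A < 2\<close>.

  Conversely, let \<open>e\<close> be the sum of the inward coordinate vectors. As \<open>d\<rho> i\<close> is nonzero at \<open>p\<close> and
  \<open>\<rho> i \<ge> 0\<close>, the derivative of \<open>\<rho> i\<close> along \<open>e\<close> is positive, so the conformal factor at \<open>x + t e\<close>
  is at most a multiple of \<open>t powr (- A)\<close>. Moving inward by \<open>t e\<close>, then parallel to the
  face, and back costs at most a multiple of \<open>t powr (1 - A / 2) + t powr (- A / 2) * \<bar>x(z) - x(z')\<bar>\<close>, and
  \<open>t = \<bar>x(z) - x(z')\<bar>\<close> gives the upper bound.
\<close>

section \<open>Integration\<close>

text \<open>The hypersurfaces are given only as closures of components of the codimension one
  stratum, so the flat form of the face in a chart has to be earned. A coordinate wall
  \<open>x $ j = 0\<close> near \<open>p\<close>, with the other vanishing coordinates positive, is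
  convex; it therefore lies in one component, and its closure in one \<open>H i\<close> with
  \<open>i \<in> I\<close>. Conversely, each component whose closure contains \<open>p\<close>
  absorbs such a wall, and the closure of the wall contains the stratum. That the face contains
  nothing else comes from the differential: \<open>\<rho> i\<close> vanishes on its wall, hence must
  grow transversally to it. All this rests on the number of vanishing coordinates being independent
  of the chart. A second obstacle is that points of the completion and their distance are definite
  descriptions. The detour bound is therefore proved for interior points, uniformly up to the
  boundary and with the height \<open>t\<close> left free. A small fixed \<open>t\<close> makes all
  sequences with the same limit in the face jointly Cauchy; only afterwards is \<open>t\<close>
  matched to the distance.\<close>

lemma borel_measurable_continuous_on_open_part:
  fixes f :: "real \<Rightarrow> 'b::euclidean_space"
  assumes "open U" "continuous_on U f"
  shows "(\<lambda>t. if t \<in> U then f t else 0) \<in> borel_measurable borel"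
proof -
  have "(\<lambda>t. indicator U t *\<^sub>R f t) \<in> borel_measurable borel"
    using assms by (intro borel_measurable_continuous_on_indicator) auto
  moreover have "(\<lambda>t. indicator U t *\<^sub>R f t) = (\<lambda>t. if t \<in> U then f t else 0)"
    by (auto simp: indicator_def)
  ultimately show ?thesis by simp
qed

text \<open>The velocity may fail to be integrable. If the right-hand side is infinite there is
  nothing to show; otherwise \<open>w\<close> is Lebesgue integrable, and the fundamental theorem
  for the gauge integral, which tolerates a finite exceptional set, identifies its integral with
  \<open>f b - f a\<close>.\<close>

lemma norm_diff_le_nn_integral_derivative:
  fixes f v :: "real \<Rightarrow> 'b::euclidean_space"
  assumes ab: "a \<le> b" and B: "finite B" and cf: "continuous_on {a..b} f"
    and df: "\<And>t. t \<in> {a<..<b} - B \<Longrightarrow> (f has_vector_derivative v t) (at t)"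
    and cv: "continuous_on ({a<..<b} - B) v"
  shows "ennreal (norm (f b - f a)) \<le> (\<integral>\<^sup>+t. (if t \<in> {a<..<b} - B then ennreal (norm (v t)) else 0) \<partial>lborel)"
proof -
  define w where "w t = (if t \<in> {a<..<b} - B then v t else 0)" for t
  have op: "open ({a<..<b} - B)" using B by (simp add: finite_imp_closed open_Diff)
  have wm: "w \<in> borel_measurable borel"
    unfolding w_def by (rule borel_measurable_continuous_on_open_part[OF op cv])
  have eq: "(\<integral>\<^sup>+t. (if t \<in> {a<..<b} - B then ennreal (norm (v t)) else 0) \<partial>lborel)
      = (\<integral>\<^sup>+t. ennreal (norm (w t)) \<partial>lborel)"
    by (intro nn_integral_cong) (auto simp: w_def)
  show ?thesis
  proof (cases "(\<integral>\<^sup>+t. ennreal (norm (w t)) \<partial>lborel) < \<infinity>")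
    case True
    have wi: "integrable lborel w"
      using True wm by (intro integrableI_bounded) auto
    have h1: "(w has_integral (integral\<^sup>L lborel w)) UNIV"
      using has_integral_integral_lborel[OF wi] .
    have "(w has_integral (f b - f a)) {a..b}"
    proof (rule fundamental_theorem_of_calculus_interior_strong[OF _ ab _ cf, where S=B])
      show "finite B" by fact
      fix t assume "t \<in> {a<..<b} - B"
      then show "(f has_vector_derivative w t) (at t)" using df[of t] by (simp add: w_def)
    qed
    then have "((\<lambda>t. if t \<in> {a..b} then w t else 0) has_integral (f b - f a)) UNIV"
      by (subst has_integral_restrict_UNIV)
    also have "(\<lambda>t. if t \<in> {a..b} then w t else 0) = w" by (auto simp: w_def)
    finally have "integral\<^sup>L lborel w = f b - f a" using h1 has_integral_unique by blast
    then have "ennreal (norm (f b - f a)) \<le> (\<integral>\<^sup>+t. ennreal (norm (w t)) \<partial>lborel)"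
      using integral_norm_bound_ennreal[OF wi] by simp
    then show ?thesis using eq by simp
  next
    case False
    then show ?thesis using eq by (simp add: less_top[symmetric])
  qed
qed

lemma nn_integral_affine:
  fixes f :: "real \<Rightarrow> ennreal"
  assumes "f \<in> borel_measurable borel" "m \<noteq> 0"
  shows "(\<integral>\<^sup>+t. ennreal \<bar>m\<bar> * f (k + m * t) \<partial>lborel) = (\<integral>\<^sup>+t. f t \<partial>lborel)"
  using nn_integral_real_affine[OF assms, of k] assms
  by (subst nn_integral_cmult) auto

text \<open>With \<open>a = A / 2\<close> this integrates the singular speed bound along an inward
  segment; its convergence is what \<open>A < 2\<close> provides.\<close>

lemma nn_integral_powr_unit:
  assumes "a < 1"
  shows "(\<integral>\<^sup>+t\<in>{0..1}. ennreal (t powr (-a)) \<partial>lborel) = ennreal (1 / (1 - a))"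
proof -
  have "((\<lambda>x. x powr (-a)) has_integral (1 powr (-a+1) / (-a+1))) {0..1::real}"
    using assms by (intro has_integral_powr_from_0) auto
  then have "((\<lambda>x. x powr (-a)) has_integral (1 / (1-a))) {0..1::real}" by simp
  then show ?thesis by (intro nn_integral_has_integral_lebesgue') auto
qed

section \<open>Completion of an extended pseudometric\<close>

lemma convergent_if_ennreal_Cauchy:
  fixes a :: "nat \<Rightarrow> ennreal"
  assumes "\<And>\<epsilon>. \<epsilon> > 0 \<Longrightarrow> \<exists>n0. \<forall>m\<ge>n0. \<forall>n\<ge>n0. a n \<le> a m + \<epsilon>"
  shows "\<exists>l. a \<longlonglongrightarrow> l"
proof -
  have "limsup a \<le> liminf a + ennreal e" if "e > 0" for e
  proof -
    have "0 < ennreal e" using that by simp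
    from assms[OF this] obtain n0 where n0: "\<And>m n. m \<ge> n0 \<Longrightarrow> n \<ge> n0 \<Longrightarrow> a n \<le> a m + ennreal e"
      by blast
    have "limsup a \<le> a m + ennreal e" if "m \<ge> n0" for m
      using n0[OF that] by (intro Limsup_bounded) (auto simp: eventually_sequentially)
    then have "limsup a - ennreal e \<le> a m" if "m \<ge> n0" for m
      using that by (simp add: ennreal_minus_le_iff add.commute)
    then have "limsup a - ennreal e \<le> liminf a"
      by (intro Liminf_bounded) (auto simp: eventually_sequentially)
    then show ?thesis
      by (simp add: ennreal_minus_le_iff add.commute)
  qed
  then have "limsup a \<le> liminf a"
    by (rule ennreal_le_epsilon)
  then have "liminf a = limsup a"
    using Liminf_le_Limsup[of sequentially a] by (intro antisym) simp_all
  then have "a \<longlonglongrightarrow> limsup a"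
    by (intro iffD2[OF tendsto_iff_Liminf_eq_Limsup] conjI refl sequentially_bot)
  then show ?thesis ..
qed

lemma ennreal_null_if_eventually_less:
  fixes a :: "nat \<Rightarrow> ennreal"
  assumes "\<And>\<epsilon>. \<epsilon> > 0 \<Longrightarrow> \<exists>n0. \<forall>n\<ge>n0. a n < \<epsilon>"
  shows "a \<longlonglongrightarrow> 0"
  using assms by (intro order_tendstoI) (auto simp: eventually_sequentially)

locale ext_pseudometric =
  fixes M :: "'a set" and d :: "'a \<Rightarrow> 'a \<Rightarrow> ennreal"
  assumes sym: "d x y = d y x" and tri: "d x z \<le> d x y + d y z"
begin

lemma equiv_cauchy: "equiv {s. cauchy_seq M d s} (cauchy_equiv M d)"
proof (rule equivI)
  show "cauchy_equiv M d \<subseteq> {s. cauchy_seq M d s} \<times> {s. cauchy_seq M d s}"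
    by (auto simp: cauchy_equiv_def)
  show "refl_on {s. cauchy_seq M d s} (cauchy_equiv M d)"
  proof (rule refl_onI)
    fix s assume "s \<in> {s. cauchy_seq M d s}"
    then have s: "cauchy_seq M d s" by simp
    \<comment> \<open>The locale does not postulate \<open>d x x = 0\<close>; the diagonal case
      \<open>m = n\<close> of the Cauchy condition takes its place.\<close>
    have "(\<lambda>n. d (s n) (s n)) \<longlonglongrightarrow> 0"
    proof (rule ennreal_null_if_eventually_less)
      fix \<epsilon> :: ennreal assume "\<epsilon> > 0"
      then obtain n0 where "\<forall>m\<ge>n0. \<forall>n\<ge>n0. d (s m) (s n) < \<epsilon>"
        using s unfolding cauchy_seq_def by meson
      then show "\<exists>n0. \<forall>n\<ge>n0. d (s n) (s n) < \<epsilon>" by blast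
    qed
    with s show "(s, s) \<in> cauchy_equiv M d" by (simp add: cauchy_equiv_def)
  qed
  show "Relation.sym (cauchy_equiv M d)"
  proof (rule symI)
    fix s t assume "(s, t) \<in> cauchy_equiv M d"
    moreover have "(\<lambda>n. d (s n) (t n)) = (\<lambda>n. d (t n) (s n))" by (rule ext) (rule sym)
    ultimately show "(t, s) \<in> cauchy_equiv M d" by (simp add: cauchy_equiv_def)
  qed
  show "trans (cauchy_equiv M d)"
  proof (rule transI)
    fix s t u assume st: "(s, t) \<in> cauchy_equiv M d" and tu: "(t, u) \<in> cauchy_equiv M d"
    have "(\<lambda>n. d (s n) (t n) + d (t n) (u n)) \<longlonglongrightarrow> 0 + 0"
      using st tu by (intro tendsto_add) (auto simp: cauchy_equiv_def)
    then have "(\<lambda>n. d (s n) (u n)) \<longlonglongrightarrow> 0"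
      by - (rule tendsto_sandwich[OF _ _ tendsto_const, where h="\<lambda>n. d (s n) (t n) + d (t n) (u n)"], simp_all add: tri)
    with st tu show "(s, u) \<in> cauchy_equiv M d" by (simp add: cauchy_equiv_def)
  qed
qed

lemma convergent_dist:
  assumes s: "cauchy_seq M d s" and t: "cauchy_seq M d t"
  shows "\<exists>l. (\<lambda>n. d (s n) (t n)) \<longlonglongrightarrow> l"
  proof (rule convergent_if_ennreal_Cauchy)
    fix \<epsilon> :: ennreal assume "\<epsilon> > 0"
    then have e: "\<epsilon> / 2 > 0" by (simp add: ennreal_zero_less_divide)
    obtain n1 where n1: "\<And>m n. m \<ge> n1 \<Longrightarrow> n \<ge> n1 \<Longrightarrow> d (s m) (s n) < \<epsilon> / 2"
      using s e unfolding cauchy_seq_def by meson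
    obtain n2 where n2: "\<And>m n. m \<ge> n2 \<Longrightarrow> n \<ge> n2 \<Longrightarrow> d (t m) (t n) < \<epsilon> / 2"
      using t e unfolding cauchy_seq_def by meson
    have "d (s n) (t n) \<le> d (s m) (t m) + \<epsilon>" if "m \<ge> max n1 n2" "n \<ge> max n1 n2" for m n
    proof -
          have "d (s n) (t n) \<le> d (s n) (s m) + (d (s m) (t m) + d (t m) (t n))"
        by (rule order_trans[OF tri[where y="s m"]], rule add_left_mono, rule tri)
      also have "\<dots> \<le> \<epsilon> / 2 + (d (s m) (t m) + \<epsilon> / 2)"
        using n1[of n m] n2[of m n] that by (intro add_mono) (auto intro: less_imp_le)
      also have "\<dots> = d (s m) (t m) + (\<epsilon> / 2 + \<epsilon> / 2)" by (simp add: ac_simps)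
      also have "\<epsilon> / 2 + \<epsilon> / 2 = \<epsilon>"
        using mult_divide_eq_ennreal[of 2 \<epsilon>] by (simp add: mult_2[symmetric] ennreal_times_divide mult.commute)
      finally show ?thesis .
    qed
    then show "\<exists>n0. \<forall>m\<ge>n0. \<forall>n\<ge>n0. d (s n) (t n) \<le> d (s m) (t m) + \<epsilon>" by blast
  qed

lemma lim_dist_le:
  assumes "(s, s') \<in> cauchy_equiv M d" "(t, t') \<in> cauchy_equiv M d"
    and l: "(\<lambda>n. d (s n) (t n)) \<longlonglongrightarrow> l" and l': "(\<lambda>n. d (s' n) (t' n)) \<longlonglongrightarrow> l'"
  shows "l \<le> l'"
proof -
  have "(\<lambda>n. d (s n) (s' n) + (d (s' n) (t' n) + d (t n) (t' n))) \<longlonglongrightarrow> 0 + (l' + 0)"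
    using assms by (intro tendsto_add) (auto simp: cauchy_equiv_def)
  moreover have "d (s n) (t n) \<le> d (s n) (s' n) + (d (s' n) (t' n) + d (t n) (t' n))" for n
    by (rule order_trans[OF tri[where y="s' n"]], rule add_left_mono, subst (2) sym, rule tri)
  ultimately show ?thesis using LIMSEQ_le[OF l] by auto
qed

text \<open>Resolves the definite description in \<open>completion_dist\<close>: the limit exists,
  \<open>lim_dist_le\<close> used in both directions makes it independent of the representatives,
  and the classes are nonempty, so the value is unique.\<close>

lemma completion_dist_tendsto:
  assumes s: "cauchy_seq M d s" and t: "cauchy_seq M d t"
  shows "(\<lambda>n. d (s n) (t n)) \<longlonglongrightarrow>
    completion_dist d (cauchy_equiv M d `` {s}) (cauchy_equiv M d `` {t})"
proof -
  obtain l where l: "(\<lambda>n. d (s n) (t n)) \<longlonglongrightarrow> l" using convergent_dist[OF s t] by blast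
  have lim: "(\<lambda>n. d (s' n) (t' n)) \<longlonglongrightarrow> l"
    if s': "(s, s') \<in> cauchy_equiv M d" and t': "(t, t') \<in> cauchy_equiv M d" for s' t'
  proof -
    obtain l' where l': "(\<lambda>n. d (s' n) (t' n)) \<longlonglongrightarrow> l'"
      using convergent_dist[of s' t'] s' t' by (auto simp: cauchy_equiv_def)
    have "(s', s) \<in> cauchy_equiv M d" "(t', t) \<in> cauchy_equiv M d"
      using s' t' equiv_cauchy by (auto simp: equiv_def sym_def)
    then have "l = l'"
      using lim_dist_le[OF s' t' l l'] lim_dist_le[OF _ _ l' l] by auto
    with l' show ?thesis by simp
  qed
  have "completion_dist d (cauchy_equiv M d `` {s}) (cauchy_equiv M d `` {t}) = l"
    unfolding completion_dist_def
  proof (rule the_equality)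
    show "\<forall>sa\<in>cauchy_equiv M d `` {s}. \<forall>ta\<in>cauchy_equiv M d `` {t}. (\<lambda>n. d (sa n) (ta n)) \<longlonglongrightarrow> l"
      using lim by auto
    fix r assume r: "\<forall>sa\<in>cauchy_equiv M d `` {s}. \<forall>ta\<in>cauchy_equiv M d `` {t}. (\<lambda>n. d (sa n) (ta n)) \<longlonglongrightarrow> r"
    have "(s, s) \<in> cauchy_equiv M d" using equiv_class_self[OF equiv_cauchy] s by blast
    moreover have "(t, t) \<in> cauchy_equiv M d" using equiv_class_self[OF equiv_cauchy] t by blast
    ultimately have "(\<lambda>n. d (s n) (t n)) \<longlonglongrightarrow> r" using r by blast
    then show "r = l" using l LIMSEQ_unique by blast
  qed
  with l show ?thesis by simp
qed

text \<open>Resolves the definite description in \<open>completion_point\<close>. Assumption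
  \<open>c\<close> with \<open>s = s'\<close> gives Cauchy sequences, and with \<open>m = n\<close>
  their equivalence. The sequence \<open>s\<close> pins down the class; if no sequence converged to
  \<open>z\<close>, every class would qualify.\<close>

lemma completion_point_eq:
  assumes s: "range s \<subseteq> M" "limitin X s z sequentially"
    and c: "\<And>s s' \<epsilon>. \<lbrakk>range s \<subseteq> M; limitin X s z sequentially; range s' \<subseteq> M; limitin X s' z sequentially; \<epsilon> > 0\<rbrakk>
      \<Longrightarrow> \<exists>n0. \<forall>m\<ge>n0. \<forall>n\<ge>n0. d (s m) (s' n) < \<epsilon>"
  shows "cauchy_seq M d s" "completion_point X M d z = cauchy_equiv M d `` {s}"
proof -
  have cs: "cauchy_seq M d s'" if "range s' \<subseteq> M" "limitin X s' z sequentially" for s'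
    using c[OF that that] that(1) by (auto simp: cauchy_seq_def)
  show "cauchy_seq M d s" using cs[OF s] .
  have eq: "(s, s') \<in> cauchy_equiv M d" if "range s' \<subseteq> M" "limitin X s' z sequentially" for s'
  proof -
    have "(\<lambda>n. d (s n) (s' n)) \<longlonglongrightarrow> 0"
    proof (rule ennreal_null_if_eventually_less)
      fix \<epsilon> :: ennreal assume "\<epsilon> > 0"
      from c[OF s that this] show "\<exists>n0. \<forall>n\<ge>n0. d (s n) (s' n) < \<epsilon>" by blast
    qed
    then show ?thesis using cs[OF s] cs[OF that] by (simp add: cauchy_equiv_def)
  qed
  show "completion_point X M d z = cauchy_equiv M d `` {s}"
    unfolding completion_point_def
  proof (rule the_equality)
    show "cauchy_equiv M d `` {s} \<in> completion M d \<and>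
      (\<forall>sa. range sa \<subseteq> M \<and> limitin X sa z sequentially \<longrightarrow> sa \<in> cauchy_equiv M d `` {s})"
      using eq cs[OF s] by (auto simp: completion_def intro: quotientI)
    fix P assume P: "P \<in> completion M d \<and>
      (\<forall>sa. range sa \<subseteq> M \<and> limitin X sa z sequentially \<longrightarrow> sa \<in> P)"
    then have "s \<in> P" using s by blast
    with P show "P = cauchy_equiv M d `` {s}"
      unfolding completion_def using equiv_cauchy
      by (elim conjE quotientE) (use equiv_class_eq in fastforce)
  qed
qed

end

section \<open>Curves and their speed\<close>

text \<open>All later arguments use one continuous derivative of a local extension. Its continuity
  comes separately for each fixed direction \<open>v\<close>, because \<open>Ck_on\<close>
  differentiates that way.\<close>

lemma smooth_on_C1:
  fixes f :: "'a::euclidean_space \<Rightarrow> 'b::real_normed_vector"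
  assumes "smooth_on f S" "x \<in> S"
  obtains W F F' where "open W" "x \<in> W" "\<And>y. y \<in> W \<Longrightarrow> (F has_derivative F' y) (at y)"
    "\<And>v. continuous_on W (\<lambda>y. F' y v)" "\<And>y. y \<in> S \<Longrightarrow> y \<in> W \<Longrightarrow> F y = f y"
proof -
  obtain W F where WF: "open W" "x \<in> W" "\<And>k. Ck_on k F W" "\<forall>y\<in>S \<inter> W. F y = f y"
    using assms unfolding smooth_on_def by meson
  have "Ck_on (Suc 0) F W" by (rule WF(3))
  then have d: "\<And>y. y \<in> W \<Longrightarrow> F differentiable (at y)"
    and c: "\<And>v. continuous_on W (\<lambda>y. frechet_derivative F (at y) v)"
    by auto
  show ?thesis
    by (rule that[of W F "\<lambda>y. frechet_derivative F (at y)"])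
      (use WF d c in \<open>auto intro: iffD1[OF frechet_derivative_works]\<close>)
qed

lemma smooth_on_continuous:
  fixes f :: "'a::euclidean_space \<Rightarrow> 'b::real_normed_vector"
  assumes "smooth_on f S"
  shows "continuous_on S f"
proof (clarsimp simp: continuous_on_eq_continuous_within)
  fix x assume x: "x \<in> S"
  obtain W F F' where W: "open W" "x \<in> W" "\<And>y. y \<in> W \<Longrightarrow> (F has_derivative F' y) (at y)"
    "\<And>y. y \<in> S \<Longrightarrow> y \<in> W \<Longrightarrow> F y = f y"
    using smooth_on_C1[OF assms x] by metis
  have "continuous (at x) F" using W has_derivative_continuous by blast
  then have "continuous (at x within S) F" by (rule continuous_at_imp_continuous_at_within)
  moreover obtain e where e: "e > 0" "ball x e \<subseteq> W" using W by (meson openE)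
  ultimately show "continuous (at x within S) f"
    using W(4) x by (auto intro!: continuous_transform_within[of x S F e f] simp: subset_iff dist_commute)
qed

text \<open>Uniqueness of a derivative within a set needs short steps inside the set along a basis.
  From any point of a corner, also at its boundary, the positive coordinate directions stay
  inside.\<close>

lemma has_derivative_unique_on_corner:
  fixes f :: "real^'n::finite \<Rightarrow> 'b::real_normed_vector"
  assumes S: "openin (top_of_set (corner K)) S" "x \<in> S"
    and D: "(f has_derivative D) (at x within S)" and E: "(f has_derivative E) (at x within S)"
  shows "D = E"
proof (rule frechet_derivative_unique_within[OF D E])
  fix i :: "real^'n" and e :: real assume i: "i \<in> Basis" and e: "e > 0"
  obtain T where T: "open T" "S = corner K \<inter> T" using S(1) by (auto simp: openin_open)
  then obtain r where r: "r > 0" "ball x r \<subseteq> T" using S(2) by (meson IntD2 openE)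
  define d where "d = min e r / 2"
  have d: "0 < d" "d < e" "d < r" using e r(1) by (auto simp: d_def)
  have nn: "0 \<le> i $ j" for j using i by (auto simp: Basis_vec_def axis_def)
  have "x + d *\<^sub>R i \<in> corner K"
    using S(2) T nn d(1) by (auto simp: corner_def intro!: add_nonneg_nonneg)
  moreover have "x + d *\<^sub>R i \<in> ball x r" using d i by (simp add: dist_norm)
  ultimately have "x + d *\<^sub>R i \<in> S" using T r by auto
  with d show "\<exists>d. 0 < \<bar>d\<bar> \<and> \<bar>d\<bar> < e \<and> x + d *\<^sub>R i \<in> S" by (intro exI[of _ d]) auto
qed

section \<open>Charts of a manifold with corners and curves seen in them\<close>

locale corner_manifold =
  fixes X :: "'a topology" and \<A> :: "('a, 'n::finite) chart set"
  assumes mwc: "manifold_with_corners X \<A>"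
begin

lemma Hausdorff: "Hausdorff_space X"
  using mwc by (simp add: manifold_with_corners_def)

lemma covered: "p \<in> topspace X \<Longrightarrow> \<exists>c\<in>\<A>. p \<in> chart_dom c"
  using mwc by (auto simp: manifold_with_corners_def)

lemma chart: "c \<in> \<A> \<Longrightarrow> corner_chart X c"
  using mwc by (simp add: manifold_with_corners_def)

lemma dom_open: "c \<in> \<A> \<Longrightarrow> openin X (chart_dom c)"
  using chart by (simp add: corner_chart_def)

lemma dom_subset: "c \<in> \<A> \<Longrightarrow> chart_dom c \<subseteq> topspace X"
  using dom_open openin_subset by blast

lemma image_open: "c \<in> \<A> \<Longrightarrow> openin (top_of_set (corner (chart_faces c))) (chart_image c)"
  using chart by (simp add: corner_chart_def)

lemma image_corner: "c \<in> \<A> \<Longrightarrow> x \<in> chart_image c \<Longrightarrow> x \<in> corner (chart_faces c)"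
  using image_open openin_subset by fastforce

lemma map_in_image: "q \<in> chart_dom c \<Longrightarrow> chart_map c q \<in> chart_image c"
  by (simp add: chart_image_def)

lemma map_inj: "c \<in> \<A> \<Longrightarrow> inj_on (chart_map c) (chart_dom c)"
  using chart[of c] dom_subset[of c] unfolding corner_chart_def
  by (metis homeomorphic_imp_injective_map topspace_subtopology_subset)

lemma inv_map: "c \<in> \<A> \<Longrightarrow> q \<in> chart_dom c \<Longrightarrow> chart_inv c (chart_map c q) = q"
  using map_inj by (simp add: chart_inv_def)

lemma map_inv: "x \<in> chart_image c \<Longrightarrow> chart_map c (chart_inv c x) = x"
  by (simp add: chart_inv_def chart_image_def f_inv_into_f)

lemma inv_in_dom: "x \<in> chart_image c \<Longrightarrow> chart_inv c x \<in> chart_dom c"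
  by (simp add: chart_inv_def chart_image_def inv_into_into)

lemma map_continuous: "c \<in> \<A> \<Longrightarrow> continuous_map (subtopology X (chart_dom c)) euclidean (chart_map c)"
  using chart[of c] unfolding corner_chart_def
  by (meson homeomorphic_imp_continuous_map continuous_map_in_subtopology)

lemma inv_continuous:
  assumes c: "c \<in> \<A>"
  shows "continuous_map (top_of_set (chart_image c)) X (chart_inv c)"
proof -
  obtain g where g: "homeomorphic_maps (subtopology X (chart_dom c)) (top_of_set (chart_image c)) (chart_map c) g"
    using chart[OF c] unfolding corner_chart_def homeomorphic_map_maps by blast
  then have cg: "continuous_map (top_of_set (chart_image c)) X g"
    by (meson continuous_map_in_subtopology homeomorphic_maps_def)
  have "g x = chart_inv c x" if "x \<in> chart_image c" for x
  proof -
    have "g (chart_map c (chart_inv c x)) = chart_inv c x"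
      using g inv_in_dom[OF that] dom_subset[OF c] by (auto simp: homeomorphic_maps_def)
    then show ?thesis using map_inv[OF that] by simp
  qed
  then show ?thesis using continuous_map_eq[OF cg] by simp
qed

lemma openin_chart_preimage:
  assumes c: "c \<in> \<A>" and U: "open U"
  shows "openin X {q \<in> chart_dom c. chart_map c q \<in> U}"
proof -
  have "openin (subtopology X (chart_dom c)) {q \<in> topspace (subtopology X (chart_dom c)). chart_map c q \<in> U}"
    using openin_continuous_map_preimage[OF map_continuous[OF c], of U] U by auto
  moreover have "{q \<in> topspace (subtopology X (chart_dom c)). chart_map c q \<in> U} = {q \<in> chart_dom c. chart_map c q \<in> U}"
    using dom_subset[OF c] by auto
  ultimately show ?thesis
    using openin_trans_full[OF _ dom_open[OF c]] by simp
qed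

text \<open>Relative openness in the corner is what uniqueness of derivatives and
  \<open>corner_ray\<close> require of the domain of a transition map.\<close>

lemma transition_image_open:
  assumes c: "c \<in> \<A>" and c': "c' \<in> \<A>"
  shows "openin (top_of_set (corner (chart_faces c))) (chart_map c ` (chart_dom c \<inter> chart_dom c'))"
proof -
  have "openin (top_of_set (chart_image c)) {x \<in> chart_image c. chart_inv c x \<in> chart_dom c'}"
    using openin_continuous_map_preimage[OF inv_continuous[OF c] dom_open[OF c']] by simp
  also have "{x \<in> chart_image c. chart_inv c x \<in> chart_dom c'} = chart_map c ` (chart_dom c \<inter> chart_dom c')"
    using inv_map[OF c] by (force simp: chart_image_def)
  finally show ?thesis using image_open[OF c] openin_trans by blast
qed

lemma transition_smooth:
  "c \<in> \<A> \<Longrightarrow> c' \<in> \<A> \<Longrightarrow>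
    smooth_on (chart_map c' \<circ> chart_inv c) (chart_map c ` (chart_dom c \<inter> chart_dom c'))"
  using mwc by (simp add: manifold_with_corners_def)

lemma transition_has_derivative:
  assumes c: "c \<in> \<A>" and c': "c' \<in> \<A>" and q: "q \<in> chart_dom c" "q \<in> chart_dom c'"
  obtains T where "((chart_map c' \<circ> chart_inv c) has_derivative T)
    (at (chart_map c q) within chart_map c ` (chart_dom c \<inter> chart_dom c'))"
proof -
  let ?S = "chart_map c ` (chart_dom c \<inter> chart_dom c')"
  have x: "chart_map c q \<in> ?S" using q by auto
  obtain W F F' where W: "open W" "chart_map c q \<in> W" "\<And>y. y \<in> W \<Longrightarrow> (F has_derivative F' y) (at y)"
    "\<And>y. y \<in> ?S \<Longrightarrow> y \<in> W \<Longrightarrow> F y = (chart_map c' \<circ> chart_inv c) y"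
    using smooth_on_C1[OF transition_smooth[OF c c'] x] by metis
  obtain e where e: "e > 0" "ball (chart_map c q) e \<subseteq> W" using W by (meson openE)
  have "(F has_derivative F' (chart_map c q)) (at (chart_map c q) within ?S)"
    using W has_derivative_at_withinI by blast
  then have "((chart_map c' \<circ> chart_inv c) has_derivative F' (chart_map c q)) (at (chart_map c q) within ?S)"
    by (rule has_derivative_transform_within[OF _ e(1) x])
      (use e W in \<open>auto simp: subset_iff dist_commute\<close>)
  then show ?thesis by (rule that)
qed

text \<open>The break set is an explicit argument, so that speeds can be integrated over its
  complement and new break sets computed when curves are reversed or joined.\<close>

definition pcurve :: "(real \<Rightarrow> 'a) \<Rightarrow> real set \<Rightarrow> bool" where
  "pcurve \<gamma> B \<longleftrightarrow> continuous_map (top_of_set {0..1}) X \<gamma> \<and> finite B \<and>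
    (\<forall>a b. 0 \<le> a \<and> a < b \<and> b \<le> 1 \<and> {a<..<b} \<inter> B = {} \<longrightarrow> C1_curve_on X \<A> a b \<gamma>)"

lemma piecewise_C1_curve_iff: "piecewise_C1_curve X \<A> \<gamma> \<longleftrightarrow> (\<exists>B. pcurve \<gamma> B)"
  by (auto simp: piecewise_C1_curve_def pcurve_def)

definition velocity :: "('a, 'n) chart \<Rightarrow> (real \<Rightarrow> 'a) \<Rightarrow> real \<Rightarrow> real^'n" where
  "velocity c \<gamma> t = vector_derivative (chart_map c \<circ> \<gamma>) (at t)"

abbreviation regular :: "(real \<Rightarrow> 'a) \<Rightarrow> real set \<Rightarrow> ('a, 'n) chart \<Rightarrow> real \<Rightarrow> bool" where
  "regular \<gamma> B c s \<equiv> s \<in> {0<..<1} - B \<and> \<gamma> s \<in> chart_dom c \<and>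
    ((chart_map c \<circ> \<gamma>) has_vector_derivative velocity c \<gamma> s) (at s)"

lemma open_regular: "pcurve \<gamma> B \<Longrightarrow> open ({0<..<1} - B)"
  by (auto simp: pcurve_def finite_imp_closed open_Diff)

lemma pcurve_preimage_open:
  assumes "pcurve \<gamma> B" "openin X U"
  shows "openin (top_of_set {0..1}) {s \<in> {0..1}. \<gamma> s \<in> U}"
  using openin_continuous_map_preimage[of "top_of_set {0..1}" X \<gamma> U] assms by (simp add: pcurve_def)

text \<open>The derivatives in \<open>C1_curve_on\<close> are one-sided at the ends of the interval.
  In the interior of an interval without break points they are two-sided, so the continuous
  \<open>w\<close> supplied there is the velocity.\<close>

lemma pcurve_C1_near:
  assumes \<gamma>: "pcurve \<gamma> B" and t: "t \<in> {0<..<1} - B" and c: "c \<in> \<A>" and td: "\<gamma> t \<in> chart_dom c"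
  obtains e where "e > 0" "\<And>s. \<bar>s - t\<bar> < e \<Longrightarrow> regular \<gamma> B c s"
    "continuous_on {t-e<..<t+e} (velocity c \<gamma>)"
proof -
  obtain T where T: "open T" "{s \<in> {0..1}. \<gamma> s \<in> chart_dom c} = {0..1} \<inter> T"
    using pcurve_preimage_open[OF \<gamma> dom_open[OF c]] unfolding openin_open by blast
  have op: "open (T \<inter> ({0<..<1} - B))" using T(1) open_regular[OF \<gamma>] by blast
  have "t \<in> {s \<in> {0..1}. \<gamma> s \<in> chart_dom c}" using t td by auto
  then have "t \<in> T \<inter> ({0<..<1} - B)" using t unfolding T(2) by blast
  with op obtain r where r: "r > 0" "ball t r \<subseteq> T \<inter> ({0<..<1} - B)" by (meson openE)
  \<comment> \<open>Half the radius keeps the closed interval, endpoints included, inside the open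
    set.\<close>
  define e where "e = r / 2"
  have e: "e > 0" "{t-e..t+e} \<subseteq> ball t r" using r(1) by (auto simp: e_def dist_real_def)
  have sub: "{t-e..t+e} \<subseteq> T \<inter> ({0<..<1} - B)" using e r by blast
  have ab: "0 \<le> t - e \<and> t - e < t + e \<and> t + e \<le> 1 \<and> {t-e<..<t+e} \<inter> B = {}"
  proof -
    have "t - e \<in> {t-e..t+e}" "t + e \<in> {t-e..t+e}" using e by auto
    then have "t - e \<in> {0<..<1}" "t + e \<in> {0<..<1}" using sub by blast+
    moreover have "{t-e<..<t+e} \<subseteq> {t-e..t+e}" by auto
    ultimately show ?thesis using sub e(1) by auto
  qed
  have dm: "\<gamma> s \<in> chart_dom c" if "s \<in> {t-e..t+e}" for s
  proof -
    have "s \<in> T" "s \<in> {0<..<1}" using sub that by blast+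
    then have "s \<in> {0..1} \<inter> T" by auto
    then show ?thesis using T(2) by blast
  qed
  then have eq: "{s \<in> {t-e..t+e}. \<gamma> s \<in> chart_dom c} = {t-e..t+e}" by auto
  have "C1_curve_on X \<A> (t-e) (t+e) \<gamma>" using \<gamma> ab unfolding pcurve_def by blast
  then obtain w where w: "continuous_on {t-e..t+e} w"
    "\<And>s. s \<in> {t-e..t+e} \<Longrightarrow> ((chart_map c \<circ> \<gamma>) has_vector_derivative w s) (at s within {t-e..t+e})"
    using c dm eq unfolding C1_curve_on_def by (metis (no_types, lifting))
  have d: "((chart_map c \<circ> \<gamma>) has_vector_derivative w s) (at s)" if "s \<in> {t-e<..<t+e}" for s
    using w(2)[of s] that at_within_interior[of s "{t-e..t+e}"] by (auto simp: less_imp_le)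
  then have v: "velocity c \<gamma> s = w s" if "s \<in> {t-e<..<t+e}" for s
    using that by (simp add: velocity_def vector_derivative_at)
  show ?thesis
  proof (rule that[OF e(1)])
    fix s assume "\<bar>s - t\<bar> < e"
    then have s: "s \<in> {t-e<..<t+e}" "s \<in> {t-e..t+e}" by auto
    then show "regular \<gamma> B c s"
      using d v dm subsetD[OF sub s(2)] by auto
  next
    have "continuous_on {t-e<..<t+e} w" using w(1) by (rule continuous_on_subset) auto
    then show "continuous_on {t-e<..<t+e} (velocity c \<gamma>)"
      by (rule continuous_on_eq) (simp add: v)
  qed
qed

end

text \<open>Only continuity on \<open>S\<close> is assumed, as \<open>gP\<close> need not extend beyond the interior.\<close>

locale corner_metric = corner_manifold X \<A>
  for X :: "'a topology" and \<A> :: "('a, 'n::finite) chart set" +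
  fixes g :: "('a, 'n) tensor2" and S :: "'a set"
  assumes bil: "c \<in> \<A> \<Longrightarrow> p \<in> chart_dom c \<Longrightarrow> p \<in> S \<Longrightarrow> bilinear (g c p)"
    and cont: "c \<in> \<A> \<Longrightarrow> continuous_on (chart_map c ` (chart_dom c \<inter> S)) (\<lambda>x. g c (chart_inv c x) u v)"
    and law: "\<lbrakk>c \<in> \<A>; c' \<in> \<A>; p \<in> chart_dom c; p \<in> chart_dom c'; p \<in> S;
        ((chart_map c' \<circ> chart_inv c) has_derivative T)
          (at (chart_map c p) within chart_map c ` (chart_dom c \<inter> chart_dom c'))\<rbrakk>
        \<Longrightarrow> g c p u v = g c' p (T u) (T v)"
begin

text \<open>\<open>curve_speed\<close> evaluates the metric in a chart chosen by
  \<open>SOME\<close>. The chain rule for the transition from \<open>c\<close> to that chart and the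
  transformation law allow any convenient \<open>c\<close> instead.\<close>

lemma curve_speed_eq:
  assumes \<gamma>: "pcurve \<gamma> B" and t: "t \<in> {0<..<1} - B" and c: "c \<in> \<A>" and td: "\<gamma> t \<in> chart_dom c"
    and S: "\<gamma> t \<in> S"
  shows "curve_speed \<A> g \<gamma> t = sqrt (g c (\<gamma> t) (velocity c \<gamma> t) (velocity c \<gamma> t))"
proof -
  define c0 where "c0 = (SOME c. c \<in> \<A> \<and> \<gamma> t \<in> chart_dom c)"
  have c0: "c0 \<in> \<A>" "\<gamma> t \<in> chart_dom c0"
    using someI[of "\<lambda>c. c \<in> \<A> \<and> \<gamma> t \<in> chart_dom c" c] c td by (auto simp: c0_def)
  obtain e where e: "e > 0" "\<And>s. \<bar>s - t\<bar> < e \<Longrightarrow> regular \<gamma> B c s"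
    using pcurve_C1_near[OF \<gamma> t c td] by metis
  obtain e0 where e0: "e0 > 0" "\<And>s. \<bar>s - t\<bar> < e0 \<Longrightarrow> regular \<gamma> B c0 s"
    using pcurve_C1_near[OF \<gamma> t c0] by metis
  define U where "U = ball t (min e e0)"
  have U: "open U" "t \<in> U" using e(1) e0(1) by (auto simp: U_def)
  have Ud: "\<gamma> s \<in> chart_dom c \<inter> chart_dom c0" if "s \<in> U" for s
    using that e(2)[of s] e0(2)[of s] by (auto simp: U_def dist_real_def abs_minus_commute)
  let ?S = "chart_map c ` (chart_dom c \<inter> chart_dom c0)"
  obtain T where T: "((chart_map c0 \<circ> chart_inv c) has_derivative T) (at (chart_map c (\<gamma> t)) within ?S)"
    using transition_has_derivative[OF c c0(1) td c0(2)] .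
  have d1: "((chart_map c \<circ> \<gamma>) has_vector_derivative velocity c \<gamma> t) (at t within U)"
    using e(2)[of t] e(1) by (auto intro: has_vector_derivative_at_within)
  have "(\<lambda>s. (chart_map c \<circ> \<gamma>) s) ` U \<subseteq> ?S" using Ud by auto
  then have "((chart_map c0 \<circ> chart_inv c) has_derivative T) (at ((chart_map c \<circ> \<gamma>) t) within (chart_map c \<circ> \<gamma>) ` U)"
    using T by (auto intro: has_derivative_subset)
  from vector_derivative_diff_chain_within[OF d1 this]
  have d2: "((chart_map c0 \<circ> chart_inv c) \<circ> (chart_map c \<circ> \<gamma>) has_vector_derivative T (velocity c \<gamma> t)) (at t within U)" .
  have "((chart_map c0 \<circ> \<gamma>) has_vector_derivative T (velocity c \<gamma> t)) (at t within U)"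
    by (rule has_vector_derivative_transform[OF U(2) _ d2]) (use Ud inv_map[OF c] in auto)
  then have "((chart_map c0 \<circ> \<gamma>) has_vector_derivative T (velocity c \<gamma> t)) (at t)"
    by (simp only: at_within_open[OF U(2) U(1)])
  then have v: "vector_derivative (chart_map c0 \<circ> \<gamma>) (at t) = T (velocity c \<gamma> t)"
    by (rule vector_derivative_at)
  have w: "at t within {0..1} = at t" using t by (intro at_within_interior) auto
  have "curve_speed \<A> g \<gamma> t = sqrt (g c0 (\<gamma> t) (T (velocity c \<gamma> t)) (T (velocity c \<gamma> t)))"
    by (simp add: curve_speed_def c0_def[symmetric] w v Let_def)
  also have "\<dots> = sqrt (g c (\<gamma> t) (velocity c \<gamma> t) (velocity c \<gamma> t))"
    using law[OF c c0(1) td c0(2) S T] by simp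
  finally show ?thesis .
qed

text \<open>Continuity of the metric is assumed only for fixed vectors. Expanding in the basis
  reduces moving vectors, such as velocities, to finitely many coefficient functions.\<close>

lemma tensor_expand:
  assumes "c \<in> \<A>" "p \<in> chart_dom c" "p \<in> S"
  shows "g c p u v = (\<Sum>i\<in>UNIV. \<Sum>j\<in>UNIV. u $ i * v $ j * g c p (axis i 1) (axis j 1))"
proof -
  have b: "bilinear (g c p)" using bil assms by blast
  have "g c p (\<Sum>i\<in>UNIV. u $ i *s axis i 1) (\<Sum>j\<in>UNIV. v $ j *s axis j 1)
     = (\<Sum>(i,j)\<in>UNIV \<times> UNIV. g c p (u $ i *s axis i 1) (v $ j *s axis j 1))"
    by (rule bilinear_sum[OF b])
  also have "\<dots> = (\<Sum>i\<in>UNIV. \<Sum>j\<in>UNIV. u $ i * v $ j * g c p (axis i 1) (axis j 1))"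
    unfolding sum.cartesian_product[symmetric]
    by (simp add: scalar_mult_eq_scaleR bilinear_lmul[OF b] bilinear_rmul[OF b] mult_ac)
  finally show ?thesis by (simp add: basis_expansion)
qed

lemma curve_speed_continuous:
  assumes \<gamma>: "pcurve \<gamma> B" and S: "\<gamma> ` {0..1} \<subseteq> S"
  shows "continuous_on ({0<..<1} - B) (curve_speed \<A> g \<gamma>)"
proof (rule continuous_at_imp_continuous_on, rule ballI)
  fix t assume t: "t \<in> {0<..<1} - B"
  have "\<gamma> t \<in> topspace X" using \<gamma> t by (auto simp: pcurve_def continuous_map_def Pi_iff)
  then obtain c where c: "c \<in> \<A>" "\<gamma> t \<in> chart_dom c" using covered by blast
  obtain e where e: "e > 0" "\<And>s. \<bar>s - t\<bar> < e \<Longrightarrow> regular \<gamma> B c s"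
    "continuous_on {t-e<..<t+e} (velocity c \<gamma>)"
    using pcurve_C1_near[OF \<gamma> t c] by metis
  let ?U = "{t-e<..<t+e}"
  have in_dom: "\<gamma> s \<in> chart_dom c \<inter> S" "s \<in> {0<..<1} - B" if "s \<in> ?U" for s
  proof -
    have s: "\<bar>s - t\<bar> < e" using that by auto
    with e(2) show "s \<in> {0<..<1} - B" by blast
    then show "\<gamma> s \<in> chart_dom c \<inter> S" using e(2)[OF s] S by auto
  qed
  have cx: "continuous_on ?U (chart_map c \<circ> \<gamma>)"
  proof (intro continuous_at_imp_continuous_on ballI)
    fix s assume "s \<in> ?U"
    then have "\<bar>s - t\<bar> < e" by auto
    with e(2) show "isCont (chart_map c \<circ> \<gamma>) s" using has_vector_derivative_continuous by blast
  qed
  have cg: "continuous_on ?U (\<lambda>s. g c (\<gamma> s) u v)" for u v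
  proof -
    have "continuous_on ?U (\<lambda>s. g c (chart_inv c ((chart_map c \<circ> \<gamma>) s)) u v)"
      by (rule continuous_on_compose2[OF cont[OF c(1)] cx]) (use in_dom in auto)
    then show ?thesis by (rule continuous_on_eq) (use in_dom inv_map[OF c(1)] in auto)
  qed
  have "continuous_on ?U (\<lambda>s. sqrt (\<Sum>i\<in>UNIV. \<Sum>j\<in>UNIV. velocity c \<gamma> s $ i * velocity c \<gamma> s $ j
      * g c (\<gamma> s) (axis i 1) (axis j 1)))"
    by (intro continuous_intros e(3) cg)
  then have "continuous_on ?U (curve_speed \<A> g \<gamma>)"
    by (rule continuous_on_eq)
      (use in_dom c(1) in \<open>auto simp: curve_speed_eq[OF \<gamma> _ c(1)] tensor_expand[of c _ "velocity c \<gamma> _"]\<close>)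
  then show "isCont (curve_speed \<A> g \<gamma>) t"
    using e(1) by (simp add: continuous_on_eq_continuous_at)
qed

end

section \<open>Riemannian distance\<close>

lemma AE_notin_finite: "finite B \<Longrightarrow> AE t in lborel. t \<notin> (B :: real set)"
  by (intro AE_not_in finite_imp_null_set_lborel)

lemma ennreal_less_add:
  assumes "a < top" "0 < e"
  shows "a < a + ennreal e"
  using assms by (cases a) (auto simp: ennreal_less_iff simp flip: ennreal_plus)

section \<open>Affine reparametrization, reversal and concatenation of curves\<close>

context corner_manifold
begin

text \<open>One statement serves for restriction (\<open>k = 0\<close>, \<open>m = 1\<close>),
  reversal (\<open>m = -1\<close>) and both halves of a join (\<open>m = 2\<close>); hence
  \<open>\<delta>\<close> has to agree with the reparametrized curve only on
  \<open>{a..b}\<close>.\<close>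

lemma C1_curve_on_affine:
  assumes \<gamma>: "C1_curve_on X \<A> a' b' \<gamma>" and \<theta>: "\<And>t. t \<in> {a..b} \<Longrightarrow> k + m * t \<in> {a'..b'}"
    and \<delta>: "\<And>t. t \<in> {a..b} \<Longrightarrow> \<delta> t = \<gamma> (k + m * t)"
  shows "C1_curve_on X \<A> a b \<delta>"
  unfolding C1_curve_on_def
proof (intro conjI ballI)
  have c1: "continuous_map (top_of_set {a..b}) (top_of_set {a'..b'}) (\<lambda>t. k + m * t)"
    using \<theta> by (auto simp: continuous_map_in_subtopology intro!: continuous_intros)
  have "continuous_map (top_of_set {a..b}) X (\<gamma> \<circ> (\<lambda>t. k + m * t))"
    using \<gamma> by (intro continuous_map_compose[OF c1]) (simp add: C1_curve_on_def)
  then show "continuous_map (top_of_set {a..b}) X \<delta>"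
    by (rule continuous_map_eq) (simp add: \<delta>)
  fix c assume c: "c \<in> \<A>"
  obtain w where w: "continuous_on {t \<in> {a'..b'}. \<gamma> t \<in> chart_dom c} w"
    "\<And>t. t \<in> {a'..b'} \<Longrightarrow> \<gamma> t \<in> chart_dom c \<Longrightarrow>
       ((chart_map c \<circ> \<gamma>) has_vector_derivative w t) (at t within {a'..b'})"
    using \<gamma> c unfolding C1_curve_on_def by meson
  have "continuous_on {t \<in> {a..b}. \<delta> t \<in> chart_dom c} (\<lambda>t. w (k + m * t))"
    by (rule continuous_on_compose2[OF w(1)]) (use \<theta> \<delta> in \<open>auto intro!: continuous_intros\<close>)
  then have "continuous_on {t \<in> {a..b}. \<delta> t \<in> chart_dom c} (\<lambda>t. m *\<^sub>R w (k + m * t))"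
    by (intro continuous_intros)
  moreover have "((chart_map c \<circ> \<delta>) has_vector_derivative m *\<^sub>R w (k + m * t)) (at t within {a..b})"
    if t: "t \<in> {a..b}" "\<delta> t \<in> chart_dom c" for t
  proof -
    have 1: "((\<lambda>t. k + m * t) has_vector_derivative m) (at t within {a..b})"
      by (auto intro!: derivative_eq_intros simp: has_real_derivative_iff_has_vector_derivative[symmetric])
    have "((chart_map c \<circ> \<gamma>) has_vector_derivative w (k + m * t)) (at (k + m * t) within {a'..b'})"
      using w(2)[OF \<theta>[OF t(1)]] \<delta>[OF t(1)] t(2) by simp
    then have 2: "((chart_map c \<circ> \<gamma>) has_vector_derivative w (k + m * t))
        (at (k + m * t) within (\<lambda>t. k + m * t) ` {a..b})"
      by (rule has_vector_derivative_within_subset) (use \<theta> in auto)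
    show ?thesis
      by (rule has_vector_derivative_transform[OF t(1) _ vector_diff_chain_within[OF 1 2]])
        (simp add: \<delta>)
  qed
  ultimately show "\<exists>w. continuous_on {t \<in> {a..b}. \<delta> t \<in> chart_dom c} w \<and>
      (\<forall>t\<in>{a..b}. \<delta> t \<in> chart_dom c \<longrightarrow>
        ((chart_map c \<circ> \<delta>) has_vector_derivative w t) (at t within {a..b}))"
    by blast
qed

lemma pcurve_reverse:
  assumes \<gamma>: "pcurve \<gamma> B"
  shows "pcurve (\<lambda>t. \<gamma> (1 - t)) ((\<lambda>t. 1 - t) ` B)"
  unfolding pcurve_def
proof (intro conjI allI impI)
  have "continuous_map (top_of_set {0..1::real}) (top_of_set {0..1}) (\<lambda>t. 1 - t)"
    by (auto simp: continuous_map_in_subtopology intro!: continuous_intros)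
  from continuous_map_compose[OF this, of X \<gamma>]
  show "continuous_map (top_of_set {0..1}) X (\<lambda>t. \<gamma> (1 - t))"
    using \<gamma> by (simp add: pcurve_def o_def)
  show "finite ((\<lambda>t. 1 - t) ` B)" using \<gamma> by (simp add: pcurve_def)
  fix a b :: real assume ab: "0 \<le> a \<and> a < b \<and> b \<le> 1 \<and> {a<..<b} \<inter> (\<lambda>t. 1 - t) ` B = {}"
  have "{1-b<..<1-a} \<inter> B = {}"
  proof (rule ccontr)
    assume "{1-b<..<1-a} \<inter> B \<noteq> {}"
    then obtain t where t: "t \<in> B" "1 - b < t" "t < 1 - a" by auto
    then have "1 - t \<in> {a<..<b} \<inter> (\<lambda>t. 1 - t) ` B" by auto
    with ab show False by blast
  qed
  then have "C1_curve_on X \<A> (1-b) (1-a) \<gamma>"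
    using \<gamma> ab unfolding pcurve_def by simp
  then show "C1_curve_on X \<A> a b (\<lambda>t. \<gamma> (1 - t))"
    by (rule C1_curve_on_affine[where k=1 and m="-1"]) auto
qed

definition join :: "(real \<Rightarrow> 'a) \<Rightarrow> (real \<Rightarrow> 'a) \<Rightarrow> real \<Rightarrow> 'a" where
  "join \<gamma> \<delta> t = (if t \<le> 1/2 then \<gamma> (2 * t) else \<delta> (2 * t - 1))"

lemma pcurve_join:
  assumes \<gamma>: "pcurve \<gamma> B" and \<delta>: "pcurve \<delta> C" and eq: "\<gamma> 1 = \<delta> 0"
  shows "pcurve (join \<gamma> \<delta>) ({1/2} \<union> (\<lambda>t. t / 2) ` B \<union> (\<lambda>t. (t + 1) / 2) ` C)"
  unfolding pcurve_def
proof (intro conjI allI impI)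
  have "continuous_map (top_of_set {0..1}) X (\<lambda>t. if t \<le> 1/2 then \<gamma> (2 * t) else \<delta> (2 * t - 1))"
  proof (rule continuous_map_cases_le)
    have e: "subtopology (top_of_set {0..1}) {x \<in> topspace (top_of_set {0..1}). x \<le> 1/2} = top_of_set {0..1/2::real}"
      unfolding subtopology_subtopology by (rule arg_cong[where f=top_of_set]) auto
    have "continuous_map (top_of_set {0..1/2}) (top_of_set {0..1}) (\<lambda>t::real. 2 * t)"
      by (auto simp: continuous_map_in_subtopology intro!: continuous_intros)
    then have "continuous_map (top_of_set {0..1/2}) X (\<gamma> \<circ> (\<lambda>t. 2 * t))"
      by (rule continuous_map_compose) (use \<gamma> in \<open>simp add: pcurve_def\<close>)
    then show "continuous_map (subtopology (top_of_set {0..1}) {x \<in> topspace (top_of_set {0..1}). x \<le> 1/2}) X (\<lambda>t. \<gamma> (2 * t))"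
      unfolding e by (simp add: o_def)
    have e: "subtopology (top_of_set {0..1}) {x \<in> topspace (top_of_set {0..1}). 1/2 \<le> x} = top_of_set {1/2..1::real}"
      unfolding subtopology_subtopology by (rule arg_cong[where f=top_of_set]) auto
    have "continuous_map (top_of_set {1/2..1}) (top_of_set {0..1}) (\<lambda>t::real. 2 * t - 1)"
      by (auto simp: continuous_map_in_subtopology intro!: continuous_intros)
    then have "continuous_map (top_of_set {1/2..1}) X (\<delta> \<circ> (\<lambda>t. 2 * t - 1))"
      by (rule continuous_map_compose) (use \<delta> in \<open>simp add: pcurve_def\<close>)
    then show "continuous_map (subtopology (top_of_set {0..1}) {x \<in> topspace (top_of_set {0..1}). 1/2 \<le> x}) X (\<lambda>t. \<delta> (2 * t - 1))"
      unfolding e by (simp add: o_def)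
    fix t :: real assume "t \<in> topspace (top_of_set {0..1})" "t = 1/2"
    then have "2 * t = 1" "2 * t - 1 = 0" by auto
    then show "\<gamma> (2 * t) = \<delta> (2 * t - 1)" by (simp only: eq)
  qed (auto intro!: continuous_intros)
  then show "continuous_map (top_of_set {0..1}) X (join \<gamma> \<delta>)" unfolding join_def[abs_def] .
  show "finite ({1/2} \<union> (\<lambda>t. t / 2) ` B \<union> (\<lambda>t. (t + 1) / 2) ` C)"
    using \<gamma> \<delta> by (simp add: pcurve_def)
  fix a b :: real
  assume ab: "0 \<le> a \<and> a < b \<and> b \<le> 1 \<and> {a<..<b} \<inter> ({1/2} \<union> (\<lambda>t. t / 2) ` B \<union> (\<lambda>t. (t + 1) / 2) ` C) = {}"
  \<comment> \<open>The junction is a break point, so an interval free of break points lies in one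
    half.\<close>
  then have "1/2 \<notin> {a<..<b}" by blast
  then consider "b \<le> 1/2" | "1/2 \<le> a" by force
  then show "C1_curve_on X \<A> a b (join \<gamma> \<delta>)"
  proof cases
    case 1
    have "{2*a<..<2*b} \<inter> B = {}"
    proof (rule ccontr)
      assume "{2*a<..<2*b} \<inter> B \<noteq> {}"
      then obtain t where t: "t \<in> B" "2*a < t" "t < 2*b" by auto
      then have "t / 2 \<in> {a<..<b} \<inter> (\<lambda>t. t / 2) ` B" by auto
      with ab show False by blast
    qed
    then have "C1_curve_on X \<A> (2*a) (2*b) \<gamma>" using \<gamma> ab 1 unfolding pcurve_def by simp
    then show ?thesis
      by (rule C1_curve_on_affine[where k=0 and m=2]) (use 1 in \<open>auto simp: join_def\<close>)
  next
    case 2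
    have "{2*a-1<..<2*b-1} \<inter> C = {}"
    proof (rule ccontr)
      assume "{2*a-1<..<2*b-1} \<inter> C \<noteq> {}"
      then obtain t where t: "t \<in> C" "2*a-1 < t" "t < 2*b-1" by auto
      then have "(t + 1) / 2 \<in> {a<..<b} \<inter> (\<lambda>t. (t + 1) / 2) ` C" by auto
      with ab show False by blast
    qed
    then have "C1_curve_on X \<A> (2*a-1) (2*b-1) \<delta>" using \<delta> ab 2 unfolding pcurve_def by simp
    then show ?thesis
    proof (rule C1_curve_on_affine[where k="-1" and m=2])
      fix t assume t: "t \<in> {a..b}"
      \<comment> \<open>At the junction \<open>join\<close> takes the first branch; there the
        matching of the endpoints is needed.\<close>
      show "join \<gamma> \<delta> t = \<delta> (- 1 + 2 * t)"
      proof (cases "t = 1/2")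
        case True
        then have "2 * t = 1" "- 1 + 2 * t = 0" by auto
        then show ?thesis using True by (simp only: join_def eq) simp
      qed (use t 2 in \<open>auto simp: join_def\<close>)
    qed auto
  qed
qed

end

section \<open>Lengths of reversed and joined curves, and the pseudometric of a metric
  tensor\<close>

context corner_metric
begin

abbreviation speed_on :: "real set \<Rightarrow> (real \<Rightarrow> 'a) \<Rightarrow> real \<Rightarrow> real" where
  "speed_on B \<gamma> t \<equiv> if t \<in> {0<..<1} - B then curve_speed \<A> g \<gamma> t else 0"

text \<open>Endpoints and break points form a null set. Away from them the speed comes from a
  two-sided derivative and is continuous, so the extension by zero is measurable for curves in
  \<open>S\<close>.\<close>

lemma curve_length_eq:
  assumes \<gamma>: "pcurve \<gamma> B"
  shows "curve_length \<A> g \<gamma> =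
    (\<integral>\<^sup>+t. ennreal (speed_on B \<gamma> t) \<partial>lborel)"
  unfolding curve_length_def
proof (rule nn_integral_cong_AE)
  have "finite (insert 0 (insert 1 B))" using \<gamma> by (simp add: pcurve_def)
  from AE_notin_finite[OF this]
  show "AE t in lborel. ennreal (curve_speed \<A> g \<gamma> t) * indicator {0..1} t =
      ennreal (speed_on B \<gamma> t)"
    by eventually_elim (auto simp: indicator_def)
qed

lemma speed_measurable:
  assumes "pcurve \<gamma> B" "\<gamma> ` {0..1} \<subseteq> S"
  shows "speed_on B \<gamma> \<in> borel_measurable borel"
  using borel_measurable_continuous_on_open_part[OF open_regular curve_speed_continuous] assms by simp

lemma curve_speed_affine:
  assumes \<gamma>: "pcurve \<gamma> B" and u: "k + m * t \<in> {0<..<1} - B"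
    and \<delta>: "pcurve \<delta> C" and t: "t \<in> {0<..<1} - C" and e: "e > 0"
    and eq: "\<And>s. \<bar>s - t\<bar> < e \<Longrightarrow> \<delta> s = \<gamma> (k + m * s)" and S: "\<gamma> (k + m * t) \<in> S"
  shows "curve_speed \<A> g \<delta> t = \<bar>m\<bar> * curve_speed \<A> g \<gamma> (k + m * t)"
proof -
  have "\<gamma> (k + m * t) \<in> topspace X" using \<gamma> u by (auto simp: pcurve_def continuous_map_def Pi_iff)
  then obtain c where c: "c \<in> \<A>" "\<gamma> (k + m * t) \<in> chart_dom c" using covered by blast
  have dt: "\<delta> t = \<gamma> (k + m * t)" using eq[of t] e by simp
  obtain e' where "e' > 0" "\<And>s. \<bar>s - (k + m * t)\<bar> < e' \<Longrightarrow> regular \<gamma> B c s"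
    using pcurve_C1_near[OF \<gamma> u c] by metis
  then have d: "((chart_map c \<circ> \<gamma>) has_vector_derivative velocity c \<gamma> (k + m * t)) (at (k + m * t))"
    by simp
  have 1: "((\<lambda>t. k + m * t) has_vector_derivative m) (at t)"
    by (auto intro!: derivative_eq_intros simp: has_real_derivative_iff_has_vector_derivative[symmetric])
  have "((chart_map c \<circ> \<gamma>) \<circ> (\<lambda>t. k + m * t) has_vector_derivative m *\<^sub>R velocity c \<gamma> (k + m * t)) (at t)"
    by (rule vector_diff_chain_within[OF 1]) (use d in \<open>auto intro: has_vector_derivative_at_within\<close>)
  then have "((chart_map c \<circ> \<delta>) has_vector_derivative m *\<^sub>R velocity c \<gamma> (k + m * t)) (at t)"
    by (rule has_vector_derivative_transform_within[OF _ e]) (auto simp: eq dist_real_def)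
  then have v: "velocity c \<delta> t = m *\<^sub>R velocity c \<gamma> (k + m * t)"
    by (simp add: velocity_def vector_derivative_at)
  have b: "bilinear (g c (\<gamma> (k + m * t)))" using bil c S by blast
  show ?thesis
    using curve_speed_eq[OF \<delta> t c(1)] curve_speed_eq[OF \<gamma> u c S] dt c(2) S
    by (simp add: v bilinear_lmul[OF b] bilinear_rmul[OF b] real_sqrt_mult mult.assoc[symmetric])
qed

lemma curve_length_reverse:
  assumes \<gamma>: "pcurve \<gamma> B" and S: "\<gamma> ` {0..1} \<subseteq> S"
  shows "curve_length \<A> g (\<lambda>t. \<gamma> (1 - t)) = curve_length \<A> g \<gamma>"
proof -
  define f where "f t = ennreal (speed_on B \<gamma> t)" for t
  have fm: "f \<in> borel_measurable borel"
    unfolding f_def using speed_measurable[OF assms] by (rule measurable_compose[OF _ measurable_ennreal])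
  have "curve_length \<A> g (\<lambda>t. \<gamma> (1 - t)) = (\<integral>\<^sup>+t. ennreal \<bar>-1\<bar> * f (1 + (-1) * t) \<partial>lborel)"
    unfolding curve_length_eq[OF pcurve_reverse[OF \<gamma>]]
  proof (intro nn_integral_cong)
    fix t :: real
    have iff: "t \<in> {0<..<1} - (\<lambda>t. 1 - t) ` B \<longleftrightarrow> 1 - t \<in> {0<..<1} - B"
      by (auto simp: image_iff)
    have "curve_speed \<A> g (\<lambda>t. \<gamma> (1 - t)) t = \<bar>-1\<bar> * curve_speed \<A> g \<gamma> (1 + (-1) * t)"
      if "t \<in> {0<..<1} - (\<lambda>t. 1 - t) ` B"
      using that iff S
      by (intro curve_speed_affine[OF \<gamma> _ pcurve_reverse[OF \<gamma>], of 1 "-1" t 1]) auto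
    then show "ennreal (if t \<in> {0<..<1} - (\<lambda>t. 1 - t) ` B then curve_speed \<A> g (\<lambda>t. \<gamma> (1 - t)) t else 0)
        = ennreal \<bar>-1\<bar> * f (1 + (-1) * t)"
      using iff by (auto simp: f_def)
  qed
  also have "\<dots> = (\<integral>\<^sup>+t. f t \<partial>lborel)" by (rule nn_integral_affine[OF fm]) simp
  finally show ?thesis unfolding curve_length_eq[OF \<gamma>] f_def .
qed

text \<open>Almost everywhere the speed of the join is the sum of the two rescaled speeds, because
  each of these vanishes outside its own half. The substitution rule then absorbs the factors
  2.\<close>

lemma curve_length_join:
  assumes \<gamma>: "pcurve \<gamma> B" "\<gamma> ` {0..1} \<subseteq> S" and \<delta>: "pcurve \<delta> C" "\<delta> ` {0..1} \<subseteq> S" and eq: "\<gamma> 1 = \<delta> 0"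
  shows "curve_length \<A> g (join \<gamma> \<delta>) = curve_length \<A> g \<gamma> + curve_length \<A> g \<delta>"
proof -
  define f where "f t = ennreal (speed_on B \<gamma> t)" for t
  define h where "h t = ennreal (speed_on C \<delta> t)" for t
  have fm: "f \<in> borel_measurable borel"
    unfolding f_def using speed_measurable[OF \<gamma>] by (rule measurable_compose[OF _ measurable_ennreal])
  have hm: "h \<in> borel_measurable borel"
    unfolding h_def using speed_measurable[OF \<delta>] by (rule measurable_compose[OF _ measurable_ennreal])
  let ?D = "{1/2} \<union> (\<lambda>t. t / 2) ` B \<union> (\<lambda>t. (t + 1) / 2) ` C"
  note j = pcurve_join[OF \<gamma>(1) \<delta>(1) eq]
  have fin: "finite ?D" using j by (simp add: pcurve_def)
  have "curve_length \<A> g (join \<gamma> \<delta>) = (\<integral>\<^sup>+t. ennreal \<bar>2\<bar> * f (0 + 2 * t) + ennreal \<bar>2\<bar> * h (-1 + 2 * t) \<partial>lborel)"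
    unfolding curve_length_eq[OF j]
  proof (rule nn_integral_cong_AE)
    show "AE t in lborel. ennreal (if t \<in> {0<..<1} - ?D then curve_speed \<A> g (join \<gamma> \<delta>) t else 0)
        = ennreal \<bar>2\<bar> * f (0 + 2 * t) + ennreal \<bar>2\<bar> * h (-1 + 2 * t)"
      using AE_notin_finite[OF fin]
    proof eventually_elim
      fix t assume t: "t \<notin> ?D"
      have th: "t \<noteq> 1/2" using t by auto
      have tB: "2 * t \<notin> B" using t by (metis UnCI image_eqI nonzero_mult_div_cancel_left zero_neq_numeral)
      have tC: "2 * t - 1 \<notin> C"
      proof
        assume "2 * t - 1 \<in> C"
        then have "((2 * t - 1) + 1) / 2 \<in> (\<lambda>t. (t + 1) / 2) ` C" by (rule imageI)
        with t show False by simp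
      qed
      consider "t \<le> 0 \<or> 1 \<le> t" | "0 < t" "t < 1/2" | "1/2 < t" "t < 1" using th by fastforce
      then show "ennreal (if t \<in> {0<..<1} - ?D then curve_speed \<A> g (join \<gamma> \<delta>) t else 0)
        = ennreal \<bar>2\<bar> * f (0 + 2 * t) + ennreal \<bar>2\<bar> * h (-1 + 2 * t)"
      proof cases
        case 1
        then show ?thesis by (auto simp: f_def h_def)
      next
        case 2
        have "curve_speed \<A> g (join \<gamma> \<delta>) t = \<bar>2\<bar> * curve_speed \<A> g \<gamma> (0 + 2 * t)"
          by (rule curve_speed_affine[OF \<gamma>(1) _ j, where e="1/2 - t"])
            (use 2 tB t \<gamma>(2) in \<open>auto simp: join_def\<close>)
        then show ?thesis using 2 tB t by (simp add: f_def h_def ennreal_mult')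
      next
        case 3
        have "curve_speed \<A> g (join \<gamma> \<delta>) t = \<bar>2\<bar> * curve_speed \<A> g \<delta> (-1 + 2 * t)"
          by (rule curve_speed_affine[OF \<delta>(1) _ j, where e="t - 1/2"])
            (use 3 tC t \<delta>(2) in \<open>auto simp: join_def\<close>)
        then show ?thesis using 3 tC t by (simp add: f_def h_def ennreal_mult')
      qed
    qed
  qed
  also have "\<dots> = (\<integral>\<^sup>+t. ennreal \<bar>2\<bar> * f (0 + 2 * t) \<partial>lborel) + (\<integral>\<^sup>+t. ennreal \<bar>2\<bar> * h (-1 + 2 * t) \<partial>lborel)"
  proof (rule nn_integral_add)
    have [measurable]: "(\<lambda>t. k + m * t) \<in> borel_measurable borel" for k m :: real by measurable
    show "(\<lambda>t. ennreal \<bar>2\<bar> * f (0 + 2 * t)) \<in> borel_measurable lborel"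
      "(\<lambda>t. ennreal \<bar>2\<bar> * h (-1 + 2 * t)) \<in> borel_measurable lborel"
      using measurable_compose[OF _ fm, of "\<lambda>t. 0 + 2 * t" borel] measurable_compose[OF _ hm, of "\<lambda>t. -1 + 2 * t" borel]
      by auto
  qed
  also have "\<dots> = (\<integral>\<^sup>+t. f t \<partial>lborel) + (\<integral>\<^sup>+t. h t \<partial>lborel)"
    by (simp only: nn_integral_affine[OF fm] nn_integral_affine[OF hm] zero_neq_numeral[symmetric] not_False_eq_True)
  finally show ?thesis unfolding curve_length_eq[OF \<gamma>(1)] curve_length_eq[OF \<delta>(1)] f_def h_def .
qed

abbreviation dist_on :: "'a \<Rightarrow> 'a \<Rightarrow> ennreal" where
  "dist_on \<equiv> riemannian_distance X \<A> g S"

lemma dist_le_length: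
  assumes "pcurve \<gamma> B" "\<gamma> ` {0..1} \<subseteq> S" "\<gamma> 0 = p" "\<gamma> 1 = q"
  shows "dist_on p q \<le> curve_length \<A> g \<gamma>"
  unfolding riemannian_distance_def
  by (rule INF_lower) (use assms in \<open>auto simp: piecewise_C1_curve_iff\<close>)

lemma dist_greatest:
  assumes "\<And>\<gamma> B. \<lbrakk>pcurve \<gamma> B; \<gamma> ` {0..1} \<subseteq> S; \<gamma> 0 = p; \<gamma> 1 = q\<rbrakk> \<Longrightarrow> r \<le> curve_length \<A> g \<gamma>"
  shows "r \<le> dist_on p q"
  unfolding riemannian_distance_def
  by (rule INF_greatest) (use assms in \<open>auto simp: piecewise_C1_curve_iff\<close>)

lemma dist_less_curve:
  assumes "dist_on p q < r"
  obtains \<gamma> B where "pcurve \<gamma> B" "\<gamma> ` {0..1} \<subseteq> S" "\<gamma> 0 = p" "\<gamma> 1 = q" "curve_length \<A> g \<gamma> < r"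
  using assms dist_greatest[of p q r] by (meson leD not_le)

lemma dist_sym_le: "dist_on p q \<le> dist_on q p"
proof (rule dist_greatest)
  fix \<gamma> B assume \<gamma>: "pcurve \<gamma> B" "\<gamma> ` {0..1} \<subseteq> S" "\<gamma> 0 = q" "\<gamma> 1 = p"
  have "dist_on p q \<le> curve_length \<A> g (\<lambda>t. \<gamma> (1 - t))"
    by (rule dist_le_length[OF pcurve_reverse[OF \<gamma>(1)]]) (use \<gamma> in auto)
  then show "dist_on p q \<le> curve_length \<A> g \<gamma>" using curve_length_reverse[OF \<gamma>(1,2)] by simp
qed

lemma dist_triangle: "dist_on p r \<le> dist_on p q + dist_on q r"
proof (rule ennreal_le_epsilon)
  fix e :: real assume fin: "dist_on p q + dist_on q r < top" and e: "0 < e"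
  have "dist_on p q < dist_on p q + ennreal (e / 2)" using fin e by (intro ennreal_less_add) (auto simp: less_top)
  then obtain \<gamma> B where \<gamma>: "pcurve \<gamma> B" "\<gamma> ` {0..1} \<subseteq> S" "\<gamma> 0 = p" "\<gamma> 1 = q"
    "curve_length \<A> g \<gamma> < dist_on p q + ennreal (e / 2)"
    by (rule dist_less_curve)
  have "dist_on q r < dist_on q r + ennreal (e / 2)" using fin e by (intro ennreal_less_add) (auto simp: less_top)
  then obtain \<delta> C where \<delta>: "pcurve \<delta> C" "\<delta> ` {0..1} \<subseteq> S" "\<delta> 0 = q" "\<delta> 1 = r"
    "curve_length \<A> g \<delta> < dist_on q r + ennreal (e / 2)"
    by (rule dist_less_curve)
  have eq: "\<gamma> 1 = \<delta> 0" using \<gamma> \<delta> by simp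
  have "dist_on p r \<le> curve_length \<A> g (join \<gamma> \<delta>)"
  proof (rule dist_le_length[OF pcurve_join[OF \<gamma>(1) \<delta>(1) eq]])
    show "join \<gamma> \<delta> ` {0..1} \<subseteq> S" using \<gamma>(2) \<delta>(2) by (auto simp: join_def image_subset_iff)
  qed (use \<gamma> \<delta> in \<open>auto simp: join_def\<close>)
  also have "\<dots> = curve_length \<A> g \<gamma> + curve_length \<A> g \<delta>"
    by (rule curve_length_join[OF \<gamma>(1,2) \<delta>(1,2) eq])
  also have "\<dots> \<le> (dist_on p q + ennreal (e / 2)) + (dist_on q r + ennreal (e / 2))"
    using \<gamma>(5) \<delta>(5) by (intro add_mono) auto
  also have "\<dots> = dist_on p q + dist_on q r + (ennreal (e / 2) + ennreal (e / 2))" by (simp add: ac_simps)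
  also have "ennreal (e / 2) + ennreal (e / 2) = ennreal e"
    using e by (simp flip: ennreal_plus)
  finally show "dist_on p r \<le> dist_on p q + dist_on q r + ennreal e" .
qed

sublocale ext_pseudometric M dist_on for M
  by unfold_locales (auto intro: antisym dist_sym_le dist_triangle)

end

section \<open>Segments and exit estimates in a chart\<close>

context corner_manifold
begin

lemma compactin_chart_inv_image:
  assumes c: "c \<in> \<A>" and K: "compact K" "K \<subseteq> chart_image c"
  shows "compactin X (chart_inv c ` K)"
  by (rule image_compactin[OF _ inv_continuous[OF c]]) (use K in \<open>simp add: compactin_subtopology\<close>)

lemma closed_corner: "closed (corner K :: (real^'n) set)"
proof -
  have "corner K = (\<Inter>j\<in>K. {x :: real^'n. 0 \<le> x $ j})" by (auto simp: corner_def)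
  then show ?thesis by (auto intro!: closed_INT closed_Collect_le continuous_intros)
qed

text \<open>In \<open>c\<close> the segment is smooth, but a curve must have a continuous derivative
  in every chart. Near each parameter the transition map extends to a differentiable
  \<open>F\<close> on an open set, which also handles segments that run along the boundary.\<close>

lemma pcurve_segment:
  assumes c: "c \<in> \<A>" and seg: "\<And>t. t \<in> {0..1} \<Longrightarrow> a + t *\<^sub>R v \<in> chart_image c"
  shows "pcurve (\<lambda>t. chart_inv c (a + t *\<^sub>R v)) {}" (is "pcurve ?\<gamma> {}")
proof -
  have "continuous_map (top_of_set {0..1}) (top_of_set (chart_image c)) (\<lambda>t. a + t *\<^sub>R v)"
    using seg by (auto simp: continuous_map_in_subtopology intro!: continuous_intros)
  from continuous_map_compose[OF this inv_continuous[OF c]]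
  have cont: "continuous_map (top_of_set {0..1}) X ?\<gamma>" by (simp add: o_def)
  have main: "\<exists>w. continuous_on {t \<in> {0..1}. ?\<gamma> t \<in> chart_dom c'} w \<and>
        (\<forall>t\<in>{0..1}. ?\<gamma> t \<in> chart_dom c' \<longrightarrow>
           ((chart_map c' \<circ> ?\<gamma>) has_vector_derivative w t) (at t within {0..1}))"
    if c': "c' \<in> \<A>" for c'
  proof -
    let ?N = "{t \<in> {0..1}. ?\<gamma> t \<in> chart_dom c'}"
    let ?S = "chart_map c ` (chart_dom c \<inter> chart_dom c')"
    \<comment> \<open>The extension \<open>F\<close> changes from point to point; with
      \<open>w\<close> defined by the derivative itself, the local formulas agree.\<close>
    define w where "w t = vector_derivative (chart_map c' \<circ> ?\<gamma>) (at t within {0..1})" for t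
    have "openin (top_of_set {0..1}) ?N"
      using openin_continuous_map_preimage[OF cont dom_open[OF c']] by simp
    then obtain O1 where O1: "open O1" "?N = {0..1} \<inter> O1" unfolding openin_open by blast
    have inS: "a + t *\<^sub>R v \<in> ?S" if "t \<in> ?N" for t
    proof -
      have "a + t *\<^sub>R v = chart_map c (?\<gamma> t)" using map_inv[OF seg, of t] that by simp
      moreover have "?\<gamma> t \<in> chart_dom c \<inter> chart_dom c'" using inv_in_dom[OF seg, of t] that by simp
      ultimately show ?thesis by (metis imageI)
    qed
    have loc: "\<exists>U. open U \<and> t0 \<in> U \<and> continuous_on ({0..1} \<inter> U) w \<and>
        (\<forall>t\<in>{0..1} \<inter> U. ((chart_map c' \<circ> ?\<gamma>) has_vector_derivative w t) (at t within {0..1}))"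
      if t0: "t0 \<in> ?N" for t0
    proof -
      obtain W F F' where W: "open W" "a + t0 *\<^sub>R v \<in> W"
        "\<And>y. y \<in> W \<Longrightarrow> (F has_derivative F' y) (at y)" "\<And>u. continuous_on W (\<lambda>y. F' y u)"
        "\<And>y. y \<in> ?S \<Longrightarrow> y \<in> W \<Longrightarrow> F y = (chart_map c' \<circ> chart_inv c) y"
        using smooth_on_C1[OF transition_smooth[OF c c'] inS[OF t0]] by metis
      define U where "U = O1 \<inter> (\<lambda>t. a + t *\<^sub>R v) -` W"
      have "open ((\<lambda>t. a + t *\<^sub>R v) -` W)"
        by (rule open_vimage[OF W(1)]) (intro continuous_intros)
      then have U: "open U" "t0 \<in> U" using O1 t0 W(2) by (auto simp: U_def)
      have F: "(chart_map c' \<circ> ?\<gamma>) t = F (a + t *\<^sub>R v)" if "t \<in> {0..1} \<inter> U" for t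
      proof -
        have "t \<in> ?N" using that O1(2) by (auto simp: U_def)
        with W(5)[OF inS] that show ?thesis by (auto simp: U_def)
      qed
      have d: "((chart_map c' \<circ> ?\<gamma>) has_vector_derivative F' (a + t *\<^sub>R v) v) (at t within {0..1})"
        if t: "t \<in> {0..1} \<inter> U" for t
      proof -
        obtain r where r: "r > 0" "ball t r \<subseteq> U" using U(1) t by (meson IntD2 openE)
        have 1: "((\<lambda>t. a + t *\<^sub>R v) has_vector_derivative v) (at t within {0..1})"
          by (auto intro!: derivative_eq_intros)
        have 2: "(F has_derivative F' (a + t *\<^sub>R v)) (at (a + t *\<^sub>R v) within (\<lambda>t. a + t *\<^sub>R v) ` {0..1})"
          using W(3)[of "a + t *\<^sub>R v"] t by (auto simp: U_def intro: has_derivative_at_withinI)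
        show ?thesis
        proof (rule has_vector_derivative_transform_within[OF vector_derivative_diff_chain_within[OF 1 2] r(1)])
          fix s assume "s \<in> {0..1}" "dist s t < r"
          then have "s \<in> {0..1} \<inter> U" using r(2) by (auto simp: dist_commute)
          then show "(F \<circ> (\<lambda>t. a + t *\<^sub>R v)) s = (chart_map c' \<circ> ?\<gamma>) s" using F by simp
        qed (use t in auto)
      qed
      have w: "w t = F' (a + t *\<^sub>R v) v" if t: "t \<in> {0..1} \<inter> U" for t
        unfolding w_def
        by (rule vector_derivative_within_closed_interval[OF _ _ d[OF t]]) (use t in auto)
      have "continuous_on ({0..1} \<inter> U) (\<lambda>t. F' (a + t *\<^sub>R v) v)"
        by (rule continuous_on_compose2[OF W(4)[of v]]) (auto simp: U_def intro!: continuous_intros)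
      then have "continuous_on ({0..1} \<inter> U) w"
        by (rule continuous_on_eq) (simp add: w)
      with U d w show ?thesis by (intro exI[of _ U]) simp
    qed
    have "continuous_on ?N w"
    proof (clarsimp simp: continuous_on_eq_continuous_within simp del: atLeastAtMost_iff)
      fix t0 assume t0: "t0 \<in> {0..1}" "?\<gamma> t0 \<in> chart_dom c'"
      then obtain U where U: "open U" "t0 \<in> U" "continuous_on ({0..1} \<inter> U) w" using loc[of t0] by blast
      have "continuous (at t0 within ({0..1} \<inter> U)) w"
        using U t0 by (auto simp: continuous_on_eq_continuous_within)
      then have "continuous (at t0 within {0..1}) w"
        using at_within_nhd[OF U(2,1), of "{0..1} \<inter> U" "{0..1}"] by auto
      then show "continuous (at t0 within ?N) w"
        by (rule continuous_within_subset) auto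
    qed
    with loc show ?thesis by (intro exI[of _ w]) blast
  qed
  show ?thesis unfolding pcurve_def
  proof (intro conjI allI impI cont finite.emptyI)
    fix \<alpha> \<beta> :: real assume ab: "0 \<le> \<alpha> \<and> \<alpha> < \<beta> \<and> \<beta> \<le> 1 \<and> {\<alpha><..<\<beta>} \<inter> {} = {}"
    have "C1_curve_on X \<A> 0 1 ?\<gamma>" unfolding C1_curve_on_def by (intro conjI ballI cont main)
    then show "C1_curve_on X \<A> \<alpha> \<beta> ?\<gamma>"
      by (rule C1_curve_on_affine[where k=0 and m=1]) (use ab in simp_all)
  qed
qed

end

context corner_metric
begin

text \<open>The bound \<open>h\<close> is demanded only on the open interval: along an inward
  segment it is a multiple of \<open>s powr (- (A / 2))\<close>, which blows up towards the start
  while its value at \<open>s = 0\<close> is 0.\<close>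

lemma segment_dist_le:
  assumes c: "c \<in> \<A>" and seg: "\<And>t. t \<in> {0..1} \<Longrightarrow> a + t *\<^sub>R v \<in> chart_image c"
    and S: "\<And>t. t \<in> {0..1} \<Longrightarrow> chart_inv c (a + t *\<^sub>R v) \<in> S"
    and h: "\<And>t. t \<in> {0<..<1} \<Longrightarrow> 0 \<le> h t \<and> g c (chart_inv c (a + t *\<^sub>R v)) v v \<le> (h t)\<^sup>2"
  shows "dist_on (chart_inv c a) (chart_inv c (a + v)) \<le> (\<integral>\<^sup>+t\<in>{0..1}. ennreal (h t) \<partial>lborel)"
proof -
  let ?\<gamma> = "\<lambda>t. chart_inv c (a + t *\<^sub>R v)"
  note p = pcurve_segment[OF c seg]
  have "dist_on (chart_inv c a) (chart_inv c (a + v)) \<le> curve_length \<A> g ?\<gamma>"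
    by (rule dist_le_length[OF p]) (use S in auto)
  also have "\<dots> = (\<integral>\<^sup>+t. ennreal (if t \<in> {0<..<1} - {} then curve_speed \<A> g ?\<gamma> t else 0) \<partial>lborel)"
    by (rule curve_length_eq[OF p])
  also have "\<dots> \<le> (\<integral>\<^sup>+t\<in>{0..1}. ennreal (h t) \<partial>lborel)"
  proof (rule nn_integral_mono)
    fix t :: real
    have "curve_speed \<A> g ?\<gamma> t \<le> h t" if t: "t \<in> {0<..<1}"
    proof -
      have t': "t \<in> {0..1}" using t by auto
      have "((\<lambda>t. a + t *\<^sub>R v) has_vector_derivative v) (at t)"
        by (auto intro!: derivative_eq_intros)
      then have "((chart_map c \<circ> ?\<gamma>) has_vector_derivative v) (at t)"
        by (rule has_vector_derivative_transform_within_open[of _ _ _ "{0<..<1}"]) (use t in \<open>auto simp: map_inv[OF seg]\<close>)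
      then have v: "velocity c ?\<gamma> t = v" by (simp add: velocity_def vector_derivative_at)
      have "curve_speed \<A> g ?\<gamma> t = sqrt (g c (?\<gamma> t) v v)"
        using curve_speed_eq[OF p _ c _ S[OF t']] t inv_in_dom[OF seg[OF t']] v by simp
      also have "\<dots> \<le> sqrt ((h t)\<^sup>2)" using h[OF t] by (intro real_sqrt_le_mono) simp
      also have "\<dots> = h t" using h[OF t] by simp
      finally show ?thesis .
    qed
    then show "ennreal (if t \<in> {0<..<1} - {} then curve_speed \<A> g ?\<gamma> t else 0) \<le> ennreal (h t) * indicator {0..1} t"
      by (auto simp: indicator_def intro: ennreal_leI)
  qed
  finally show ?thesis .
qed

text \<open>The curve is followed up to its first exit from the coordinate ball of radius
  \<open>\<kappa>\<close> around \<open>x0\<close>. It starts within half the radius, so its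
  coordinates move by at least \<open>\<kappa> / 2\<close>, and \<open>low\<close> bounds its speed
  from below by \<open>m\<close> times the coordinate speed.\<close>

lemma exit_length:
  assumes \<gamma>: "pcurve \<gamma> B" "\<gamma> ` {0..1} \<subseteq> S" and c: "c \<in> \<A>"
    and start: "\<gamma> 0 \<in> chart_dom c" "norm (chart_map c (\<gamma> 0) - x0) \<le> \<kappa> / 2" and \<kappa>: "\<kappa> > 0"
    and image: "cball x0 \<kappa> \<inter> corner (chart_faces c) \<subseteq> chart_image c"
    and out: "\<not> (\<gamma> 1 \<in> chart_dom c \<and> norm (chart_map c (\<gamma> 1) - x0) < \<kappa>)"
    and m: "m \<ge> 0" and low: "\<And>y v. \<lbrakk>y \<in> S; y \<in> chart_dom c; norm (chart_map c y - x0) < \<kappa>\<rbrakk>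
      \<Longrightarrow> m\<^sup>2 * (norm v)\<^sup>2 \<le> g c y v v"
  shows "ennreal (m * \<kappa> / 2) \<le> curve_length \<A> g \<gamma>"
proof -
  define \<Omega> where "\<Omega> = {q \<in> chart_dom c. chart_map c q \<in> ball x0 \<kappa>}"
  have \<Omega>: "q \<in> \<Omega> \<longleftrightarrow> q \<in> chart_dom c \<and> norm (chart_map c q - x0) < \<kappa>" for q
    by (auto simp: \<Omega>_def dist_norm norm_minus_commute)
  have "openin (top_of_set {0..1}) {t \<in> {0..1}. \<gamma> t \<in> \<Omega>}"
    unfolding \<Omega>_def by (intro pcurve_preimage_open[OF \<gamma>(1)] openin_chart_preimage[OF c]) simp
  then obtain T where T: "open T" "{t \<in> {0..1}. \<gamma> t \<in> \<Omega>} = {0..1} \<inter> T" unfolding openin_open by blast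
  \<comment> \<open>\<open>T\<close> marks the times inside the ball, so the least element of the
    complement is the exit time.\<close>
  have "compact ({0..1} - T)" using T(1) by (simp add: compact_diff)
  moreover have "1 \<in> {0..1} - T" using T(2) out \<Omega>[of "\<gamma> 1"] by fastforce
  ultimately obtain \<tau> where \<tau>: "\<tau> \<in> {0..1} - T" "\<And>t. t \<in> {0..1} - T \<Longrightarrow> \<tau> \<le> t"
    using compact_attains_inf[of "{0..1} - T"] by blast
  have before: "\<gamma> t \<in> \<Omega>" if "t \<in> {0..1}" "t < \<tau>" for t
  proof -
    have "t \<in> T" using \<tau>(2)[of t] that by force
    then have "t \<in> {0..1} \<inter> T" using that by blast
    then show ?thesis using T(2) by blast
  qed
  have "\<gamma> \<tau> \<notin> \<Omega>" using \<tau>(1) T(2) by blast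
  have "\<gamma> 0 \<in> \<Omega>" using start \<kappa> by (simp add: \<Omega>)
  with \<open>\<gamma> \<tau> \<notin> \<Omega>\<close> have "\<tau> \<noteq> 0" by metis
  with \<tau>(1) have \<tau>01: "0 < \<tau>" "\<tau> \<le> 1" by auto
  \<comment> \<open>A priori the curve might leave the chart domain without reaching the sphere of
    radius \<open>\<kappa>\<close>. The part of \<open>X\<close> over the closed ball is compact,
    hence closed in the Hausdorff space \<open>X\<close>; so it still contains
    \<open>\<gamma> \<tau>\<close>, which is thus in the chart.\<close>
  let ?K = "chart_inv c ` (cball x0 \<kappa> \<inter> corner (chart_faces c))"
  have "closedin X ?K"
    by (intro compactin_imp_closedin[OF Hausdorff] compactin_chart_inv_image[OF c] image)
      (simp add: closed_corner compact_Int_closed)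
  then have "closedin (top_of_set {0..1}) {t \<in> {0..1}. \<gamma> t \<in> ?K}"
    using closedin_continuous_map_preimage[of "top_of_set {0..1}" X \<gamma> ?K] \<gamma>(1) by (simp add: pcurve_def)
  then have cl: "closed {t \<in> {0..1}. \<gamma> t \<in> ?K}" by (rule closedin_closed_trans) simp
  have "{0..<\<tau>} \<subseteq> {t \<in> {0..1}. \<gamma> t \<in> ?K}"
  proof
    fix t assume "t \<in> {0..<\<tau>}"
    then have t: "t \<in> {0..1}" "t < \<tau>" using \<tau>01 by auto
    have q: "\<gamma> t \<in> chart_dom c" "chart_map c (\<gamma> t) \<in> ball x0 \<kappa>" using before[OF t] by (auto simp: \<Omega>_def)
    then have "chart_map c (\<gamma> t) \<in> cball x0 \<kappa> \<inter> corner (chart_faces c)"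
      using image_corner[OF c map_in_image] by auto
    then have "chart_inv c (chart_map c (\<gamma> t)) \<in> ?K" by (rule imageI)
    then show "t \<in> {t \<in> {0..1}. \<gamma> t \<in> ?K}" using t inv_map[OF c q(1)] by simp
  qed
  then have "closure {0..<\<tau>} \<subseteq> {t \<in> {0..1}. \<gamma> t \<in> ?K}" using cl by (rule closure_minimal)
  then have inK: "\<gamma> t \<in> ?K" if "t \<in> {0..\<tau>}" for t
    using that \<tau>01 by (auto simp: closure_atLeastLessThan)
  have dom: "\<gamma> t \<in> chart_dom c" if t: "t \<in> {0..\<tau>}" for t
  proof -
    obtain x where "x \<in> cball x0 \<kappa> \<inter> corner (chart_faces c)" "\<gamma> t = chart_inv c x"
      using inK[OF t] by (elim imageE) auto
    then show ?thesis using inv_in_dom subsetD[OF image] by metis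
  qed
  let ?f = "\<lambda>t. chart_map c (\<gamma> t)"
  have "continuous_map (top_of_set {0..\<tau>}) (subtopology X (chart_dom c)) \<gamma>"
  proof -
    have "continuous_map (top_of_set {0..\<tau>}) X \<gamma>"
      using \<gamma>(1) \<tau>01 continuous_map_from_subtopology_mono[of euclidean "{0..1}" X \<gamma> "{0..\<tau>}"]
      by (auto simp: pcurve_def)
    then show ?thesis using dom by (auto simp: continuous_map_in_subtopology)
  qed
  from continuous_map_compose[OF this map_continuous[OF c]]
  have cf: "continuous_on {0..\<tau>} ?f" by (simp add: o_def)
  have far: "\<kappa> / 2 \<le> norm (?f \<tau> - ?f 0)"
  proof -
    have "\<kappa> \<le> norm (?f \<tau> - x0)" using \<open>\<gamma> \<tau> \<notin> \<Omega>\<close> dom[of \<tau>] \<tau>01 by (auto simp: \<Omega>)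
    moreover have "norm (?f \<tau> - x0) \<le> norm (?f \<tau> - ?f 0) + norm (?f 0 - x0)"
      using norm_triangle_ineq[of "?f \<tau> - ?f 0" "?f 0 - x0"] by simp
    ultimately show ?thesis using start(2) by linarith
  qed
  have reg: "t \<in> {0<..<1} - B" "t \<in> {0..\<tau>}" if "t \<in> {0<..<\<tau>} - B" for t using that \<tau>01 by auto
  have "ennreal (norm (m *\<^sub>R ?f \<tau> - m *\<^sub>R ?f 0)) \<le>
      (\<integral>\<^sup>+t. (if t \<in> {0<..<\<tau>} - B then ennreal (norm (m *\<^sub>R velocity c \<gamma> t)) else 0) \<partial>lborel)"
  proof (rule norm_diff_le_nn_integral_derivative)
    show "finite B" using \<gamma>(1) by (simp add: pcurve_def)
    show "continuous_on {0..\<tau>} (\<lambda>t. m *\<^sub>R ?f t)" by (intro continuous_intros cf)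
    show "((\<lambda>t. m *\<^sub>R ?f t) has_vector_derivative m *\<^sub>R velocity c \<gamma> t) (at t)"
      if t: "t \<in> {0<..<\<tau>} - B" for t
    proof -
      obtain e where "e > 0" "\<And>s. \<bar>s - t\<bar> < e \<Longrightarrow> regular \<gamma> B c s"
        using pcurve_C1_near[OF \<gamma>(1) reg(1)[OF t] c dom[OF reg(2)[OF t]]] by metis
      then have "(?f has_vector_derivative velocity c \<gamma> t) (at t)" by (simp add: o_def)
      then show ?thesis by (auto intro!: derivative_eq_intros)
    qed
    show "continuous_on ({0<..<\<tau>} - B) (\<lambda>t. m *\<^sub>R velocity c \<gamma> t)"
    proof (intro continuous_intros continuous_at_imp_continuous_on ballI)
      fix t assume t: "t \<in> {0<..<\<tau>} - B"
      obtain e where "e > 0" "continuous_on {t-e<..<t+e} (velocity c \<gamma>)"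
        using pcurve_C1_near[OF \<gamma>(1) reg(1)[OF t] c dom[OF reg(2)[OF t]]] by metis
      then show "isCont (velocity c \<gamma>) t" by (simp add: continuous_on_eq_continuous_at)
    qed
  qed (use \<tau>01 in simp)
  also have "\<dots> \<le> (\<integral>\<^sup>+t. ennreal (speed_on B \<gamma> t) \<partial>lborel)"
  proof (rule nn_integral_mono)
    fix t :: real
    have "norm (m *\<^sub>R velocity c \<gamma> t) \<le> curve_speed \<A> g \<gamma> t" if t: "t \<in> {0<..<\<tau>} - B"
    proof -
      have S: "\<gamma> t \<in> S" using \<gamma>(2) reg(1)[OF t] by auto
      have "norm (chart_map c (\<gamma> t) - x0) < \<kappa>" using before[of t] t reg(1)[OF t] by (auto simp: \<Omega>)
      then have "sqrt (m\<^sup>2 * (norm (velocity c \<gamma> t))\<^sup>2) \<le> curve_speed \<A> g \<gamma> t"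
        using low[OF S dom[OF reg(2)[OF t]]] curve_speed_eq[OF \<gamma>(1) reg(1)[OF t] c dom[OF reg(2)[OF t]] S] by simp
      then show ?thesis using m by (simp add: real_sqrt_mult)
    qed
    then show "(if t \<in> {0<..<\<tau>} - B then ennreal (norm (m *\<^sub>R velocity c \<gamma> t)) else 0)
        \<le> ennreal (speed_on B \<gamma> t)"
      using reg by (auto intro: ennreal_leI simp del: norm_scaleR)
  qed
  also have "\<dots> = curve_length \<A> g \<gamma>" by (rule curve_length_eq[OF \<gamma>(1), symmetric])
  finally have "ennreal (norm (m *\<^sub>R ?f \<tau> - m *\<^sub>R ?f 0)) \<le> curve_length \<A> g \<gamma>" .
  moreover have "m * \<kappa> / 2 \<le> norm (m *\<^sub>R ?f \<tau> - m *\<^sub>R ?f 0)"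
    using mult_left_mono[OF far m] m by (simp flip: scaleR_diff_right)
  ultimately show ?thesis by (meson ennreal_leI order_trans)
qed

lemma exit_dist:
  assumes "c \<in> \<A>" "p \<in> chart_dom c" "norm (chart_map c p - x0) \<le> \<kappa> / 2" "\<kappa> > 0"
    "cball x0 \<kappa> \<inter> corner (chart_faces c) \<subseteq> chart_image c"
    "\<not> (q \<in> chart_dom c \<and> norm (chart_map c q - x0) < \<kappa>)" "m \<ge> 0"
    "\<And>y v. \<lbrakk>y \<in> S; y \<in> chart_dom c; norm (chart_map c y - x0) < \<kappa>\<rbrakk> \<Longrightarrow> m\<^sup>2 * (norm v)\<^sup>2 \<le> g c y v v"
  shows "ennreal (m * \<kappa> / 2) \<le> dist_on p q"
  by (rule dist_greatest) (rule exit_length; use assms in blast)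

end

section \<open>Invariance of strata\<close>

text \<open>Only the coordinates that vanish at \<open>x\<close> restrict the direction; the other
  constrained ones are positive and stay so for a short time.\<close>

lemma corner_ray:
  fixes S :: "(real^'n::finite) set"
  assumes S: "openin (top_of_set (corner K)) S" "x \<in> S" and v: "\<And>j. j \<in> K \<Longrightarrow> x $ j = 0 \<Longrightarrow> 0 \<le> v $ j"
  obtains d where "d > 0" "\<And>s. s \<in> {0..d} \<Longrightarrow> x + s *\<^sub>R v \<in> S"
proof -
  obtain T where T: "open T" "S = corner K \<inter> T" using S(1) by (auto simp: openin_open)
  have xK: "x \<in> corner K" and xT: "x \<in> T" using S(2) T(2) by auto
  have "\<forall>\<^sub>F s in at_right 0. \<forall>j\<in>K. 0 \<le> (x + s *\<^sub>R v) $ j"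
  proof (subst eventually_ball_finite_distrib, simp, rule ballI)
    fix j assume j: "j \<in> K"
    show "\<forall>\<^sub>F s in at_right 0. 0 \<le> (x + s *\<^sub>R v) $ j"
    proof (cases "x $ j = 0")
      case True
      then show ?thesis using v[OF j True]
        by (auto simp: eventually_at_right_field intro!: exI[of _ 1])
    next
      case False
      then have "0 < x $ j" using xK j by (force simp: corner_def)
      moreover have "((\<lambda>s. (x + s *\<^sub>R v) $ j) \<longlongrightarrow> (x + 0 *\<^sub>R v) $ j) (at_right 0)"
        by (intro tendsto_intros)
      ultimately have "\<forall>\<^sub>F s in at_right 0. 0 < (x + s *\<^sub>R v) $ j"
        by (intro order_tendstoD(1)) auto
      then show ?thesis by eventually_elim simp
    qed
  qed
  moreover have "\<forall>\<^sub>F s in at_right 0. x + s *\<^sub>R v \<in> T"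
  proof (rule topological_tendstoD[OF _ T(1)])
    show "((\<lambda>s. x + s *\<^sub>R v) \<longlongrightarrow> x + 0 *\<^sub>R v) (at_right 0)" by (intro tendsto_intros)
  qed (use xT in simp)
  ultimately have "\<forall>\<^sub>F s in at_right 0. x + s *\<^sub>R v \<in> S"
    by eventually_elim (auto simp: T corner_def)
  then obtain b where b: "b > 0" "\<And>s. 0 < s \<Longrightarrow> s < b \<Longrightarrow> x + s *\<^sub>R v \<in> S"
    by (auto simp: eventually_at_right_field)
  show ?thesis
  proof (rule that[of "b / 2"])
    fix s assume "s \<in> {0..b/2}"
    then show "x + s *\<^sub>R v \<in> S" using b S(2) by (cases "s = 0") auto
  qed (use b in simp)
qed

lemma ray_derivative_nonneg:
  fixes f :: "'a::real_normed_vector \<Rightarrow> real"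
  assumes D: "(f has_derivative D) (at x within S)" and d: "d > 0"
    and ray: "\<And>s. s \<in> {0..d} \<Longrightarrow> x + s *\<^sub>R v \<in> S \<and> f x \<le> f (x + s *\<^sub>R v)"
  shows "0 \<le> D v"
proof (rule ccontr)
  assume neg: "\<not> 0 \<le> D v"
  have 1: "((\<lambda>s. x + s *\<^sub>R v) has_vector_derivative v) (at 0 within {0..d})"
    by (auto intro!: derivative_eq_intros)
  have "(\<lambda>s. x + s *\<^sub>R v) ` {0..d} \<subseteq> S" using ray by auto
  then have 2: "(f has_derivative D) (at (x + 0 *\<^sub>R v) within (\<lambda>s. x + s *\<^sub>R v) ` {0..d})"
    using D by (auto intro: has_derivative_subset)
  have "((f \<circ> (\<lambda>s. x + s *\<^sub>R v)) has_real_derivative D v) (at 0 within {0..d})"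
    using vector_derivative_diff_chain_within[OF 1 2]
    by (simp add: has_real_derivative_iff_has_vector_derivative)
  from has_real_derivative_neg_dec_right[OF this] neg obtain e where e: "e > 0"
    "\<And>h. h > 0 \<Longrightarrow> 0 + h \<in> {0..d} \<Longrightarrow> h < e \<Longrightarrow> f (x + h *\<^sub>R v) < f x"
    by auto
  define h where "h = min d e / 2"
  have h: "0 < h" "h \<in> {0..d}" "h < e" using d e(1) by (auto simp: h_def)
  with e(2)[of h] ray[of h] show False by simp
qed

lemma convex_direction_growth:
  fixes F :: "'a::real_normed_vector \<Rightarrow> real"
  assumes W: "convex W" and F: "\<And>y. y \<in> W \<Longrightarrow> (F has_derivative F' y) (at y)"
    and k: "\<And>y. y \<in> W \<Longrightarrow> k \<le> F' y u" and y: "y \<in> W" "y + s *\<^sub>R u \<in> W" and s: "0 \<le> s"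
  shows "F y + k * s \<le> F (y + s *\<^sub>R u)"
proof (cases "s = 0")
  case False
  with s have s: "0 < s" by simp
  have inW: "y + t *\<^sub>R u \<in> W" if t: "t \<in> {0..s}" for t
  proof -
    have "y + t *\<^sub>R u = (1 - t / s) *\<^sub>R y + (t / s) *\<^sub>R (y + s *\<^sub>R u)"
      using s by (simp add: algebra_simps)
    then show ?thesis using convexD_alt[OF W y, of "t / s"] t s by (simp add: field_simps)
  qed
  have "\<exists>\<xi>>0. \<xi> < s \<and> F (y + s *\<^sub>R u) - F (y + 0 *\<^sub>R u) = (s - 0) * F' (y + \<xi> *\<^sub>R u) u"
  proof (rule MVT2[OF s])
    fix t :: real assume "0 \<le> t" "t \<le> s"
    then have t: "y + t *\<^sub>R u \<in> W" using inW by simp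
    have 1: "((\<lambda>t. y + t *\<^sub>R u) has_vector_derivative u) (at t)"
      by (auto intro!: derivative_eq_intros)
    have "((F \<circ> (\<lambda>t. y + t *\<^sub>R u)) has_vector_derivative F' (y + t *\<^sub>R u) u) (at t)"
      by (rule vector_derivative_diff_chain_within[OF 1]) (use F[OF t] in \<open>auto intro: has_derivative_at_withinI\<close>)
    then show "((\<lambda>t. F (y + t *\<^sub>R u)) has_real_derivative F' (y + t *\<^sub>R u) u) (at t)"
      by (simp add: has_real_derivative_iff_has_vector_derivative o_def)
  qed
  then obtain \<xi> where \<xi>: "0 < \<xi>" "\<xi> < s" "F (y + s *\<^sub>R u) - F y = s * F' (y + \<xi> *\<^sub>R u) u" by auto
  have "s * k \<le> s * F' (y + \<xi> *\<^sub>R u) u"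
    using k[OF inW[of \<xi>]] \<xi> s by (intro mult_left_mono) auto
  with \<xi>(3) mult.commute[of k s] show ?thesis by linarith
qed simp

section \<open>Chart independence of the codimension of a point\<close>

context corner_manifold
begin

text \<open>A coordinate of \<open>c\<close> that vanishes at \<open>q\<close> has a minimum there.
  A vector tangent to the stratum in \<open>c'\<close> can be followed along both \<open>v\<close>
  and \<open>- v\<close>, so the derivative of that coordinate is nonnegative and
  nonpositive.\<close>

lemma vanishing_kernel:
  assumes c: "c \<in> \<A>" and c': "c' \<in> \<A>" and q: "q \<in> chart_dom c" "q \<in> chart_dom c'"
    and R: "((chart_map c \<circ> chart_inv c') has_derivative R)
      (at (chart_map c' q) within chart_map c' ` (chart_dom c' \<inter> chart_dom c))"
    and v: "\<And>j. j \<in> vanishing_faces c' q \<Longrightarrow> v $ j = 0" and k: "k \<in> vanishing_faces c q"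
  shows "R v $ k = 0"
proof -
  let ?S = "chart_map c' ` (chart_dom c' \<inter> chart_dom c)"
  have x: "chart_map c' q \<in> ?S" using q by auto
  have D: "((\<lambda>y. (chart_map c \<circ> chart_inv c') y $ k) has_derivative (\<lambda>v. R v $ k)) (at (chart_map c' q) within ?S)"
    using bounded_linear.has_derivative[OF bounded_linear_vec_nth R] .
  have f: "0 \<le> (chart_map c \<circ> chart_inv c') y $ k" if "y \<in> ?S" for y
    using that inv_map[OF c'] image_corner[OF c map_in_image] k
    by (force simp: corner_def vanishing_faces_def)
  have f0: "(chart_map c \<circ> chart_inv c') (chart_map c' q) $ k = 0"
    using k inv_map[OF c' q(2)] by (simp add: vanishing_faces_def)
  have "0 \<le> R u $ k" if u: "\<And>j. j \<in> vanishing_faces c' q \<Longrightarrow> u $ j = 0" for u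
  proof -
    obtain d where d: "d > 0" "\<And>s. s \<in> {0..d} \<Longrightarrow> chart_map c' q + s *\<^sub>R u \<in> ?S"
      by (rule corner_ray[OF transition_image_open[OF c' c] x, of u]) (use u in \<open>auto simp: vanishing_faces_def\<close>)
    show ?thesis by (rule ray_derivative_nonneg[OF D d(1)]) (use d(2) f f0 in auto)
  qed
  from this[of v] this[of "- v"] v show ?thesis
    using linear_neg[OF has_derivative_linear[OF R]] by fastforce
qed

text \<open>The composite of the two transitions is the identity on a relatively open part of the
  corner, so the chain rule and uniqueness of derivatives there apply.\<close>

lemma transition_inverse:
  assumes c: "c \<in> \<A>" and c': "c' \<in> \<A>" and q: "q \<in> chart_dom c" "q \<in> chart_dom c'"
    and T: "((chart_map c' \<circ> chart_inv c) has_derivative T)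
      (at (chart_map c q) within chart_map c ` (chart_dom c \<inter> chart_dom c'))"
    and R: "((chart_map c \<circ> chart_inv c') has_derivative R)
      (at (chart_map c' q) within chart_map c' ` (chart_dom c' \<inter> chart_dom c))"
  shows "R (T v) = v"
proof -
  let ?S = "chart_map c ` (chart_dom c \<inter> chart_dom c')"
  have x: "chart_map c q \<in> ?S" using q by auto
  have "(chart_map c' \<circ> chart_inv c) ` ?S \<subseteq> chart_map c' ` (chart_dom c' \<inter> chart_dom c)"
    using inv_map[OF c] by auto
  then have R': "((chart_map c \<circ> chart_inv c') has_derivative R)
      (at ((chart_map c' \<circ> chart_inv c) (chart_map c q)) within (chart_map c' \<circ> chart_inv c) ` ?S)"
    using R inv_map[OF c q(1)] by (auto intro: has_derivative_subset)
  have "((chart_map c \<circ> chart_inv c') \<circ> (chart_map c' \<circ> chart_inv c) has_derivative R \<circ> T) (at (chart_map c q) within ?S)"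
    by (rule diff_chain_within[OF T R'])
  then have 1: "((\<lambda>y. y) has_derivative R \<circ> T) (at (chart_map c q) within ?S)"
    by (rule has_derivative_transform[OF x, rotated]) (use inv_map[OF c] inv_map[OF c'] in auto)
  have "R \<circ> T = (\<lambda>y. y)"
    by (rule has_derivative_unique_on_corner[OF transition_image_open[OF c c'] x 1]) (rule has_derivative_ident)
  then show ?thesis by (simp add: fun_eq_iff)
qed

text \<open>The inverse transition derivative embeds the tangent space of the stratum of \<open>q\<close> seen in \<open>c'\<close> into
  the one seen in \<open>c\<close>.\<close>

lemma card_vanishing_faces_le:
  assumes c: "c \<in> \<A>" and c': "c' \<in> \<A>" and q: "q \<in> chart_dom c" "q \<in> chart_dom c'"
  shows "card (vanishing_faces c q) \<le> card (vanishing_faces c' q)"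
proof -
  obtain T where T: "((chart_map c' \<circ> chart_inv c) has_derivative T)
      (at (chart_map c q) within chart_map c ` (chart_dom c \<inter> chart_dom c'))"
    using transition_has_derivative[OF c c' q] .
  obtain R where R: "((chart_map c \<circ> chart_inv c') has_derivative R)
      (at (chart_map c' q) within chart_map c' ` (chart_dom c' \<inter> chart_dom c))"
    using transition_has_derivative[OF c' c q(2,1)] .
  let ?Z = "\<lambda>J. {v :: real^'n. \<forall>j. j \<notin> - J \<longrightarrow> v $ j = 0}"
  have lin: "linear R" by (rule has_derivative_linear[OF R])
  have inj: "inj R"
    by (rule inj_on_inverseI[where g=T]) (use transition_inverse[OF c' c q(2,1) R T] in simp)
  have sub: "R ` ?Z (vanishing_faces c' q) \<subseteq> ?Z (vanishing_faces c q)"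
    using vanishing_kernel[OF c c' q R] by fastforce
  have dimZ: "dim (?Z J) = card (- J)" for J
    using dim_substandard_cart[of "- J", where 'a=real] by (simp add: dim_vec_eq)
  have "card (- vanishing_faces c' q) = dim (R ` ?Z (vanishing_faces c' q))"
    using dim_image_eq[OF lin inj_on_subset[OF inj]] dimZ by simp
  also have "\<dots> \<le> dim (?Z (vanishing_faces c q))" by (rule dim_subset[OF sub])
  also have "\<dots> = card (- vanishing_faces c q)" by (rule dimZ)
  finally have "CARD('n) - card (vanishing_faces c' q) \<le> CARD('n) - card (vanishing_faces c q)"
    by (simp add: Compl_eq_Diff_UNIV card_Diff_subset)
  moreover have "card (vanishing_faces c q) \<le> CARD('n)" by (rule card_mono) auto
  ultimately show ?thesis by linarith
qed

lemma card_vanishing_faces: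
  assumes "c \<in> \<A>" "c' \<in> \<A>" "q \<in> chart_dom c" "q \<in> chart_dom c'"
  shows "card (vanishing_faces c q) = card (vanishing_faces c' q)"
  using card_vanishing_faces_le assms by (meson antisym)

text \<open>\<open>mf_boundary\<close> asks for some chart that shows a vanishing coordinate; as
  their number is invariant, a single chart decides.\<close>

lemma mf_interior_iff:
  assumes c: "c \<in> \<A>" and q: "q \<in> chart_dom c"
  shows "q \<in> mf_interior X \<A> \<longleftrightarrow> vanishing_faces c q = {}"
proof
  assume "q \<in> mf_interior X \<A>"
  then show "vanishing_faces c q = {}" using c q by (auto simp: mf_interior_def mf_boundary_def)
next
  assume e: "vanishing_faces c q = {}"
  have "vanishing_faces c' q = {}" if "c' \<in> \<A>" "q \<in> chart_dom c'" for c'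
    using card_vanishing_faces[OF that(1) c that(2) q] e by (simp add: finite_subset[OF subset_UNIV])
  then show "q \<in> mf_interior X \<A>" using c q dom_subset by (auto simp: mf_interior_def mf_boundary_def)
qed

end

section \<open>Local structure of the faces\<close>

definition inward :: "('a, 'n::finite) chart \<Rightarrow> 'a \<Rightarrow> real^'n" where
  "inward c q = (\<chi> j. if j \<in> vanishing_faces c q then 1 else 0)"

locale manifold_with_hypersurfaces = corner_manifold X \<A>
  for X :: "'a topology" and \<A> :: "('a, 'n::finite) chart set" +
  fixes N :: nat and H :: "nat \<Rightarrow> 'a set" and \<rho> :: "nat \<Rightarrow> 'a \<Rightarrow> real"
  assumes hyp: "bij_betw H {1..N} (boundary_hypersurfaces X \<A>)"
    and bdf: "i \<in> {1..N} \<Longrightarrow> boundary_defining_function X \<A> (H i) (\<rho> i)"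
begin

lemma rho_smooth: "i \<in> {1..N} \<Longrightarrow> c \<in> \<A> \<Longrightarrow> smooth_on (\<rho> i \<circ> chart_inv c) (chart_image c)"
  using bdf by (simp add: boundary_defining_function_def smooth_function_def)

lemma rho_nonneg: "i \<in> {1..N} \<Longrightarrow> q \<in> topspace X \<Longrightarrow> 0 \<le> \<rho> i q"
  using bdf by (simp add: boundary_defining_function_def)

lemma hypersurface_eq: "i \<in> {1..N} \<Longrightarrow> H i = {q \<in> topspace X. \<rho> i q = 0}"
  using bdf by (simp add: boundary_defining_function_def)

lemma rho_continuous: "i \<in> {1..N} \<Longrightarrow> c \<in> \<A> \<Longrightarrow> continuous_on (chart_image c) (\<lambda>x. \<rho> i (chart_inv c x))"
  using smooth_on_continuous[OF rho_smooth] by (simp add: o_def)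

lemma inv_in_space: "c \<in> \<A> \<Longrightarrow> x \<in> chart_image c \<Longrightarrow> chart_inv c x \<in> topspace X"
  using inv_in_dom dom_subset by blast

text \<open>The derivative is nonnegative on the cone of inward vectors because
  \<open>\<rho> i\<close> has its minimum at \<open>q\<close>. The vector \<open>inward c q\<close>
  is interior to this cone, so if the derivative vanished on it, it would vanish everywhere,
  contrary to the nonzero differential.\<close>

lemma rho_derivative_inward:
  assumes i: "i \<in> {1..N}" and q: "q \<in> H i" "q \<in> chart_dom c" and c: "c \<in> \<A>"
    and D: "((\<rho> i \<circ> chart_inv c) has_derivative D) (at (chart_map c q) within chart_image c)"
  shows "0 < D (inward c q)"
proof -
  note x = map_in_image[OF q(2)]
  have nn: "0 \<le> D u" if u: "\<And>j. j \<in> vanishing_faces c q \<Longrightarrow> 0 \<le> u $ j" for u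
  proof -
    obtain d where d: "d > 0" "\<And>s. s \<in> {0..d} \<Longrightarrow> chart_map c q + s *\<^sub>R u \<in> chart_image c"
      by (rule corner_ray[OF image_open[OF c] x, of u]) (use u in \<open>auto simp: vanishing_faces_def\<close>)
    show ?thesis
      by (rule ray_derivative_nonneg[OF D d(1)])
        (use d(2) inv_map[OF c q(2)] q(1) hypersurface_eq[OF i] rho_nonneg[OF i inv_in_space[OF c]] in auto)
  qed
  have lin: "linear D" using has_derivative_linear[OF D] .
  have "D (inward c q) \<noteq> 0"
  proof
    assume z: "D (inward c q) = 0"
    have half: "0 \<le> D v" for v
    proof -
      \<comment> \<open>Scaled by \<open>1 / b\<close>, every \<open>v\<close> has components at
        most 1 in absolute value, so adding it to \<open>inward c q\<close> stays in the
        cone.\<close>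
      define b where "b = norm v + 1"
      have b: "b > 0" by (simp add: b_def add_nonneg_pos)
      have "0 \<le> D (inward c q + (1 / b) *\<^sub>R v)"
      proof (rule nn)
        fix j assume "j \<in> vanishing_faces c q"
        have "\<bar>v $ j\<bar> \<le> b" using component_le_norm_cart[of v j] by (simp add: b_def)
        then have "- 1 \<le> v $ j / b" using b by (simp add: field_simps abs_le_iff)
        then show "0 \<le> (inward c q + (1 / b) *\<^sub>R v) $ j"
          using \<open>j \<in> vanishing_faces c q\<close> by (simp add: inward_def)
      qed
      then show ?thesis using z b by (simp add: linear_add[OF lin] linear_scale[OF lin] zero_le_divide_iff)
    qed
    have "D v = 0" for v using half[of v] half[of "- v"] linear_neg[OF lin, of v] by simp
    then have "D = (\<lambda>v. 0)" by blast
    moreover have "\<not> ((\<rho> i \<circ> chart_inv c) has_derivative (\<lambda>v. 0)) (at (chart_map c q) within chart_image c)"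
      using bdf[OF i] q c by (simp add: boundary_defining_function_def)
    ultimately show False using D by simp
  qed
  moreover have "0 \<le> D (inward c q)" by (rule nn) (simp add: inward_def)
  ultimately show ?thesis by simp
qed

lemma rho_C1:
  assumes i: "i \<in> {1..N}" and c: "c \<in> \<A>" and q: "q \<in> chart_dom c"
  obtains r F F' where "r > 0" "\<And>y. y \<in> ball (chart_map c q) r \<Longrightarrow> (F has_derivative F' y) (at y)"
    "\<And>v. continuous_on (ball (chart_map c q) r) (\<lambda>y. F' y v)"
    "\<And>y. y \<in> chart_image c \<Longrightarrow> y \<in> ball (chart_map c q) r \<Longrightarrow> F y = \<rho> i (chart_inv c y)"
    "((\<rho> i \<circ> chart_inv c) has_derivative F' (chart_map c q)) (at (chart_map c q) within chart_image c)"
proof -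
  let ?x = "chart_map c q"
  note x = map_in_image[OF q]
  obtain W F F' where W: "open W" "?x \<in> W" "\<And>y. y \<in> W \<Longrightarrow> (F has_derivative F' y) (at y)"
    "\<And>v. continuous_on W (\<lambda>y. F' y v)" "\<And>y. y \<in> chart_image c \<Longrightarrow> y \<in> W \<Longrightarrow> F y = (\<rho> i \<circ> chart_inv c) y"
    using smooth_on_C1[OF rho_smooth[OF i c] x] by metis
  obtain r where r: "r > 0" "ball ?x r \<subseteq> W" using W by (meson openE)
  have "(F has_derivative F' ?x) (at ?x within chart_image c)"
    using W has_derivative_at_withinI by blast
  then have "((\<rho> i \<circ> chart_inv c) has_derivative F' ?x) (at ?x within chart_image c)"
    by (rule has_derivative_transform_within[OF _ r(1) x]) (use r W in \<open>auto simp: subset_iff dist_commute\<close>)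
  with r W show ?thesis
    by (intro that[of r F F']) (auto intro: continuous_on_subset)
qed

text \<open>A zero of \<open>\<rho> i\<close> at an interior point would require a positive
  derivative along \<open>inward c q\<close>, which is the zero vector there.\<close>

lemma rho_pos_interior:
  assumes q: "q \<in> mf_interior X \<A>" and i: "i \<in> {1..N}"
  shows "0 < \<rho> i q"
proof (rule ccontr)
  assume "\<not> 0 < \<rho> i q"
  moreover have qX: "q \<in> topspace X" using q by (simp add: mf_interior_def)
  ultimately have qH: "q \<in> H i" using rho_nonneg[OF i qX] hypersurface_eq[OF i] by auto
  obtain c where c: "c \<in> \<A>" "q \<in> chart_dom c" using covered[OF qX] by blast
  obtain D where D: "((\<rho> i \<circ> chart_inv c) has_derivative D) (at (chart_map c q) within chart_image c)"
    using rho_C1[OF i c] by metis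
  have "inward c q = 0" using mf_interior_iff[OF c] q by (simp add: inward_def vec_eq_iff)
  then show False
    using rho_derivative_inward[OF i qH c(2,1) D] linear_0[OF has_derivative_linear[OF D]] by simp
qed

end

locale face_point = manifold_with_hypersurfaces X \<A> N H \<rho>
  for X :: "'a topology" and \<A> :: "('a, 'n::finite) chart set" and N H \<rho> +
  fixes I :: "nat set" and p :: 'a and c :: "('a, 'n) chart"
  assumes pF: "p \<in> open_face X N H I" and I: "I \<subseteq> {1..N}" and c: "c \<in> \<A>" and pc: "p \<in> chart_dom c"
begin

abbreviation "face \<equiv> open_face X N H I"
abbreviation "\<phi> \<equiv> chart_map c"
abbreviation "\<psi> \<equiv> chart_inv c"
abbreviation "x0 \<equiv> \<phi> p"
abbreviation "K \<equiv> chart_faces c"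
abbreviation "J \<equiv> vanishing_faces c p"

text \<open>Within such a radius the chart sees only the faces through \<open>p\<close>. Positivity
  of the coordinates outside \<open>J\<close> is required on the whole ball, so that membership in
  the corner can be tested on the coordinates in \<open>J\<close> alone. Closed balls make
  \<open>cball x0 r \<inter> corner K\<close> a compact part of the chart image.\<close>

definition small :: "real \<Rightarrow> bool" where
  "small r \<longleftrightarrow> 0 < r \<and> cball x0 r \<inter> corner K \<subseteq> chart_image c \<and>
    (\<forall>x\<in>cball x0 r. \<forall>k\<in>K - J. 0 < x $ k) \<and>
    (\<forall>x\<in>cball x0 r \<inter> corner K. \<forall>i\<in>{1..N} - I. 0 < \<rho> i (\<psi> x))"

lemma small_mono:
  assumes "small r" "0 < r'" "r' \<le> r"
  shows "small r'"
proof -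
  have "cball x0 r' \<subseteq> cball x0 r" using assms by auto
  with assms show ?thesis unfolding small_def by blast
qed

lemma p_rho: "i \<in> {1..N} - I \<Longrightarrow> 0 < \<rho> i p"
proof -
  assume i: "i \<in> {1..N} - I"
  then have "p \<notin> H i" using pF by (auto simp: open_face_def face_index_def)
  moreover have "p \<in> topspace X" using pc dom_subset[OF c] by auto
  ultimately show ?thesis
    using i hypersurface_eq[of i] rho_nonneg[of i p] by (auto simp: less_le)
qed

lemma small_exists: "\<exists>r. small r"
proof -
  obtain T where T: "open T" "chart_image c = corner K \<inter> T" using image_open[OF c] by (auto simp: openin_open)
  have x0: "x0 \<in> chart_image c" by (rule map_in_image[OF pc])
  have "\<forall>\<^sub>F x in nhds x0. x \<in> T"
    using T x0 by (auto intro: eventually_nhds_in_open)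
  moreover have "\<forall>\<^sub>F x in nhds x0. \<forall>k\<in>K - J. 0 < x $ k"
  proof (subst eventually_ball_finite_distrib, simp, rule ballI)
    fix k assume k: "k \<in> K - J"
    have "0 < x0 $ k" using k image_corner[OF c x0] by (force simp: corner_def vanishing_faces_def)
    moreover have "((\<lambda>x. x $ k) \<longlongrightarrow> x0 $ k) (nhds x0)" by (intro tendsto_vec_nth filterlim_ident)
    ultimately show "\<forall>\<^sub>F x in nhds x0. 0 < x $ k" by (rule order_tendstoD(1)[rotated])
  qed
  moreover have "\<forall>\<^sub>F x in nhds x0. x \<in> chart_image c \<longrightarrow> (\<forall>i\<in>{1..N} - I. 0 < \<rho> i (\<psi> x))"
  proof -
    have "\<forall>\<^sub>F x in at x0 within chart_image c. \<forall>i\<in>{1..N} - I. 0 < \<rho> i (\<psi> x)"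
    proof (subst eventually_ball_finite_distrib, simp, rule ballI)
      fix i assume i: "i \<in> {1..N} - I"
      have "((\<lambda>x. \<rho> i (\<psi> x)) \<longlongrightarrow> \<rho> i (\<psi> x0)) (at x0 within chart_image c)"
        using rho_continuous[of i c] i c x0 by (simp add: continuous_on_def)
      then show "\<forall>\<^sub>F x in at x0 within chart_image c. 0 < \<rho> i (\<psi> x)"
        by (rule order_tendstoD(1)) (use p_rho[OF i] inv_map[OF c pc] in simp)
    qed
    moreover have "\<forall>i\<in>{1..N} - I. 0 < \<rho> i (\<psi> x0)" using p_rho inv_map[OF c pc] by simp
    ultimately show ?thesis
      unfolding eventually_at_filter by (auto elim: eventually_mono)
  qed
  ultimately have "\<forall>\<^sub>F x in nhds x0. x \<in> T \<and> (\<forall>k\<in>K - J. 0 < x $ k) \<and>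
      (x \<in> chart_image c \<longrightarrow> (\<forall>i\<in>{1..N} - I. 0 < \<rho> i (\<psi> x)))"
    by eventually_elim blast
  then obtain d where d: "d > 0" "\<And>x. dist x x0 < d \<Longrightarrow> x \<in> T \<and> (\<forall>k\<in>K - J. 0 < x $ k) \<and>
      (x \<in> chart_image c \<longrightarrow> (\<forall>i\<in>{1..N} - I. 0 < \<rho> i (\<psi> x)))"
    unfolding eventually_nhds_metric by auto
  have "dist x x0 < d" if "x \<in> cball x0 (d / 2)" for x
    using that d(1) by (auto simp: dist_commute)
  with d(2) have "small (d / 2)" unfolding small_def using d(1) T(2) by auto
  then show ?thesis ..
qed

text \<open>For small \<open>r\<close> this is the open part of the wall \<open>x $ j = 0\<close>
  that meets no other wall: one piece of the codimension one stratum in the chart.\<close>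

definition side :: "real \<Rightarrow> 'n \<Rightarrow> (real^'n) set" where
  "side r j = ball x0 r \<inter> {x. x $ j = 0 \<and> (\<forall>k\<in>J - {j}. 0 < x $ k)}"

lemma J_sub: "J \<subseteq> K" by (auto simp: vanishing_faces_def)

lemma side_image:
  assumes "small r" "j \<in> J"
  shows "side r j \<subseteq> chart_image c"
proof -
  have "side r j \<subseteq> cball x0 r \<inter> corner K"
  proof
    fix x assume x: "x \<in> side r j"
    have xb: "x \<in> cball x0 r" using x by (auto simp: side_def)
    have "0 \<le> x $ k" if "k \<in> K" for k
    proof (cases "k \<in> J")
      case True then show ?thesis using x by (cases "k = j") (auto simp: side_def less_imp_le)
    next
      case False then show ?thesis using assms(1) xb that unfolding small_def by (meson DiffI less_imp_le)
    qed
    with xb show "x \<in> cball x0 r \<inter> corner K" by (auto simp: corner_def)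
  qed
  with assms(1) show ?thesis by (auto simp: small_def)
qed

lemma vanishing_near:
  assumes "small r" "q \<in> chart_dom c" "\<phi> q \<in> ball x0 r"
  shows "vanishing_faces c q = {j \<in> J. \<phi> q $ j = 0}"
proof -
  have "\<phi> q \<in> cball x0 r" using assms(3) by auto
  then have "0 < \<phi> q $ k" if "k \<in> K - J" for k
    using assms(1) that unfolding small_def by blast
  then show ?thesis using J_sub by (fastforce simp: vanishing_faces_def)
qed

lemma side_vanishing:
  assumes r: "small r" and j: "j \<in> J" and x: "x \<in> side r j"
  shows "vanishing_faces c (\<psi> x) = {j}"
proof -
  have xi: "x \<in> chart_image c" using side_image[OF r j] x by blast
  have "vanishing_faces c (\<psi> x) = {k \<in> J. x $ k = 0}"
    using vanishing_near[OF r inv_in_dom[OF xi]] x by (simp add: map_inv[OF xi] side_def)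
  also have "\<dots> = {j}" using x j by (force simp: side_def)
  finally show ?thesis .
qed

text \<open>A convex set is connected. Connectedness inside the codimension one stratum puts the
  wall into a single component, which ties coordinate walls to hypersurfaces.\<close>

lemma side_connectedin:
  assumes r: "small r" and j: "j \<in> J"
  shows "connectedin (subtopology X (codim1_stratum \<A>)) (\<psi> ` side r j)"
proof -
  have "convex (side r j)"
  proof -
    have "side r j = ball x0 r \<inter> ({x. x $ j = 0} \<inter> (\<Inter>k\<in>J - {j}. {x. 0 < x $ k}))"
      by (auto simp: side_def)
    moreover have "convex {x :: real^'n. x $ k = 0}" for k by (auto simp: convex_def)
    moreover have "convex {x :: real^'n. 0 < x $ k}" for k
      using convex_halfspace_gt[of 0 "axis k 1 :: real^'n"] by (simp add: inner_axis')
    ultimately show ?thesis by (auto intro!: convex_Int convex_INT)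
  qed
  then have "connectedin (top_of_set (chart_image c)) (side r j)"
    using side_image[OF r j] by (simp add: connectedin_subtopology convex_connected)
  then have "connectedin X (\<psi> ` side r j)"
    by (rule connectedin_continuous_map_image[OF inv_continuous[OF c]])
  moreover have "\<psi> ` side r j \<subseteq> codim1_stratum \<A>"
  proof clarify
    fix x assume x: "x \<in> side r j"
    then have "x \<in> chart_image c" using side_image[OF r j] by blast
    then show "\<psi> x \<in> codim1_stratum \<A>"
      using side_vanishing[OF r j x] c inv_in_dom by (auto simp: codim1_stratum_def intro!: bexI[of _ c])
  qed
  ultimately show ?thesis by (simp add: connectedin_subtopology)
qed

lemma side_closure:
  assumes r: "small r" and j: "j \<in> J" and q: "q \<in> chart_dom c" "\<phi> q \<in> ball x0 r" "\<phi> q $ j = 0"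
  shows "q \<in> X closure_of (\<psi> ` side r j)"
proof -
  let ?x = "\<phi> q"
  \<comment> \<open>\<open>u\<close> points away from every wall through \<open>p\<close> except the
    wall \<open>j\<close>, along which it runs.\<close>
  define u where "u = inward c p - axis j 1"
  have "\<forall>\<^sub>F s in at_right 0. ?x + s *\<^sub>R u \<in> side r j"
  proof -
    have "\<forall>\<^sub>F s in at_right 0. ?x + s *\<^sub>R u \<in> ball x0 r"
    proof (rule topological_tendstoD[OF _ open_ball])
      show "((\<lambda>s. ?x + s *\<^sub>R u) \<longlongrightarrow> ?x + 0 *\<^sub>R u) (at_right 0)" by (intro tendsto_intros)
    qed (use q in simp)
    moreover have "\<forall>\<^sub>F s in at_right (0::real). 0 < s" by (rule eventually_at_right_less)
    ultimately show ?thesis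
    proof eventually_elim
      fix s :: real assume s: "?x + s *\<^sub>R u \<in> ball x0 r" "0 < s"
      have "0 \<le> ?x $ k" if "k \<in> J" for k
        using that image_corner[OF c map_in_image[OF q(1)]] J_sub by (auto simp: corner_def)
      then show "?x + s *\<^sub>R u \<in> side r j"
        using s q(3) j by (auto simp: side_def u_def inward_def axis_def intro: add_nonneg_pos)
    qed
  qed
  then have "?x \<in> closure (side r j)"
    unfolding closure_approachable
  proof (intro allI impI)
    fix e :: real assume e: "e > 0"
    have "\<forall>\<^sub>F s in at_right 0. ?x + s *\<^sub>R u \<in> ball ?x e"
    proof (rule topological_tendstoD[OF _ open_ball])
      show "((\<lambda>s. ?x + s *\<^sub>R u) \<longlongrightarrow> ?x + 0 *\<^sub>R u) (at_right 0)" by (intro tendsto_intros)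
    qed (use e in simp)
    with \<open>\<forall>\<^sub>F s in at_right 0. ?x + s *\<^sub>R u \<in> side r j\<close>
    have "\<forall>\<^sub>F s in at_right (0::real). \<exists>y\<in>side r j. dist y ?x < e"
      by eventually_elim (metis dist_commute mem_ball)
    then show "\<exists>y\<in>side r j. dist y ?x < e"
      using eventually_happens trivial_limit_at_right_real by blast
  qed
  then have "?x \<in> top_of_set (chart_image c) closure_of side r j"
    using side_image[OF r j] map_in_image[OF q(1)] by (simp add: closure_of_subtopology Int_absorb1)
  then have "\<psi> ?x \<in> X closure_of (\<psi> ` side r j)"
    using continuous_map_image_closure_subset[OF inv_continuous[OF c]] by blast
  then show ?thesis using inv_map[OF c q(1)] by simp
qed

lemma hypersurface_image: "boundary_hypersurfaces X \<A> = H ` {1..N}"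
  using hyp by (simp add: bij_betw_def)

text \<open>The component that contains the wall has some \<open>H i\<close> as its closure;
  \<open>p\<close> is in the closure of the wall, hence \<open>i \<in> I\<close>.\<close>

lemma side_in_hypersurface:
  assumes r: "small r" and j: "j \<in> J"
  obtains i where "i \<in> I"
    "\<And>q. q \<in> chart_dom c \<Longrightarrow> \<phi> q \<in> ball x0 r \<Longrightarrow> \<phi> q $ j = 0 \<Longrightarrow> q \<in> H i"
proof -
  let ?Y = "subtopology X (codim1_stratum \<A>)" and ?U = "\<psi> ` side r j"
  have x0: "x0 \<in> ball x0 r" "x0 $ j = 0" using r j by (auto simp: small_def vanishing_faces_def)
  have "p \<in> X closure_of ?U" by (rule side_closure[OF r j pc x0])
  then obtain y where y: "y \<in> ?U" by (metis closure_of_empty empty_iff equals0I)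
  have yY: "y \<in> topspace ?Y" using side_connectedin[OF r j] y connectedin_subset_topspace by blast
  let ?C = "connected_component_of_set ?Y y"
  have UC: "?U \<subseteq> ?C" using connected_component_of_maximal[OF side_connectedin[OF r j] y] .
  have "?C \<in> connected_components_of ?Y" using yY by (simp add: connected_component_in_connected_components_of)
  then have "X closure_of ?C \<in> H ` {1..N}"
    unfolding hypersurface_image[symmetric] boundary_hypersurfaces_def by blast
  then obtain i where i: "i \<in> {1..N}" "X closure_of ?C = H i" by blast
  have *: "q \<in> H i" if "q \<in> chart_dom c" "\<phi> q \<in> ball x0 r" "\<phi> q $ j = 0" for q
    using side_closure[OF r j that] closure_of_mono[OF UC, of X] i(2) by blast
  have "i \<in> I" using *[OF pc x0] i(1) pF by (auto simp: open_face_def face_index_def)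
  with * show ?thesis by (rule that[rotated])
qed

text \<open>\<open>H i\<close> is the closure of a component \<open>C\<close>, so \<open>C\<close>
  has a point \<open>y\<close> near \<open>p\<close>. By invariance \<open>y\<close> has exactly one
  vanishing coordinate and lies on some \<open>side r j\<close>. Maximality of \<open>C\<close> puts
  this whole wall into \<open>C\<close>, and the closure of the wall contains
  \<open>q\<close>.\<close>

lemma stratum_in_hypersurface:
  assumes r: "small r" and i: "i \<in> I" and q: "q \<in> chart_dom c" "\<phi> q \<in> ball x0 r"
    and z: "\<And>j. j \<in> J \<Longrightarrow> \<phi> q $ j = 0"
  shows "q \<in> H i"
proof -
  let ?Y = "subtopology X (codim1_stratum \<A>)"
  have "H i \<in> boundary_hypersurfaces X \<A>" using hypersurface_image i I by blast
  then obtain C where C: "C \<in> connected_components_of ?Y" "H i = X closure_of C"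
    unfolding boundary_hypersurfaces_def by blast
  have "p \<in> H i" using pF i by (auto simp: open_face_def face_index_def)
  then have cl: "\<forall>T. p \<in> T \<and> openin X T \<longrightarrow> (\<exists>y. y \<in> C \<and> y \<in> T)"
    using C(2) by (simp add: in_closure_of)
  have "openin X {q \<in> chart_dom c. \<phi> q \<in> ball x0 r}"
    by (rule openin_chart_preimage[OF c open_ball])
  moreover have "p \<in> {q \<in> chart_dom c. \<phi> q \<in> ball x0 r}"
    using pc r by (simp add: small_def)
  ultimately obtain y where "y \<in> C" "y \<in> {q \<in> chart_dom c. \<phi> q \<in> ball x0 r}"
    using cl by meson
  then have y: "y \<in> C" "y \<in> chart_dom c" "\<phi> y \<in> ball x0 r" by simp_all
  have "y \<in> codim1_stratum \<A>"
    using connected_components_of_subset[OF C(1)] y(1) by auto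
  then obtain c' where c': "c' \<in> \<A>" "y \<in> chart_dom c'" "card (vanishing_faces c' y) = 1"
    by (auto simp: codim1_stratum_def)
  have "card (vanishing_faces c y) = 1"
    using card_vanishing_faces[OF c c'(1) y(2) c'(2)] c'(3) by simp
  then obtain j where j: "vanishing_faces c y = {j}" by (auto simp: card_1_singleton_iff)
  have eq: "{j \<in> J. \<phi> y $ j = 0} = {j}" using vanishing_near[OF r y(2,3)] j by simp
  then have jJ: "j \<in> J" "\<phi> y $ j = 0" by blast+
  have "0 < \<phi> y $ k" if "k \<in> J - {j}" for k
  proof -
    have "\<phi> y $ k \<noteq> 0" using eq that by blast
    moreover have "0 \<le> \<phi> y $ k"
      using image_corner[OF c map_in_image[OF y(2)]] that J_sub by (auto simp: corner_def)
    ultimately show ?thesis by simp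
  qed
  then have "\<phi> y \<in> side r j" using y(3) jJ by (simp add: side_def)
  then have "y \<in> \<psi> ` side r j" using inv_map[OF c y(2)] by (metis imageI)
  then have "\<not> disjnt C (\<psi> ` side r j)" using y(1) by (auto simp: disjnt_def)
  then have "\<psi> ` side r j \<subseteq> C"
    by (rule connected_components_of_maximal[OF C(1) side_connectedin[OF r jJ(1)]])
  then show ?thesis
    using side_closure[OF r jJ(1) q z[OF jJ(1)]] closure_of_mono[of _ C X] C(2) by blast
qed

text \<open>The hypersurface \<open>H i\<close> that contains the wall \<open>j\<close> has no
  points off the wall near \<open>p\<close>: the derivative of \<open>\<rho> i\<close> along
  \<open>axis j 1\<close> is positive at \<open>x0\<close>, so \<open>\<rho> i\<close> is positive
  wherever \<open>x $ j\<close> is. Points of the face lie on \<open>H i\<close>, hence on the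
  wall.\<close>

lemma side_transversal:
  assumes j: "j \<in> J"
  shows "\<exists>r. small r \<and> (\<forall>q\<in>face \<inter> chart_dom c. \<phi> q \<in> ball x0 r \<longrightarrow> \<phi> q $ j = 0)"
proof -
  obtain r0 where r0: "small r0" using small_exists by blast
  obtain i where i: "i \<in> I"
    "\<And>q. q \<in> chart_dom c \<Longrightarrow> \<phi> q \<in> ball x0 r0 \<Longrightarrow> \<phi> q $ j = 0 \<Longrightarrow> q \<in> H i"
    using side_in_hypersurface[OF r0 j] by metis
  have iN: "i \<in> {1..N}" using i(1) I by blast
  have pH: "p \<in> H i" using pF i(1) by (auto simp: open_face_def face_index_def)
  obtain r1 G G' where G: "r1 > 0" "\<And>y. y \<in> ball x0 r1 \<Longrightarrow> (G has_derivative G' y) (at y)"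
    "\<And>v. continuous_on (ball x0 r1) (\<lambda>y. G' y v)"
    "\<And>y. y \<in> chart_image c \<Longrightarrow> y \<in> ball x0 r1 \<Longrightarrow> G y = \<rho> i (\<psi> y)"
    "((\<rho> i \<circ> \<psi>) has_derivative G' x0) (at x0 within chart_image c)"
    using rho_C1[OF iN c pc] by metis
  have lin: "linear (G' x0)" using has_derivative_linear[OF G(5)] .
  note x0 = map_in_image[OF pc]
  \<comment> \<open>This direction stays on the wall, where \<open>\<rho> i\<close> is zero. So the
    derivative along \<open>axis j 1\<close> is at least the one along \<open>inward c p\<close>,
    which is positive.\<close>
  have "0 \<le> - G' x0 (inward c p - axis j 1)"
  proof -
    have op: "openin (top_of_set (corner K)) (chart_image c \<inter> ball x0 r0)"
      using image_open[OF c] by (rule openin_Int_open) simp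
    have in0: "x0 \<in> chart_image c \<inter> ball x0 r0" using x0 r0 by (simp add: small_def)
    obtain d where d: "d > 0"
      "\<And>s. s \<in> {0..d} \<Longrightarrow> x0 + s *\<^sub>R (inward c p - axis j 1) \<in> chart_image c \<inter> ball x0 r0"
      by (rule corner_ray[OF op in0, of "inward c p - axis j 1"])
        (use j in \<open>auto simp: inward_def axis_def vanishing_faces_def\<close>)
    show ?thesis
    proof (rule ray_derivative_nonneg[OF has_derivative_minus[OF G(5)] d(1)])
      fix s assume s: "s \<in> {0..d}"
      let ?y = "x0 + s *\<^sub>R (inward c p - axis j 1)"
      have y: "?y \<in> chart_image c" "?y \<in> ball x0 r0" using d(2)[OF s] by auto
      have "?y $ j = 0" using j by (simp add: inward_def axis_def vanishing_faces_def)
      then have "\<psi> ?y \<in> H i"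
        using i(2)[OF inv_in_dom[OF y(1)]] y(2) by (simp add: map_inv[OF y(1)])
      then show "?y \<in> chart_image c \<and> - (\<rho> i \<circ> \<psi>) x0 \<le> - (\<rho> i \<circ> \<psi>) ?y"
        using y(1) hypersurface_eq[OF iN] rho_nonneg[OF iN inv_in_space[OF c x0]] by simp
    qed
  qed
  moreover have "0 < G' x0 (inward c p)" by (rule rho_derivative_inward[OF iN pH pc c G(5)])
  ultimately have pos: "0 < G' x0 (axis j 1)" by (simp add: linear_diff[OF lin])
  define k where "k = G' x0 (axis j 1) / 2"
  have "isCont (\<lambda>y. G' y (axis j 1)) x0"
    using G(1,3) by (simp add: continuous_on_eq_continuous_at)
  then have "((\<lambda>y. G' y (axis j 1)) \<longlongrightarrow> G' x0 (axis j 1)) (nhds x0)"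
    by (simp add: isCont_def tendsto_nhds_iff)
  then have "\<forall>\<^sub>F y in nhds x0. k < G' y (axis j 1)"
    by (rule order_tendstoD(1)) (use pos in \<open>simp add: k_def\<close>)
  then obtain r2 where r2: "r2 > 0" "\<And>y. dist y x0 < r2 \<Longrightarrow> k < G' y (axis j 1)"
    unfolding eventually_nhds_metric by auto
  define r where "r = min r0 (min r1 r2)"
  have r: "small r" using small_mono[OF r0] r0 G(1) r2(1) by (auto simp: r_def small_def)
  have "\<phi> q $ j = 0" if q: "q \<in> face" "q \<in> chart_dom c" "\<phi> q \<in> ball x0 r" for q
  proof (rule ccontr)
    assume nz: "\<phi> q $ j \<noteq> 0"
    let ?x = "\<phi> q"
    have xi: "?x \<in> chart_image c" by (rule map_in_image[OF q(2)])
    have s: "0 < ?x $ j" using nz image_corner[OF c xi] j J_sub by (force simp: corner_def)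
    \<comment> \<open>The projection to the wall stays in the ball because \<open>x0\<close> lies on
      the wall. From a value at least 0 at \<open>y\<close>, the function \<open>\<rho> i\<close>
      grows strictly on the way back to a point where it is 0.\<close>
    define y where "y = ?x - (?x $ j) *\<^sub>R axis j 1"
    have x0j: "x0 $ j = 0" using j by (simp add: vanishing_faces_def)
    have "norm (y - x0) \<le> norm (?x - x0)"
    proof (rule norm_le_componentwise_cart)
      fix k show "norm ((y - x0) $ k) \<le> norm ((?x - x0) $ k)"
        using x0j by (auto simp: y_def axis_def)
    qed
    then have yb: "y \<in> ball x0 r" using q(3) by (simp add: dist_norm norm_minus_commute)
    have "y \<in> corner K" using image_corner[OF c xi] by (auto simp: corner_def y_def axis_def)
    then have yi: "y \<in> chart_image c" using yb r by (auto simp: small_def)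
    have "G y + k * (?x $ j) \<le> G (y + (?x $ j) *\<^sub>R axis j 1)"
    proof (rule convex_direction_growth[of "ball x0 r" G G'])
      show "(G has_derivative G' z) (at z)" if "z \<in> ball x0 r" for z
        using that G(2) by (auto simp: r_def)
      show "k \<le> G' z (axis j 1)" if "z \<in> ball x0 r" for z
        using that r2(2)[of z] by (auto simp: r_def dist_commute)
    qed (use yb q(3) s in \<open>auto simp: y_def\<close>)
    also have "y + (?x $ j) *\<^sub>R axis j 1 = ?x" by (simp add: y_def)
    finally have le: "G y + k * (?x $ j) \<le> G ?x" .
    have "G y = \<rho> i (\<psi> y)" using G(4)[OF yi] yb by (auto simp: r_def)
    then have "0 \<le> G y" using rho_nonneg[OF iN inv_in_space[OF c yi]] by simp
    moreover have "G ?x = 0"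
    proof -
      have "q \<in> H i" using q(1) i(1) by (auto simp: open_face_def face_index_def)
      moreover have "G ?x = \<rho> i q" using G(4)[OF xi] q(3) inv_map[OF c q(2)] by (auto simp: r_def)
      ultimately show ?thesis using hypersurface_eq[OF iN] by simp
    qed
    moreover have "0 < k * (?x $ j)" using pos s by (simp add: k_def)
    ultimately show False using le by linarith
  qed
  with r show ?thesis by blast
qed

text \<open>The least of the radii for the finitely many walls serves all of them. Further
  hypersurfaces are excluded because \<open>small\<close> keeps the remaining
  \<open>\<rho> i\<close> positive.\<close>

lemma face_flat:
  "\<exists>r. small r \<and> (\<forall>q\<in>chart_dom c. \<phi> q \<in> ball x0 r \<longrightarrow>
    (q \<in> face \<longleftrightarrow> (\<forall>j\<in>J. \<phi> q $ j = 0)))"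
proof -
  obtain R where R: "\<And>j. j \<in> J \<Longrightarrow> small (R j) \<and>
      (\<forall>q\<in>face \<inter> chart_dom c. \<phi> q \<in> ball x0 (R j) \<longrightarrow> \<phi> q $ j = 0)"
    using side_transversal by metis
  obtain r0 where r0: "small r0" using small_exists by blast
  define r where "r = Min (insert r0 (R ` J))"
  have le: "r \<le> r0" "\<And>j. j \<in> J \<Longrightarrow> r \<le> R j" by (auto simp: r_def)
  have "0 < r" using r0 R by (auto simp: r_def small_def)
  then have r: "small r" using small_mono[OF r0] le by blast
  have "q \<in> face \<longleftrightarrow> (\<forall>j\<in>J. \<phi> q $ j = 0)"
    if q: "q \<in> chart_dom c" "\<phi> q \<in> ball x0 r" for q
  proof
    assume "q \<in> face"
    then show "\<forall>j\<in>J. \<phi> q $ j = 0"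
      using R q le(2) by (meson IntI mem_ball less_le_trans)
  next
    assume z: "\<forall>j\<in>J. \<phi> q $ j = 0"
    have "\<phi> q \<in> cball x0 r \<inter> corner K" using q image_corner[OF c map_in_image[OF q(1)]] by auto
    then have "0 < \<rho> i q" if "i \<in> {1..N} - I" for i
      using r that inv_map[OF c q(1)] unfolding small_def by metis
    then have "q \<notin> H i" if "i \<in> {1..N} - I" for i
      using that hypersurface_eq[of i] by fastforce
    moreover have "q \<in> H i" if "i \<in> I" for i
      using stratum_in_hypersurface[OF r that q] z by blast
    ultimately have "face_index N H q = I" using I by (auto simp: face_index_def)
    then show "q \<in> face" using q(1) dom_subset[OF c] by (auto simp: open_face_def)
  qed
  with r show ?thesis by blast
qed

end

section \<open>The conformal factor near a face\<close>

locale conformal_manifold = manifold_with_hypersurfaces X \<A> N H \<rho>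
  for X :: "'a topology" and \<A> :: "('a, 'n::finite) chart set" and N H \<rho> +
  fixes g0 :: "('a, 'n) tensor2" and \<alpha> :: "nat \<Rightarrow> real"
  assumes metric: "smooth_riemannian_metric \<A> g0" and \<alpha>: "i \<in> {1..N} \<Longrightarrow> 0 \<le> \<alpha> i"
begin

abbreviation "gP \<equiv> product_conformal_metric N \<rho> \<alpha> g0"
abbreviation "M \<equiv> mf_interior X \<A>"
abbreviation "dP \<equiv> riemannian_distance X \<A> gP M"

definition weight :: "'a \<Rightarrow> real" where
  "weight q = (\<Prod>i=1..N. \<rho> i q powr (- \<alpha> i))"

lemma gP_eq: "gP c q u v = weight q * g0 c q u v"
  by (simp add: product_conformal_metric_def weight_def)

lemma g0_bilinear: "c \<in> \<A> \<Longrightarrow> q \<in> chart_dom c \<Longrightarrow> bilinear (g0 c q)"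
  using metric by (simp add: smooth_riemannian_metric_def)

lemma g0_pos: "c \<in> \<A> \<Longrightarrow> q \<in> chart_dom c \<Longrightarrow> v \<noteq> 0 \<Longrightarrow> 0 < g0 c q v v"
  using metric by (simp add: smooth_riemannian_metric_def)

lemma g0_continuous: "c \<in> \<A> \<Longrightarrow> continuous_on (chart_image c) (\<lambda>x. g0 c (chart_inv c x) u v)"
  using metric by (auto simp: smooth_riemannian_metric_def intro: smooth_on_continuous)

lemma g0_law:
  assumes "c \<in> \<A>" "c' \<in> \<A>" "q \<in> chart_dom c" "q \<in> chart_dom c'"
    "((chart_map c' \<circ> chart_inv c) has_derivative T)
          (at (chart_map c q) within chart_map c ` (chart_dom c \<inter> chart_dom c'))"
  shows "g0 c q u v = g0 c' q (T u) (T v)"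
  using metric assms unfolding smooth_riemannian_metric_def by blast

lemma corner_metric_g0: "corner_metric X \<A> g0 S"
proof
  show "bilinear (g0 c p)" if "c \<in> \<A>" "p \<in> chart_dom c" "p \<in> S" for c p
    using g0_bilinear that by blast
  show "continuous_on (chart_map c ` (chart_dom c \<inter> S)) (\<lambda>x. g0 c (chart_inv c x) u v)" if "c \<in> \<A>" for c u v
    by (rule continuous_on_subset[OF g0_continuous[OF that]]) (auto simp: chart_image_def)
qed (rule g0_law)

lemma corner_metric_gP: "corner_metric X \<A> gP M"
proof
  show "bilinear (gP c p)" if "c \<in> \<A>" "p \<in> chart_dom c" "p \<in> M" for c p
    using g0_bilinear[OF that(1,2)] unfolding bilinear_def gP_eq
    by (simp add: linear_iff algebra_simps)
  show "continuous_on (chart_map c ` (chart_dom c \<inter> M)) (\<lambda>x. gP c (chart_inv c x) u v)" if c: "c \<in> \<A>" for c u v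
  proof -
    have sub: "chart_map c ` (chart_dom c \<inter> M) \<subseteq> chart_image c" by (auto simp: chart_image_def)
    show ?thesis unfolding gP_eq weight_def
    proof (intro continuous_on_mult continuous_on_prod continuous_on_powr continuous_on_const ballI)
      show "continuous_on (chart_map c ` (chart_dom c \<inter> M)) (\<lambda>x. g0 c (chart_inv c x) u v)"
        by (rule continuous_on_subset[OF g0_continuous[OF c] sub])
      fix i assume i: "i \<in> {1..N}"
      show "continuous_on (chart_map c ` (chart_dom c \<inter> M)) (\<lambda>x. \<rho> i (chart_inv c x))"
        by (rule continuous_on_subset[OF rho_continuous[OF i c] sub])
      fix x assume "x \<in> chart_map c ` (chart_dom c \<inter> M)"
      then obtain q where "q \<in> chart_dom c" "q \<in> M" "x = chart_map c q" by blast
      \<comment> \<open>Continuity of \<open>powr\<close> is available for a nonzero base, which is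
        why \<open>gP\<close> is considered on \<open>M\<close>.\<close>
      then show "\<rho> i (chart_inv c x) \<noteq> 0" using rho_pos_interior[OF _ i] inv_map[OF c] by fastforce
    qed
  qed
  show "gP c p u v = gP c' p (T u) (T v)"
    if "c \<in> \<A>" "c' \<in> \<A>" "p \<in> chart_dom c" "p \<in> chart_dom c'" "p \<in> M"
      "((chart_map c' \<circ> chart_inv c) has_derivative T)
          (at (chart_map c p) within chart_map c ` (chart_dom c \<inter> chart_dom c'))" for c c' p T u v
    using g0_law[OF that(1-4,6)] by (simp add: gP_eq)
qed

end

locale conformal_face = face_point X \<A> N H \<rho> I p c + conformal_manifold X \<A> N H \<rho> g0 \<alpha>
  for X :: "'a topology" and \<A> :: "('a, 'n::finite) chart set" and N H \<rho> I p c g0 \<alpha>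
begin

abbreviation "dF \<equiv> riemannian_distance X \<A> g0 face"
abbreviation "e \<equiv> inward c p"
abbreviation "A \<equiv> sum \<alpha> I"
abbreviation "patch r \<equiv> cball x0 r \<inter> corner K"

lemma patch_compact: "compact (patch r)"
  by (simp add: closed_corner compact_Int_closed)

lemma patch_image: "small r \<Longrightarrow> patch r \<subseteq> chart_image c"
  by (simp add: small_def)

lemma x0_patch: "small r \<Longrightarrow> x0 \<in> patch r"
  using image_corner[OF c map_in_image[OF pc]] by (simp add: small_def)

text \<open>Positive definiteness on the compact product of \<open>patch r\<close> with the unit
  sphere gives positive extrema, and homogeneity extends them to all vectors. Square roots are taken
  because the constants are compared with speeds.\<close>

lemma g0_bounds:
  assumes r: "small r"
  obtains m m' where "0 < m" "0 < m'"
    "\<And>x v. x \<in> patch r \<Longrightarrow> m\<^sup>2 * (norm v)\<^sup>2 \<le> g0 c (\<psi> x) v v"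
    "\<And>x v. x \<in> patch r \<Longrightarrow> g0 c (\<psi> x) v v \<le> m'\<^sup>2 * (norm v)\<^sup>2"
proof -
  interpret G: corner_metric X \<A> g0 UNIV by (rule corner_metric_g0)
  let ?S = "sphere (0 :: real^'n) 1"
  define \<Phi> where "\<Phi> y = (case y of (x, v) \<Rightarrow> \<Sum>i\<in>UNIV. \<Sum>j\<in>UNIV. v $ i * v $ j * g0 c (\<psi> x) (axis i 1) (axis j 1))"
    for y :: "(real^'n) \<times> (real^'n)"
  have \<Phi>: "g0 c (\<psi> x) v v = \<Phi> (x, v)" if "x \<in> patch r" for x v
    using G.tensor_expand[OF c inv_in_dom] patch_image[OF r] that by (auto simp: \<Phi>_def)
  have cg: "continuous_on (patch r \<times> ?S) (\<lambda>y. g0 c (\<psi> (fst y)) (axis i 1) (axis j 1))" for i j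
    by (rule continuous_on_compose2[OF g0_continuous[OF c]]) (use patch_image[OF r] in \<open>auto intro!: continuous_intros\<close>)
  have cont: "continuous_on (patch r \<times> ?S) \<Phi>"
    unfolding \<Phi>_def case_prod_unfold by (intro continuous_intros cg)
  have comp: "compact (patch r \<times> ?S)" by (intro compact_Times patch_compact) simp
  have "(x0, axis undefined 1) \<in> patch r \<times> ?S" using x0_patch[OF r] by simp
  then have ne: "patch r \<times> ?S \<noteq> {}" by blast
  obtain y1 where y1: "y1 \<in> patch r \<times> ?S" "\<And>y. y \<in> patch r \<times> ?S \<Longrightarrow> \<Phi> y1 \<le> \<Phi> y"
    using continuous_attains_inf[OF comp ne cont] by blast
  obtain y2 where y2: "y2 \<in> patch r \<times> ?S" "\<And>y. y \<in> patch r \<times> ?S \<Longrightarrow> \<Phi> y \<le> \<Phi> y2"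
    using continuous_attains_sup[OF comp ne cont] by blast
  have pos: "0 < \<Phi> y" if "y \<in> patch r \<times> ?S" for y
  proof -
    obtain x v where y: "y = (x, v)" "x \<in> patch r" "v \<in> ?S" using \<open>y \<in> patch r \<times> ?S\<close> by auto
    then have "v \<noteq> 0" by auto
    moreover have "\<psi> x \<in> chart_dom c" using inv_in_dom patch_image[OF r] y(2) by blast
    ultimately show ?thesis using \<Phi>[OF y(2), of v] g0_pos[OF c, of "\<psi> x" v] y(1) by simp
  qed
  have scale: "g0 c (\<psi> x) v v = (norm v)\<^sup>2 * \<Phi> (x, v /\<^sub>R norm v)" if x: "x \<in> patch r" and v: "v \<noteq> 0" for x v
  proof -
    have "\<psi> x \<in> chart_dom c" using inv_in_dom patch_image[OF r] x by blast
    then have b: "bilinear (g0 c (\<psi> x))" by (rule g0_bilinear[OF c])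
    show ?thesis using v
      by (simp add: \<Phi>[OF x, symmetric] bilinear_lmul[OF b] bilinear_rmul[OF b] power2_eq_square field_simps)
  qed
  have lo: "\<Phi> y1 * (norm v)\<^sup>2 \<le> g0 c (\<psi> x) v v" and hi: "g0 c (\<psi> x) v v \<le> \<Phi> y2 * (norm v)\<^sup>2"
    if x: "x \<in> patch r" for x v
  proof -
    have "\<psi> x \<in> chart_dom c" using inv_in_dom patch_image[OF r] x by blast
    then have b: "bilinear (g0 c (\<psi> x))" by (rule g0_bilinear[OF c])
    show "\<Phi> y1 * (norm v)\<^sup>2 \<le> g0 c (\<psi> x) v v" "g0 c (\<psi> x) v v \<le> \<Phi> y2 * (norm v)\<^sup>2"
      using scale[OF x, of v] y1(2)[of "(x, v /\<^sub>R norm v)"] y2(2)[of "(x, v /\<^sub>R norm v)"] x bilinear_lzero[OF b]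
      by (cases "v = 0"; simp add: mult.commute mult_right_mono)+
  qed
  show ?thesis
    by (rule that[of "sqrt (\<Phi> y1)" "sqrt (\<Phi> y2)"]) (use pos[OF y1(1)] pos[OF y2(1)] lo hi in \<open>simp_all add: less_imp_le\<close>)
qed

lemma rho_patch_upper:
  assumes r: "small r" and i: "i \<in> {1..N}"
  obtains B where "0 < B" "\<And>x. x \<in> patch r \<Longrightarrow> \<rho> i (\<psi> x) \<le> B"
proof -
  have "continuous_on (patch r) (\<lambda>x. \<rho> i (\<psi> x))"
    by (rule continuous_on_subset[OF rho_continuous[OF i c] patch_image[OF r]])
  from continuous_attains_sup[OF patch_compact _ this] x0_patch[OF r]
  obtain y where y: "y \<in> patch r" "\<And>x. x \<in> patch r \<Longrightarrow> \<rho> i (\<psi> x) \<le> \<rho> i (\<psi> y)" by blast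
  have "0 \<le> \<rho> i (\<psi> y)" by (rule rho_nonneg[OF i inv_in_space[OF c]]) (use y patch_image[OF r] in blast)
  with y show ?thesis by (intro that[of "\<rho> i (\<psi> y) + 1"]) force+
qed

lemma rho_patch_lower:
  assumes r: "small r" and i: "i \<in> {1..N} - I"
  obtains b where "0 < b" "\<And>x. x \<in> patch r \<Longrightarrow> b \<le> \<rho> i (\<psi> x)"
proof -
  have "continuous_on (patch r) (\<lambda>x. \<rho> i (\<psi> x))"
    by (rule continuous_on_subset[OF rho_continuous[OF _ c] patch_image[OF r]]) (use i in auto)
  from continuous_attains_inf[OF patch_compact _ this] x0_patch[OF r]
  obtain y where y: "y \<in> patch r" "\<And>x. x \<in> patch r \<Longrightarrow> \<rho> i (\<psi> y) \<le> \<rho> i (\<psi> x)" by blast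
  have "0 < \<rho> i (\<psi> y)" using r y(1) i unfolding small_def by blast
  with y show ?thesis by (intro that[of "\<rho> i (\<psi> y)"])
qed

text \<open>The extension \<open>G\<close> lives on a full ball, so the mean value inequality can
  use segments outside the corner. The operator norm is bounded by the sum of the absolute partial
  derivatives, whose continuity is known direction by direction.\<close>

lemma rho_lipschitz:
  assumes i: "i \<in> {1..N}"
  obtains r L where "small r" "0 < L"
    "\<And>x y. x \<in> patch r \<Longrightarrow> y \<in> patch r \<Longrightarrow> \<bar>\<rho> i (\<psi> x) - \<rho> i (\<psi> y)\<bar> \<le> L * norm (x - y)"
proof -
  obtain r0 where r0: "small r0" using small_exists by blast
  obtain r1 G G' where G: "r1 > 0" "\<And>y. y \<in> ball x0 r1 \<Longrightarrow> (G has_derivative G' y) (at y)"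
    "\<And>v. continuous_on (ball x0 r1) (\<lambda>y. G' y v)"
    "\<And>y. y \<in> chart_image c \<Longrightarrow> y \<in> ball x0 r1 \<Longrightarrow> G y = \<rho> i (\<psi> y)"
    using rho_C1[OF i c pc] by metis
  define r where "r = min r0 (r1 / 2)"
  have r: "small r" by (rule small_mono[OF r0]) (use r0 G(1) in \<open>auto simp: r_def small_def\<close>)
  have sub: "cball x0 r \<subseteq> ball x0 r1" using G(1) by (auto simp: r_def)
  have "continuous_on (cball x0 r) (\<lambda>y. \<Sum>j\<in>UNIV. \<bar>G' y (axis j 1)\<bar>)"
    by (intro continuous_intros continuous_on_subset[OF G(3) sub])
  then have "bounded ((\<lambda>y. \<Sum>j\<in>UNIV. \<bar>G' y (axis j 1)\<bar>) ` cball x0 r)"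
    by (intro compact_imp_bounded compact_continuous_image) auto
  then obtain L where L: "L > 0" "\<And>y. y \<in> cball x0 r \<Longrightarrow> (\<Sum>j\<in>UNIV. \<bar>G' y (axis j 1)\<bar>) \<le> L"
    unfolding bounded_pos by force
  have on: "onorm (G' y) \<le> L" if y: "y \<in> cball x0 r" for y
  proof (rule onorm_le)
    fix v :: "real^'n"
    have lin: "linear (G' y)" using has_derivative_linear[OF G(2)] sub y by blast
    have "G' y v = G' y (\<Sum>j\<in>UNIV. v $ j *\<^sub>R axis j 1)"
      by (simp add: basis_expansion flip: scalar_mult_eq_scaleR)
    also have "\<dots> = (\<Sum>j\<in>UNIV. v $ j * G' y (axis j 1))"
      by (simp add: linear_sum[OF lin] linear_scale[OF lin])
    finally have "norm (G' y v) \<le> (\<Sum>j\<in>UNIV. \<bar>v $ j * G' y (axis j 1)\<bar>)" by simp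
    also have "\<dots> \<le> (\<Sum>j\<in>UNIV. norm v * \<bar>G' y (axis j 1)\<bar>)"
      by (intro sum_mono) (simp add: abs_mult mult_right_mono component_le_norm_cart)
    also have "\<dots> = norm v * (\<Sum>j\<in>UNIV. \<bar>G' y (axis j 1)\<bar>)" by (simp add: sum_distrib_left)
    also have "\<dots> \<le> norm v * L" by (intro mult_left_mono L(2) y) simp
    finally show "norm (G' y v) \<le> L * norm v" by (simp add: mult.commute)
  qed
  have "norm (G x - G y) \<le> L * norm (x - y)" if "x \<in> cball x0 r" "y \<in> cball x0 r" for x y
    by (rule differentiable_bound[OF convex_cball _ on that])
      (use G(2) sub in \<open>blast intro: has_derivative_at_withinI\<close>)
  moreover have "G x = \<rho> i (\<psi> x)" if "x \<in> patch r" for x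
    using that G(4) patch_image[OF r] sub by blast
  ultimately show ?thesis by (intro that[OF r L(1)]) (metis Int_iff real_norm_def)
qed

text \<open>Positivity of the derivative along \<open>e\<close> persists near \<open>x0\<close> by
  continuity. The start \<open>x\<close> may be any point of the patch, as \<open>\<rho> i\<close>
  is nonnegative there.\<close>

lemma rho_inward_growth:
  assumes i: "i \<in> I"
  obtains r k where "small r" "0 < k"
    "\<And>x t. x \<in> patch r \<Longrightarrow> x + t *\<^sub>R e \<in> patch r \<Longrightarrow> 0 \<le> t \<Longrightarrow> k * t \<le> \<rho> i (\<psi> (x + t *\<^sub>R e))"
proof -
  have iN: "i \<in> {1..N}" using i I by blast
  have pH: "p \<in> H i" using pF i by (auto simp: open_face_def face_index_def)
  obtain r0 where r0: "small r0" using small_exists by blast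
  obtain r1 G G' where G: "r1 > 0" "\<And>y. y \<in> ball x0 r1 \<Longrightarrow> (G has_derivative G' y) (at y)"
    "\<And>v. continuous_on (ball x0 r1) (\<lambda>y. G' y v)"
    "\<And>y. y \<in> chart_image c \<Longrightarrow> y \<in> ball x0 r1 \<Longrightarrow> G y = \<rho> i (\<psi> y)"
    "((\<rho> i \<circ> \<psi>) has_derivative G' x0) (at x0 within chart_image c)"
    using rho_C1[OF iN c pc] by metis
  have pos: "0 < G' x0 e" by (rule rho_derivative_inward[OF iN pH pc c G(5)])
  have "isCont (\<lambda>y. G' y e) x0"
    using G(1,3) by (simp add: continuous_on_eq_continuous_at)
  then have "((\<lambda>y. G' y e) \<longlongrightarrow> G' x0 e) (nhds x0)"
    by (simp add: isCont_def tendsto_nhds_iff)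
  then have "\<forall>\<^sub>F y in nhds x0. G' x0 e / 2 < G' y e"
    by (rule order_tendstoD(1)) (use pos in simp)
  then obtain r2 where r2: "r2 > 0" "\<And>y. dist y x0 < r2 \<Longrightarrow> G' x0 e / 2 < G' y e"
    unfolding eventually_nhds_metric by auto
  define r where "r = min r0 (min (r1 / 2) (r2 / 2))"
  have r: "small r" by (rule small_mono[OF r0]) (use r0 G(1) r2(1) in \<open>auto simp: r_def small_def\<close>)
  have sub: "cball x0 r \<subseteq> ball x0 r1" "cball x0 r \<subseteq> ball x0 r2" using G(1) r2(1) by (auto simp: r_def)
  have eq: "G x = \<rho> i (\<psi> x)" if "x \<in> patch r" for x
    using that G(4) patch_image[OF r] sub by blast
  show ?thesis
  proof (rule that[OF r, of "G' x0 e / 2"])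
    fix x t assume x: "x \<in> patch r" "x + t *\<^sub>R e \<in> patch r" "(0::real) \<le> t"
    have "G x + G' x0 e / 2 * t \<le> G (x + t *\<^sub>R e)"
    proof (rule convex_direction_growth[of "cball x0 r" G G'])
      show "(G has_derivative G' y) (at y)" if "y \<in> cball x0 r" for y using that G(2) sub by blast
      show "G' x0 e / 2 \<le> G' y e" if "y \<in> cball x0 r" for y
        using r2(2)[of y] subsetD[OF sub(2) that] by (simp add: dist_commute)
    qed (use x in auto)
    moreover have "0 \<le> G x"
      using eq[OF x(1)] rho_nonneg[OF iN inv_in_space[OF c]] patch_image[OF r] x(1) by auto
    ultimately show "G' x0 e / 2 * t \<le> \<rho> i (\<psi> (x + t *\<^sub>R e))" using eq[OF x(2)] by simp
  qed (use pos in simp)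
qed

text \<open>Exponent 0 for the other hypersurfaces gives bounds of one form for all \<open>N\<close>
  factors of \<open>weight\<close>; their product has exponent \<open>- A\<close>.\<close>

definition expo :: "nat \<Rightarrow> real" where "expo i = (if i \<in> I then \<alpha> i else 0)"

lemma prod_expo:
  assumes "0 < s"
  shows "(\<Prod>i=1..N. k i * s powr (- expo i)) = (\<Prod>i=1..N. k i) * s powr (- A)"
proof -
  have "(\<Sum>i=1..N. expo i) = A"
    unfolding expo_def using I by (subst sum.inter_restrict[symmetric]) (auto simp: Int_absorb1)
  then have "(\<Prod>i=1..N. s powr (- expo i)) = s powr (- A)"
    using assms powr_sum[of s "\<lambda>i. - expo i" "{1..N}"] by (simp add: sum_negf)
  then show ?thesis by (simp add: prod.distrib)
qed

lemma small_Min: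
  assumes "\<And>i. i \<in> {1..N} \<Longrightarrow> small (r i)"
  obtains s where "small s" "\<And>i. i \<in> {1..N} \<Longrightarrow> s \<le> r i"
proof -
  obtain r0 where r0: "small r0" using small_exists by blast
  define s where "s = Min (insert r0 (r ` {1..N}))"
  have "0 < s" using r0 assms by (auto simp: s_def small_def)
  moreover have "s \<le> r0" "\<And>i. i \<in> {1..N} \<Longrightarrow> s \<le> r i" unfolding s_def by (rule Min_le; simp)+
  ultimately show ?thesis using small_mono[OF r0] that by blast
qed

text \<open>Negative powers turn upper bounds on the \<open>\<rho> i\<close> into lower bounds, and
  factors with \<open>i\<close> outside \<open>I\<close> contribute constants. The centre
  \<open>z\<close> varies over the face near \<open>p\<close>, which makes the later constants
  uniform.\<close>

lemma weight_lower:
  obtains r k where "small r" "0 < k"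
    "\<And>x z s. \<lbrakk>x \<in> patch r; z \<in> patch r; \<psi> z \<in> face; \<psi> x \<in> M; 0 < s; norm (x - z) \<le> s\<rbrakk>
      \<Longrightarrow> k * s powr (- A) \<le> weight (\<psi> x)"
proof -
  have "\<exists>r k. small r \<and> 0 < k \<and> (\<forall>x\<in>patch r. \<forall>z\<in>patch r. \<forall>s>0. \<psi> z \<in> face \<longrightarrow> 0 < \<rho> i (\<psi> x)
      \<longrightarrow> norm (x - z) \<le> s \<longrightarrow> k * s powr (- expo i) \<le> \<rho> i (\<psi> x) powr (- \<alpha> i))"
    if i: "i \<in> {1..N}" for i
  proof (cases "i \<in> I")
    case True
    obtain r L where r: "small r" "0 < L"
      "\<And>x y. x \<in> patch r \<Longrightarrow> y \<in> patch r \<Longrightarrow> \<bar>\<rho> i (\<psi> x) - \<rho> i (\<psi> y)\<bar> \<le> L * norm (x - y)"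
      by (rule rho_lipschitz[OF i]) blast
    have "L powr (- \<alpha> i) * s powr (- \<alpha> i) \<le> \<rho> i (\<psi> x) powr (- \<alpha> i)"
      if "x \<in> patch r" "z \<in> patch r" "0 < s" "\<psi> z \<in> face" "0 < \<rho> i (\<psi> x)" "norm (x - z) \<le> s" for x z s
    proof -
      have "\<psi> z \<in> H i" using that(4) True by (auto simp: open_face_def face_index_def)
      then have "\<rho> i (\<psi> x) \<le> L * norm (x - z)"
        using r(3)[OF that(1,2)] hypersurface_eq[OF i] by simp
      also have "\<dots> \<le> L * s" using that(6) r(2) by simp
      finally have "(L * s) powr (- \<alpha> i) \<le> \<rho> i (\<psi> x) powr (- \<alpha> i)"
        using that(5) \<alpha>[OF i] by (intro powr_mono2') auto
      then show ?thesis using r(2) that(3) by (simp add: powr_mult)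
    qed
    then show ?thesis using r(1,2) True
      by (intro exI[of _ r] exI[of _ "L powr (- \<alpha> i)"]) (simp add: expo_def)
  next
    case False
    obtain r where r: "small r" using small_exists by blast
    obtain B where B: "0 < B" "\<And>x. x \<in> patch r \<Longrightarrow> \<rho> i (\<psi> x) \<le> B"
      using rho_patch_upper[OF r i] by blast
    have "B powr (- \<alpha> i) \<le> \<rho> i (\<psi> x) powr (- \<alpha> i)" if "x \<in> patch r" "0 < \<rho> i (\<psi> x)" for x
      using that B(2) \<alpha>[OF i] by (intro powr_mono2') auto
    then show ?thesis using r B(1) False
      by (intro exI[of _ r] exI[of _ "B powr (- \<alpha> i)"]) (simp add: expo_def)
  qed
  then obtain r k where rk: "\<And>i. i \<in> {1..N} \<Longrightarrow> small (r i) \<and> 0 < k i \<and>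
      (\<forall>x\<in>patch (r i). \<forall>z\<in>patch (r i). \<forall>s>0. \<psi> z \<in> face \<longrightarrow> 0 < \<rho> i (\<psi> x)
      \<longrightarrow> norm (x - z) \<le> s \<longrightarrow> k i * s powr (- expo i) \<le> \<rho> i (\<psi> x) powr (- \<alpha> i))"
    by metis
  obtain s0 where s0: "small s0" "\<And>i. i \<in> {1..N} \<Longrightarrow> s0 \<le> r i"
    using small_Min[of r] rk by blast
  show ?thesis
  proof (rule that[OF s0(1), of "\<Prod>i=1..N. k i"])
    show "0 < (\<Prod>i=1..N. k i)" using rk by (intro prod_pos) auto
    fix x z s assume a: "x \<in> patch s0" "z \<in> patch s0" "\<psi> z \<in> face" "\<psi> x \<in> M" "0 < (s::real)" "norm (x - z) \<le> s"
    have "(\<Prod>i=1..N. k i * s powr (- expo i)) \<le> weight (\<psi> x)"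
      unfolding weight_def
    proof (intro prod_mono conjI)
      fix i assume i: "i \<in> {1..N}"
      show "0 \<le> k i * s powr (- expo i)" using rk[OF i] by simp
      have "patch s0 \<subseteq> patch (r i)" using s0(2)[OF i] by auto
      then show "k i * s powr (- expo i) \<le> \<rho> i (\<psi> x) powr (- \<alpha> i)"
        using rk[OF i] a rho_pos_interior[OF a(4) i] by blast
    qed
    then show "(\<Prod>i=1..N. k i) * s powr (- A) \<le> weight (\<psi> x)" using prod_expo[OF a(5), of k] by simp
  qed
qed

text \<open>Only the inward displacement \<open>t\<close> enters, not the height of \<open>x\<close>
  itself, so the bound is uniform over base points arbitrarily close to the boundary.\<close>

lemma weight_upper:
  obtains r k where "small r" "0 < k"
    "\<And>x t. \<lbrakk>x \<in> patch r; x + t *\<^sub>R e \<in> patch r; 0 < t\<rbrakk>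
      \<Longrightarrow> weight (\<psi> (x + t *\<^sub>R e)) \<le> k * t powr (- A)"
proof -
  have "\<exists>r k. small r \<and> 0 < k \<and> (\<forall>x\<in>patch r. \<forall>t>0. x + t *\<^sub>R e \<in> patch r \<longrightarrow>
      \<rho> i (\<psi> (x + t *\<^sub>R e)) powr (- \<alpha> i) \<le> k * t powr (- expo i))"
    if i: "i \<in> {1..N}" for i
  proof (cases "i \<in> I")
    case True
    obtain r k where r: "small r" "0 < k"
      "\<And>x t. x \<in> patch r \<Longrightarrow> x + t *\<^sub>R e \<in> patch r \<Longrightarrow> 0 \<le> t \<Longrightarrow> k * t \<le> \<rho> i (\<psi> (x + t *\<^sub>R e))"
      by (rule rho_inward_growth[OF True]) blast
    have "\<rho> i (\<psi> (x + t *\<^sub>R e)) powr (- \<alpha> i) \<le> k powr (- \<alpha> i) * t powr (- \<alpha> i)"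
      if "x \<in> patch r" "x + t *\<^sub>R e \<in> patch r" "0 < t" for x t
    proof -
      have "\<rho> i (\<psi> (x + t *\<^sub>R e)) powr (- \<alpha> i) \<le> (k * t) powr (- \<alpha> i)"
        using r(3)[OF that(1,2)] that(3) r(2) \<alpha>[OF i] by (intro powr_mono2') auto
      then show ?thesis using r(2) that(3) by (simp add: powr_mult)
    qed
    then show ?thesis using r(1,2) True
      by (intro exI[of _ r] exI[of _ "k powr (- \<alpha> i)"]) (simp add: expo_def)
  next
    case False
    obtain r where r: "small r" using small_exists by blast
    have i': "i \<in> {1..N} - I" using i False by blast
    obtain b where b: "0 < b" "\<And>x. x \<in> patch r \<Longrightarrow> b \<le> \<rho> i (\<psi> x)"
      using rho_patch_lower[OF r i'] by blast
    have "\<rho> i (\<psi> x) powr (- \<alpha> i) \<le> b powr (- \<alpha> i)" if "x \<in> patch r" for x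
      using that b \<alpha>[OF i] by (intro powr_mono2') auto
    then show ?thesis using r b(1) False
      by (intro exI[of _ r] exI[of _ "b powr (- \<alpha> i)"]) (simp add: expo_def)
  qed
  then obtain r k where rk: "\<And>i. i \<in> {1..N} \<Longrightarrow> small (r i) \<and> 0 < k i \<and>
      (\<forall>x\<in>patch (r i). \<forall>t>0. x + t *\<^sub>R e \<in> patch (r i) \<longrightarrow>
      \<rho> i (\<psi> (x + t *\<^sub>R e)) powr (- \<alpha> i) \<le> k i * t powr (- expo i))"
    by metis
  obtain s0 where s0: "small s0" "\<And>i. i \<in> {1..N} \<Longrightarrow> s0 \<le> r i"
    using small_Min[of r] rk by blast
  show ?thesis
  proof (rule that[OF s0(1), of "\<Prod>i=1..N. k i"])
    show "0 < (\<Prod>i=1..N. k i)" using rk by (intro prod_pos) auto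
    fix x t assume a: "x \<in> patch s0" "x + t *\<^sub>R e \<in> patch s0" "0 < (t::real)"
    have "weight (\<psi> (x + t *\<^sub>R e)) \<le> (\<Prod>i=1..N. k i * t powr (- expo i))"
      unfolding weight_def
    proof (intro prod_mono conjI)
      fix i assume i: "i \<in> {1..N}"
      have "patch s0 \<subseteq> patch (r i)" using s0(2)[OF i] by auto
      then show "\<rho> i (\<psi> (x + t *\<^sub>R e)) powr (- \<alpha> i) \<le> k i * t powr (- expo i)"
        using rk[OF i] a by blast
    qed simp
    then show "weight (\<psi> (x + t *\<^sub>R e)) \<le> (\<Prod>i=1..N. k i) * t powr (- A)"
      using prod_expo[OF a(3), of k] by simp
  qed
qed

end

section \<open>Distance estimates\<close>

context conformal_face
begin

sublocale face_metric: corner_metric X \<A> g0 face by (rule corner_metric_g0)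
sublocale interior_metric: corner_metric X \<A> gP M by (rule corner_metric_gP)

end

text \<open>Gathers all constants on one common radius. The bound \<open>r \<le> 1\<close> makes
  powers of lengths antitone in the exponent, as used in deriving \<open>A < 2\<close>.\<close>

locale face_estimates = conformal_face X \<A> N H \<rho> I p c g0 \<alpha>
  for X :: "'a topology" and \<A> :: "('a, 'n::finite) chart set" and N H \<rho> I p c g0 \<alpha> +
  fixes r m m' k k' :: real
  assumes r: "small r" "r \<le> 1"
    and flat: "q \<in> chart_dom c \<Longrightarrow> \<phi> q \<in> ball x0 r \<Longrightarrow> q \<in> face \<longleftrightarrow> (\<forall>j\<in>J. \<phi> q $ j = 0)"
    and m: "0 < m" "0 < m'" and k: "0 < k" "0 < k'"
    and g0_lower: "x \<in> patch r \<Longrightarrow> m\<^sup>2 * (norm v)\<^sup>2 \<le> g0 c (\<psi> x) v v"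
    and g0_upper: "x \<in> patch r \<Longrightarrow> g0 c (\<psi> x) v v \<le> m'\<^sup>2 * (norm v)\<^sup>2"
    and w_lower: "\<lbrakk>x \<in> patch r; z \<in> patch r; \<psi> z \<in> face; \<psi> x \<in> M; 0 < s; norm (x - z) \<le> s\<rbrakk>
      \<Longrightarrow> k * s powr (- A) \<le> weight (\<psi> x)"
    and w_upper: "\<lbrakk>x \<in> patch r; x + t *\<^sub>R e \<in> patch r; 0 < t\<rbrakk>
      \<Longrightarrow> weight (\<psi> (x + t *\<^sub>R e)) \<le> k' * t powr (- A)"

lemma (in conformal_face) face_estimates_exist:
  "\<exists>r m m' k k'. face_estimates X \<A> N H \<rho> I p c g0 \<alpha> r m m' k k'"
proof -
  obtain r1 where r1: "small r1" "\<forall>q\<in>chart_dom c. \<phi> q \<in> ball x0 r1 \<longrightarrow>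
    (q \<in> face \<longleftrightarrow> (\<forall>j\<in>J. \<phi> q $ j = 0))" using face_flat by blast
  obtain r2 k where r2: "small r2" "0 < k"
    "\<And>x z s. \<lbrakk>x \<in> patch r2; z \<in> patch r2; \<psi> z \<in> face; \<psi> x \<in> M; 0 < s; norm (x - z) \<le> s\<rbrakk>
      \<Longrightarrow> k * s powr (- A) \<le> weight (\<psi> x)" by (rule weight_lower) blast
  obtain r3 k' where r3: "small r3" "0 < k'"
    "\<And>x t. \<lbrakk>x \<in> patch r3; x + t *\<^sub>R e \<in> patch r3; 0 < t\<rbrakk>
      \<Longrightarrow> weight (\<psi> (x + t *\<^sub>R e)) \<le> k' * t powr (- A)" by (rule weight_upper) blast
  define r where "r = min (min r1 1) (min r2 r3)"
  have r: "small r" by (rule small_mono[OF r1(1)]) (use r1(1) r2(1) r3(1) in \<open>auto simp: r_def small_def\<close>)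
  obtain m m' where m: "0 < m" "0 < m'"
    "\<And>x v. x \<in> patch r \<Longrightarrow> m\<^sup>2 * (norm v)\<^sup>2 \<le> g0 c (\<psi> x) v v"
    "\<And>x v. x \<in> patch r \<Longrightarrow> g0 c (\<psi> x) v v \<le> m'\<^sup>2 * (norm v)\<^sup>2"
    by (rule g0_bounds[OF r]) blast
  have sub: "patch r \<subseteq> patch r2" "patch r \<subseteq> patch r3" "ball x0 r \<subseteq> ball x0 r1" by (auto simp: r_def)
  have "face_estimates X \<A> N H \<rho> I p c g0 \<alpha> r m m' k k'"
  proof
    show "small r" by fact
    show "r \<le> 1" by (simp add: r_def)
    show "q \<in> face \<longleftrightarrow> (\<forall>j\<in>J. \<phi> q $ j = 0)" if "q \<in> chart_dom c" "\<phi> q \<in> ball x0 r" for q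
      using r1(2) that sub(3) by blast
    show "k * s powr (- A) \<le> weight (\<psi> x)"
      if "x \<in> patch r" "z \<in> patch r" "\<psi> z \<in> face" "\<psi> x \<in> M" "0 < s" "norm (x - z) \<le> s" for x z s
      using r2(3)[of x z s] that sub(1) by blast
    show "weight (\<psi> (x + t *\<^sub>R e)) \<le> k' * t powr (- A)"
      if "x \<in> patch r" "x + t *\<^sub>R e \<in> patch r" "0 < t" for x t
      using r3(3)[of x t] that sub(2) by blast
  qed (use m r2(2) r3(2) in auto)
  then show ?thesis by blast
qed

context face_estimates
begin

lemma r_pos: "0 < r" using r(1) by (simp add: small_def)

lemma map_in_patch: "q \<in> chart_dom c \<Longrightarrow> \<phi> q \<in> cball x0 r \<Longrightarrow> \<phi> q \<in> patch r"
  using image_corner[OF c map_in_image] by blast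

lemma patch_inv:
  assumes "x \<in> patch r"
  shows "\<psi> x \<in> chart_dom c" "\<phi> (\<psi> x) = x"
  using patch_image[OF r(1)] assms inv_in_dom map_inv by blast+

lemma cball_sub:
  assumes "y \<in> cball x0 (r / 2)" "\<kappa> \<le> r / 2"
  shows "cball y \<kappa> \<subseteq> cball x0 r"
proof
  fix u assume "u \<in> cball y \<kappa>"
  then show "u \<in> cball x0 r" using assms dist_triangle[of x0 u y] by simp
qed

lemma dF_lower:
  assumes z: "z \<in> face" "z \<in> chart_dom c" "\<phi> z \<in> cball x0 (r / 2)"
    and \<kappa>: "0 < \<kappa>" "\<kappa> \<le> r / 2" and out: "\<not> (z' \<in> chart_dom c \<and> norm (\<phi> z' - \<phi> z) < \<kappa>)"
  shows "ennreal (m * \<kappa> / 2) \<le> dF z z'"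
proof (rule face_metric.exit_dist[OF c z(2) _ \<kappa>(1) _ out])
  note sub = cball_sub[OF z(3) \<kappa>(2)]
  then show "cball (\<phi> z) \<kappa> \<inter> corner K \<subseteq> chart_image c"
    using patch_image[OF r(1)] by blast
  fix y v assume y: "y \<in> face" "y \<in> chart_dom c" "norm (\<phi> y - \<phi> z) < \<kappa>"
  then have "\<phi> y \<in> cball (\<phi> z) \<kappa>" by (simp add: dist_norm norm_minus_commute)
  then have "\<phi> y \<in> patch r" using sub map_in_patch[OF y(2)] by blast
  from g0_lower[OF this] show "m\<^sup>2 * (norm v)\<^sup>2 \<le> g0 c y v v" using inv_map[OF c y(2)] by simp
qed (use \<kappa> m in auto)

lemma nn_integral_const_unit: "0 \<le> C \<Longrightarrow> (\<integral>\<^sup>+t\<in>{0..1::real}. ennreal C \<partial>lborel) = ennreal C"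
  by (simp add: nn_integral_cmult_indicator)

text \<open>The face is flat in the chart, so the coordinate segment between two of its points stays
  in it.\<close>

lemma dF_upper:
  assumes z: "z \<in> face" "z \<in> chart_dom c" "\<phi> z \<in> ball x0 r"
    and z': "z' \<in> face" "z' \<in> chart_dom c" "\<phi> z' \<in> ball x0 r"
  shows "dF z z' \<le> ennreal (m' * norm (\<phi> z' - \<phi> z))"
proof -
  let ?v = "\<phi> z' - \<phi> z"
  have pt: "\<phi> z + t *\<^sub>R ?v \<in> patch r" "\<psi> (\<phi> z + t *\<^sub>R ?v) \<in> face"
    if t: "t \<in> {0..1}" for t
  proof -
    let ?y = "\<phi> z + t *\<^sub>R ?v"
    have "?y = (1 - t) *\<^sub>R \<phi> z + t *\<^sub>R \<phi> z'" by (simp add: algebra_simps)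
    then have yb: "?y \<in> ball x0 r" using convexD_alt[OF convex_ball z(3) z'(3)] t by auto
    then have yc: "?y \<in> cball x0 r" by auto
    have yJ: "?y $ j = 0" if "j \<in> J" for j using flat[OF z(2,3)] flat[OF z'(2,3)] z(1) z'(1) that by simp
    have "0 \<le> ?y $ j" if "j \<in> K" for j
    proof (cases "j \<in> J")
      case False
      then show ?thesis using r(1) yc that unfolding small_def by (meson DiffI less_imp_le)
    qed (use yJ in simp)
    then show yp: "?y \<in> patch r" using yc by (simp add: corner_def)
    show "\<psi> ?y \<in> face"
      using flat[OF patch_inv(1)[OF yp]] patch_inv(2)[OF yp] yb yJ by simp
  qed
  have "dF (\<psi> (\<phi> z)) (\<psi> (\<phi> z + ?v)) \<le> (\<integral>\<^sup>+t\<in>{0..1::real}. ennreal (m' * norm ?v) \<partial>lborel)"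
  proof (rule face_metric.segment_dist_le[OF c, where h="\<lambda>_. m' * norm ?v"])
    fix t :: real assume "t \<in> {0..1}"
    then show "\<phi> z + t *\<^sub>R ?v \<in> chart_image c" "\<psi> (\<phi> z + t *\<^sub>R ?v) \<in> face"
      using pt patch_image[OF r(1)] by blast+
  next
    fix t :: real assume "t \<in> {0<..<1}"
    then have "\<phi> z + t *\<^sub>R ?v \<in> patch r" using pt(1) by auto
    then show "0 \<le> m' * norm ?v \<and> g0 c (\<psi> (\<phi> z + t *\<^sub>R ?v)) ?v ?v \<le> (m' * norm ?v)\<^sup>2"
      using g0_upper m by (simp add: power_mult_distrib)
  qed
  then show ?thesis
    using inv_map[OF c] z(2) z'(2) m by (simp add: nn_integral_const_unit)
qed

lemma powr_half_square: "0 < s \<Longrightarrow> (s powr (- A / 2))\<^sup>2 = s powr (- A)"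
  by (simp add: power2_eq_square flip: powr_add)

lemma powr_half_mult: "0 < s \<Longrightarrow> s * s powr (- A / 2) = s powr (1 - A / 2)"
  by (simp add: powr_mult_base)

text \<open>The exit estimate with speed constant
  \<open>sqrt k * \<kappa> powr (- A / 2) * m\<close>; the factor \<open>\<kappa>\<close> of the
  distance crossed lifts the exponent to \<open>1 - A / 2\<close>. The ball is centred at the
  boundary point \<open>z\<close>, while the curve starts at the interior point
  \<open>q\<close>.\<close>

lemma dP_lower:
  assumes z: "z \<in> face" "z \<in> chart_dom c" "\<phi> z \<in> cball x0 (r / 2)"
    and \<kappa>: "0 < \<kappa>" "\<kappa> \<le> r / 2"
    and q: "q \<in> chart_dom c" "norm (\<phi> q - \<phi> z) \<le> \<kappa> / 2"
    and out: "\<not> (q' \<in> chart_dom c \<and> norm (\<phi> q' - \<phi> z) < \<kappa>)"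
  shows "ennreal (sqrt k * m / 2 * \<kappa> powr (1 - A / 2)) \<le> dP q q'"
proof -
  note sub = cball_sub[OF z(3) \<kappa>(2)]
  have "ennreal (sqrt k * \<kappa> powr (- A / 2) * m * \<kappa> / 2) \<le> dP q q'"
  proof (rule interior_metric.exit_dist[OF c q \<kappa>(1) _ out])
    show "cball (\<phi> z) \<kappa> \<inter> corner K \<subseteq> chart_image c"
      using patch_image[OF r(1)] sub by blast
    fix y v assume y: "y \<in> M" "y \<in> chart_dom c" "norm (\<phi> y - \<phi> z) < \<kappa>"
    then have "\<phi> y \<in> cball (\<phi> z) \<kappa>" by (simp add: dist_norm norm_minus_commute)
    then have yp: "\<phi> y \<in> patch r" using sub map_in_patch[OF y(2)] by blast
    have zp: "\<phi> z \<in> patch r" using map_in_patch[OF z(2)] z(3) r_pos by auto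
    have "k * \<kappa> powr (- A) \<le> weight y"
      using w_lower[OF yp zp] inv_map[OF c] y z \<kappa>(1) by simp
    moreover have "m\<^sup>2 * (norm v)\<^sup>2 \<le> g0 c y v v" using g0_lower[OF yp] inv_map[OF c y(2)] by simp
    ultimately have "(k * \<kappa> powr (- A)) * (m\<^sup>2 * (norm v)\<^sup>2) \<le> gP c y v v"
      unfolding gP_eq using k(1) by (intro mult_mono) (auto simp: weight_def intro: prod_nonneg)
    moreover have "(sqrt k * \<kappa> powr (- A / 2) * m)\<^sup>2 = k * \<kappa> powr (- A) * m\<^sup>2"
      using k(1) \<kappa>(1) powr_half_square[of \<kappa>] by (simp add: power_mult_distrib)
    ultimately show "(sqrt k * \<kappa> powr (- A / 2) * m)\<^sup>2 * (norm v)\<^sup>2 \<le> gP c y v v"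
      by (simp only: mult.assoc)
  qed (use k m in simp)
  also have "sqrt k * \<kappa> powr (- A / 2) * m * \<kappa> / 2 = sqrt k * m / 2 * (\<kappa> * \<kappa> powr (- A / 2))" by simp
  also have "\<dots> = sqrt k * m / 2 * \<kappa> powr (1 - A / 2)" using powr_half_mult[OF \<kappa>(1)] by simp
  finally show ?thesis .
qed

text \<open>The alternative in \<open>pos\<close> covers both uses: a lift by positive
  \<open>t\<close> from a point that may lie on walls, and the start \<open>t = 0\<close> of a
  vertical segment, which is already interior.\<close>

lemma push_inward:
  assumes x: "x \<in> cball x0 (r / 2)" "\<And>j. j \<in> J \<Longrightarrow> 0 \<le> x $ j" and t: "0 \<le> t" "t * norm e \<le> r / 2"
    and pos: "0 < t \<or> (\<forall>j\<in>J. 0 < x $ j)"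
  shows "x + t *\<^sub>R e \<in> patch r" "\<psi> (x + t *\<^sub>R e) \<in> M"
proof -
  let ?y = "x + t *\<^sub>R e"
  have "?y \<in> cball x (r / 2)" using t by (simp add: dist_norm)
  then have yb: "?y \<in> cball x0 r" using cball_sub[OF x(1) order_refl] by blast
  have yp: "0 < ?y $ j" if "j \<in> K" for j
  proof (cases "j \<in> J")
    case True
    then show ?thesis using x(2)[OF True] pos t(1) by (auto simp: inward_def add_nonneg_pos add_pos_nonneg)
  next
    case False
    then show ?thesis using r(1) yb that unfolding small_def by blast
  qed
  then show p: "?y \<in> patch r" using yb by (auto simp: corner_def less_imp_le)
  have "vanishing_faces c (\<psi> ?y) = {}"
    using patch_inv(2)[OF p] yp by (force simp: vanishing_faces_def)
  then show "\<psi> ?y \<in> M" using mf_interior_iff[OF c patch_inv(1)[OF p]] by simp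
qed

lemma interior_coordinate_pos:
  assumes "q \<in> M" "q \<in> chart_dom c" "j \<in> J"
  shows "0 < \<phi> q $ j"
proof -
  have "vanishing_faces c q = {}" using mf_interior_iff[OF c assms(2)] assms(1) by simp
  then have "\<phi> q $ j \<noteq> 0" using assms(3) J_sub by (auto simp: vanishing_faces_def)
  moreover have "0 \<le> \<phi> q $ j"
    using image_corner[OF c map_in_image[OF assms(2)]] assms(3) J_sub by (auto simp: corner_def)
  ultimately show ?thesis by simp
qed

lemma gP_upper:
  assumes "x \<in> patch r" "x + t *\<^sub>R e \<in> patch r" "0 < t"
  shows "gP c (\<psi> (x + t *\<^sub>R e)) v v \<le> (sqrt k' * t powr (- A / 2) * m' * norm v)\<^sup>2"
proof -
  have "gP c (\<psi> (x + t *\<^sub>R e)) v v \<le> (k' * t powr (- A)) * (m'\<^sup>2 * (norm v)\<^sup>2)"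
    unfolding gP_eq
  proof (intro mult_mono w_upper[OF assms] g0_upper[OF assms(2)])
    have "0 \<le> m\<^sup>2 * (norm v)\<^sup>2" by simp
    also have "\<dots> \<le> g0 c (\<psi> (x + t *\<^sub>R e)) v v" by (rule g0_lower[OF assms(2)])
    finally show "0 \<le> g0 c (\<psi> (x + t *\<^sub>R e)) v v" .
  qed (use k in simp)
  also have "\<dots> = (sqrt k' * t powr (- A / 2) * m' * norm v)\<^sup>2"
    using k assms(3) powr_half_square[of t] by (simp add: power_mult_distrib)
  finally show ?thesis .
qed

section \<open>Interior distances bounded by detours at height t\<close>

context
  assumes A2: "A < 2"
begin

text \<open>The integral of \<open>t * (s * t) powr (- A / 2)\<close> over \<open>s\<close> in
  \<open>{0..1}\<close> is \<open>t powr (1 - A / 2) / (1 - A / 2)\<close>; the remaining factors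
  come from the bounds on the weight and on \<open>g0\<close> and from the length of
  \<open>e\<close>.\<close>

definition vconst :: real where "vconst = sqrt k' * m' * norm e / (1 - A / 2)"

lemma vertical_dist:
  assumes q: "q \<in> M" "q \<in> chart_dom c" "\<phi> q \<in> cball x0 (r / 2)"
    and t: "0 < t" "t * norm e \<le> r / 2"
  shows "dP q (\<psi> (\<phi> q + t *\<^sub>R e)) \<le> ennreal (vconst * t powr (1 - A / 2))"
proof -
  let ?x = "\<phi> q" and ?C = "sqrt k' * m' * norm e * t powr (1 - A / 2)"
  have pos: "0 < ?x $ j" if "j \<in> J" for j using interior_coordinate_pos[OF q(1,2) that] .
  have st: "0 \<le> s * t" "s * t * norm e \<le> r / 2" if "s \<in> {0..1}" for s
  proof -
    show "0 \<le> s * t" using that t by simp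
    have "s * (t * norm e) \<le> t * norm e"
      using that t by (intro mult_left_le_one_le) auto
    then show "s * t * norm e \<le> r / 2" unfolding mult.assoc using t(2) by linarith
  qed
  have pt: "?x + s *\<^sub>R t *\<^sub>R e \<in> patch r" "\<psi> (?x + s *\<^sub>R t *\<^sub>R e) \<in> M" if "s \<in> {0..1}" for s
    using push_inward[OF q(3) less_imp_le[OF pos] st[OF that]] pos by auto
  have xp: "?x \<in> patch r" using pt(1)[of 0] by simp
  have "dP (\<psi> ?x) (\<psi> (?x + t *\<^sub>R e)) \<le> (\<integral>\<^sup>+s\<in>{0..1::real}. ennreal (?C * s powr (- (A / 2))) \<partial>lborel)"
  proof (rule interior_metric.segment_dist_le[OF c, where h="\<lambda>s. ?C * s powr (- (A / 2))"])
    fix s :: real assume s: "s \<in> {0..1}"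
    show "?x + s *\<^sub>R t *\<^sub>R e \<in> chart_image c" using pt(1)[OF s] patch_image[OF r(1)] by blast
    show "\<psi> (?x + s *\<^sub>R t *\<^sub>R e) \<in> M" by (rule pt(2)[OF s])
  next
    fix s :: real assume s: "s \<in> {0<..<1}"
    have p: "?x + (s * t) *\<^sub>R e \<in> patch r" using pt(1)[of s] s by simp
    have "gP c (\<psi> (?x + (s * t) *\<^sub>R e)) (t *\<^sub>R e) (t *\<^sub>R e)
        \<le> (sqrt k' * (s * t) powr (- A / 2) * m' * norm (t *\<^sub>R e))\<^sup>2"
      by (rule gP_upper[OF xp p]) (use s t in simp)
    also have "sqrt k' * (s * t) powr (- A / 2) * m' * norm (t *\<^sub>R e) =
        sqrt k' * m' * norm e * (t * t powr (- A / 2)) * s powr (- A / 2)"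
      using s t by (simp add: powr_mult)
    also have "\<dots> = ?C * s powr (- (A / 2))" using powr_half_mult[OF t(1)] by simp
    finally show "0 \<le> ?C * s powr (- (A / 2)) \<and>
        gP c (\<psi> (?x + s *\<^sub>R t *\<^sub>R e)) (t *\<^sub>R e) (t *\<^sub>R e) \<le> (?C * s powr (- (A / 2)))\<^sup>2"
      using k m by simp
  qed
  also have "\<dots> = (\<integral>\<^sup>+s. ennreal ?C * (ennreal (s powr (- (A / 2))) * indicator {0..1} s) \<partial>lborel)"
    using k m by (intro nn_integral_cong) (simp add: ennreal_mult' mult.assoc)
  also have "\<dots> = ennreal ?C * (\<integral>\<^sup>+s\<in>{0..1::real}. ennreal (s powr (- (A / 2))) \<partial>lborel)"
    by (rule nn_integral_cmult) measurable
  also have "\<dots> = ennreal ?C * ennreal (1 / (1 - A / 2))"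
    using nn_integral_powr_unit[of "A / 2"] A2 by simp
  also have "\<dots> = ennreal (vconst * t powr (1 - A / 2))"
    using k m A2 by (subst ennreal_mult'[symmetric]) (auto simp: vconst_def)
  finally show ?thesis using inv_map[OF c q(2)] by simp
qed

lemma horizontal_dist:
  assumes q: "q \<in> M" "q \<in> chart_dom c" "\<phi> q \<in> cball x0 (r / 2)"
    and q': "q' \<in> M" "q' \<in> chart_dom c" "\<phi> q' \<in> cball x0 (r / 2)"
    and t: "0 < t" "t * norm e \<le> r / 2"
  shows "dP (\<psi> (\<phi> q + t *\<^sub>R e)) (\<psi> (\<phi> q' + t *\<^sub>R e))
    \<le> ennreal (sqrt k' * m' * t powr (- A / 2) * norm (\<phi> q' - \<phi> q))"
proof -
  let ?v = "\<phi> q' - \<phi> q"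
  let ?b = "\<lambda>s. \<phi> q + s *\<^sub>R ?v"
  have b: "?b s \<in> cball x0 (r / 2)" "\<And>j. j \<in> J \<Longrightarrow> 0 \<le> ?b s $ j" if s: "s \<in> {0..1}" for s
  proof -
    have eq: "?b s = (1 - s) *\<^sub>R \<phi> q + s *\<^sub>R \<phi> q'" by (simp add: algebra_simps)
    show "?b s \<in> cball x0 (r / 2)" unfolding eq using convexD_alt[OF convex_cball q(3) q'(3)] s by auto
    show "0 \<le> ?b s $ j" if "j \<in> J" for j
      unfolding eq using interior_coordinate_pos[OF q(1,2) that] interior_coordinate_pos[OF q'(1,2) that] s
      by simp
  qed
  have pt: "?b s + t *\<^sub>R e \<in> patch r" "\<psi> (?b s + t *\<^sub>R e) \<in> M" if s: "s \<in> {0..1}" for s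
    using push_inward[OF b[OF s] less_imp_le[OF t(1)] t(2)] t(1) by auto
  have comm: "\<phi> q + t *\<^sub>R e + s *\<^sub>R ?v = ?b s + t *\<^sub>R e" for s by simp
  \<comment> \<open>\<open>w_upper\<close> measures height from a base point, so the unlifted
    segment must lie in the patch too.\<close>
  have bp: "?b s \<in> patch r" if s: "s \<in> {0..1}" for s
  proof -
    have "?b s \<in> cball x0 r" using b(1)[OF s] r_pos by auto
    moreover have "0 \<le> ?b s $ j" if "j \<in> K" for j
    proof (cases "j \<in> J")
      case False
      then show ?thesis using r(1) calculation that unfolding small_def by (meson DiffI less_imp_le)
    qed (rule b(2)[OF s])
    ultimately show ?thesis by (simp add: corner_def)
  qed
  have "dP (\<psi> (\<phi> q + t *\<^sub>R e)) (\<psi> (\<phi> q + t *\<^sub>R e + ?v))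
     \<le> (\<integral>\<^sup>+s\<in>{0..1::real}. ennreal (sqrt k' * t powr (- A / 2) * m' * norm ?v) \<partial>lborel)"
  proof (rule interior_metric.segment_dist_le[OF c, where h="\<lambda>_. sqrt k' * t powr (- A / 2) * m' * norm ?v"])
    fix s :: real assume s: "s \<in> {0..1}"
    show "\<phi> q + t *\<^sub>R e + s *\<^sub>R ?v \<in> chart_image c"
      unfolding comm using pt(1)[OF s] patch_image[OF r(1)] by blast
    show "\<psi> (\<phi> q + t *\<^sub>R e + s *\<^sub>R ?v) \<in> M" unfolding comm by (rule pt(2)[OF s])
  next
    fix s :: real assume "s \<in> {0<..<1}"
    then have s: "s \<in> {0..1}" by simp
    show "0 \<le> sqrt k' * t powr (- A / 2) * m' * norm ?v \<and>
      gP c (\<psi> (\<phi> q + t *\<^sub>R e + s *\<^sub>R ?v)) ?v ?v \<le> (sqrt k' * t powr (- A / 2) * m' * norm ?v)\<^sup>2"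
      unfolding comm using gP_upper[OF bp[OF s] pt(1)[OF s] t(1)] k m by simp
  qed
  also have "\<dots> = ennreal (sqrt k' * m' * t powr (- A / 2) * norm ?v)"
    using k m by (subst nn_integral_const_unit) (auto simp: mult_ac)
  finally show ?thesis by (simp add: algebra_simps)
qed

definition hconst :: real where "hconst = sqrt k' * m'"

abbreviation detour :: "real \<Rightarrow> real \<Rightarrow> real" where
  "detour t l \<equiv> 2 * vconst * t powr (1 - A / 2) + hconst * t powr (- A / 2) * l"

lemma const_nonneg: "0 \<le> vconst" "0 < hconst"
  using k m A2 by (auto simp: vconst_def hconst_def)

lemma dP_upper:
  assumes q: "q \<in> M" "q \<in> chart_dom c" "\<phi> q \<in> cball x0 (r / 2)"
    and q': "q' \<in> M" "q' \<in> chart_dom c" "\<phi> q' \<in> cball x0 (r / 2)"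
    and t: "0 < t" "t * norm e \<le> r / 2"
  shows "dP q q' \<le> ennreal (detour t (norm (\<phi> q' - \<phi> q)))"
proof -
  let ?u = "\<psi> (\<phi> q + t *\<^sub>R e)" and ?u' = "\<psi> (\<phi> q' + t *\<^sub>R e)"
  have "dP q q' \<le> dP q ?u + (dP ?u ?u' + dP ?u' q')"
    by (rule order_trans[OF interior_metric.tri[where y="?u"]], rule add_left_mono, rule interior_metric.tri)
  also have "dP ?u' q' = dP q' ?u'" by (rule interior_metric.sym)
  also have "dP q ?u + (dP ?u ?u' + dP q' ?u') \<le> ennreal (vconst * t powr (1 - A / 2)) +
      (ennreal (hconst * t powr (- A / 2) * norm (\<phi> q' - \<phi> q)) + ennreal (vconst * t powr (1 - A / 2)))"
    unfolding hconst_def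
    by (intro add_mono vertical_dist[OF q t] vertical_dist[OF q' t] horizontal_dist[OF q q' t])
  also have "\<dots> = ennreal (detour t (norm (\<phi> q' - \<phi> q)))"
    using const_nonneg by (simp flip: ennreal_plus)
  finally show ?thesis .
qed

end

lemma eventually_near:
  assumes lim: "limitin X s z sequentially" and z: "z \<in> chart_dom c" and \<epsilon>: "0 < \<epsilon>"
  shows "\<forall>\<^sub>F n in sequentially. s n \<in> chart_dom c \<and> norm (\<phi> (s n) - \<phi> z) < \<epsilon>"
proof -
  have "openin X {q \<in> chart_dom c. \<phi> q \<in> ball (\<phi> z) \<epsilon>}"
    by (rule openin_chart_preimage[OF c open_ball])
  moreover have "z \<in> {q \<in> chart_dom c. \<phi> q \<in> ball (\<phi> z) \<epsilon>}" using z \<epsilon> by simp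
  ultimately have "\<forall>\<^sub>F n in sequentially. s n \<in> {q \<in> chart_dom c. \<phi> q \<in> ball (\<phi> z) \<epsilon>}"
    using lim unfolding limitin_def by blast
  then show ?thesis by eventually_elim (simp add: dist_norm norm_minus_commute)
qed

lemma p_not_interior: "I \<noteq> {} \<Longrightarrow> p \<notin> M"
proof
  assume "I \<noteq> {}" "p \<in> M"
  then obtain i where i: "i \<in> I" by blast
  then have "p \<in> H i" using pF by (auto simp: open_face_def face_index_def)
  then show False using rho_pos_interior[OF \<open>p \<in> M\<close>, of i] hypersurface_eq[of i] i I by fastforce
qed

text \<open>For \<open>A \<ge> 2\<close> the bound of \<open>dP_lower\<close> does not decay with
  the radius, as \<open>\<kappa> powr (1 - A / 2)\<close> is at least 1. A sequence that converges
  to \<open>p\<close> then has arbitrarily late terms at a fixed distance and is not Cauchy.\<close>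

lemma accessible_exponent:
  assumes I: "I \<noteq> {}" and acc: "accessible_point X M dP p"
  shows "A < 2"
proof (rule ccontr)
  assume "\<not> A < 2"
  obtain s where s: "cauchy_seq M dP s" "limitin X s p sequentially"
    using acc by (auto simp: accessible_point_def)
  define K1 where "K1 = sqrt k * m / 2"
  have K1: "0 < K1" using k m by (simp add: K1_def)
  then have "0 < ennreal K1" by simp
  then obtain n0 where n0: "\<And>i j. i \<ge> n0 \<Longrightarrow> j \<ge> n0 \<Longrightarrow> dP (s i) (s j) < ennreal K1"
    using s(1) unfolding cauchy_seq_def by meson
  have "\<forall>\<^sub>F n in sequentially. s n \<in> chart_dom c \<and> norm (\<phi> (s n) - x0) < r / 2"
    by (rule eventually_near[OF s(2) pc]) (use r_pos in simp)
  then obtain n1 where n1: "\<And>n. n \<ge> n1 \<Longrightarrow> s n \<in> chart_dom c \<and> norm (\<phi> (s n) - x0) < r / 2"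
    by (auto simp: eventually_sequentially)
  define j where "j = max n0 n1"
  have j: "s j \<in> chart_dom c" "norm (\<phi> (s j) - x0) < r / 2" "n0 \<le> j" using n1[of j] by (auto simp: j_def)
  \<comment> \<open>One late term fixes the radius; another late term is then taken within half of
    it. The radius is positive because \<open>p\<close> is not an interior point.\<close>
  define \<kappa> where "\<kappa> = norm (\<phi> (s j) - x0)"
  have "s j \<in> M" using s(1) by (auto simp: cauchy_seq_def)
  then have "s j \<noteq> p" using p_not_interior[OF I] by metis
  then have \<kappa>: "0 < \<kappa>" using inj_onD[OF map_inj[OF c] _ j(1) pc] by (auto simp: \<kappa>_def)
  have "\<forall>\<^sub>F n in sequentially. s n \<in> chart_dom c \<and> norm (\<phi> (s n) - x0) < \<kappa> / 2"
    by (rule eventually_near[OF s(2) pc]) (use \<kappa> in simp)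
  then obtain n2 where n2: "\<And>n. n \<ge> n2 \<Longrightarrow> s n \<in> chart_dom c \<and> norm (\<phi> (s n) - x0) < \<kappa> / 2"
    by (auto simp: eventually_sequentially)
  define i where "i = max n0 n2"
  have i: "s i \<in> chart_dom c" "norm (\<phi> (s i) - x0) < \<kappa> / 2" "n0 \<le> i" using n2[of i] by (auto simp: i_def)
  have "ennreal (sqrt k * m / 2 * \<kappa> powr (1 - A / 2)) \<le> dP (s i) (s j)"
    by (rule dP_lower[OF pF pc _ \<kappa> _ i(1)]) (use i j r_pos in \<open>auto simp: \<kappa>_def\<close>)
  moreover have "1 \<le> \<kappa> powr (1 - A / 2)"
  proof -
    have "\<kappa> \<le> 1" using j(2) r(2) by (simp add: \<kappa>_def)
    then have "\<kappa> powr 0 \<le> \<kappa> powr (1 - A / 2)" using \<kappa> \<open>\<not> A < 2\<close> by (intro powr_mono') auto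
    then show ?thesis using \<kappa> by simp
  qed
  then have "ennreal K1 \<le> ennreal (sqrt k * m / 2 * \<kappa> powr (1 - A / 2))"
    unfolding K1_def[symmetric] using K1 by (intro ennreal_leI) simp
  ultimately have "ennreal K1 \<le> dP (s i) (s j)" by (rule order_trans[rotated])
  with n0[OF i(3) j(3)] show False by simp
qed

end

section \<open>Comparison with the boundary distance\<close>

context face_estimates
begin

context
  assumes A2: "A < 2"
begin

lemma interior_sequence:
  assumes z: "z \<in> face" "z \<in> chart_dom c" "\<phi> z \<in> cball x0 (r / 2)"
  obtains s where "range s \<subseteq> M" "limitin X s z sequentially"
proof -
  \<comment> \<open>The \<open>+ 1\<close> avoids a division by zero and still gives
    \<open>t * norm e \<le> r / 2\<close>.\<close>
  define t where "t = r / (2 * (norm e + 1))"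
  have ne: "0 < norm e + 1" by (simp add: add_nonneg_pos)
  have t: "0 < t" using r_pos ne by (simp add: t_def)
  have "t * norm e \<le> t * (norm e + 1)" using t by simp
  also have "\<dots> = r / 2" using ne by (simp add: t_def field_simps)
  finally have te: "t * norm e \<le> r / 2" .
  have zb: "\<phi> z \<in> ball x0 r" using z(3) r_pos by auto
  have zJ: "0 \<le> \<phi> z $ j" if "j \<in> J" for j using flat[OF z(2) zb] z(1) that by simp
  define y where "y n = \<phi> z + (t / real (Suc n)) *\<^sub>R e" for n
  have tn: "0 < t / real (Suc n)" "t / real (Suc n) * norm e \<le> r / 2" for n
  proof -
    show "0 < t / real (Suc n)" using t by simp
    have "t / real (Suc n) \<le> t" using t by (simp add: divide_le_eq_1_pos field_simps)
    then have "t / real (Suc n) * norm e \<le> t * norm e" by (intro mult_right_mono) auto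
    then show "t / real (Suc n) * norm e \<le> r / 2" using te by linarith
  qed
  have y: "y n \<in> patch r" "\<psi> (y n) \<in> M" for n
    unfolding y_def using push_inward[OF z(3) zJ less_imp_le[OF tn(1)] tn(2)] tn(1) by blast+
  have "(\<lambda>n. t / real (Suc n)) \<longlonglongrightarrow> 0" using LIMSEQ_Suc[OF lim_const_over_n[of t]] by simp
  then have "y \<longlonglongrightarrow> \<phi> z + 0 *\<^sub>R e" unfolding y_def by (intro tendsto_intros)
  then have "limitin (top_of_set (chart_image c)) y (\<phi> z) sequentially"
    using subsetD[OF patch_image[OF r(1)] y(1)] map_in_image[OF z(2)] by (simp add: limitin_subtopology)
  from continuous_map_limit[OF inv_continuous[OF c] this]
  have "limitin X (\<psi> \<circ> y) z sequentially" using inv_map[OF c z(2)] by simp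
  then show ?thesis using y(2) by (intro that[of "\<psi> \<circ> y"]) auto
qed

lemma scale_small:
  assumes "0 < \<delta>"
  obtains t where "0 < t" "t * norm e \<le> r / 2" "2 * vconst * t powr (1 - A / 2) < \<delta>"
proof -
  have "((\<lambda>t. 2 * vconst * t powr (1 - A / 2)) \<longlongrightarrow> 2 * vconst * 0 powr (1 - A / 2)) (at_right 0)"
    using A2 by (intro tendsto_intros tendsto_powr2) (auto simp: eventually_at_right_field intro: exI[of _ 1])
  then have "\<forall>\<^sub>F t in at_right 0. 2 * vconst * t powr (1 - A / 2) < \<delta>"
    by (rule order_tendstoD(2)) (use assms in simp)
  moreover have "((\<lambda>t. t * norm e) \<longlongrightarrow> 0 * norm e) (at_right 0)" by (intro tendsto_intros)
  then have "\<forall>\<^sub>F t in at_right 0. t * norm e < r / 2"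
    by (rule order_tendstoD(2)) (use r_pos in simp)
  moreover have "\<forall>\<^sub>F t in at_right (0::real). 0 < t" by (rule eventually_at_right_less)
  ultimately have "\<forall>\<^sub>F t in at_right 0. 0 < t \<and> t * norm e \<le> r / 2 \<and> 2 * vconst * t powr (1 - A / 2) < \<delta>"
    by eventually_elim auto
  then show ?thesis using that eventually_happens trivial_limit_at_right_real by blast
qed

lemma eventually_in_half:
  assumes "limitin X s z sequentially" "z \<in> chart_dom c" "\<phi> z \<in> ball x0 (r / 2)" "range s \<subseteq> M"
  shows "\<forall>\<^sub>F n in sequentially. s n \<in> M \<and> s n \<in> chart_dom c \<and> \<phi> (s n) \<in> cball x0 (r / 2)"
proof -
  have "0 < r / 2 - dist x0 (\<phi> z)" using assms(3) by simp
  from eventually_near[OF assms(1,2) this] show ?thesis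
  proof eventually_elim
    case (elim n)
    have "dist x0 (\<phi> (s n)) \<le> dist x0 (\<phi> z) + norm (\<phi> (s n) - \<phi> z)"
      using dist_triangle[of x0 "\<phi> (s n)" "\<phi> z"] by (simp add: dist_norm norm_minus_commute)
    then show ?case using elim assms(4) by auto
  qed
qed

text \<open>The height \<open>t\<close> is fixed first, so that both vertical parts together cost
  less than \<open>\<delta> / 2\<close>. Afterwards the tails are taken so close to \<open>z\<close>
  that the horizontal part at this height costs at most \<open>\<delta> / 2\<close>.\<close>

lemma jointly_Cauchy:
  assumes z: "z \<in> face" "z \<in> chart_dom c" "\<phi> z \<in> ball x0 (r / 2)"
    and s: "range s \<subseteq> M" "limitin X s z sequentially" and s': "range s' \<subseteq> M" "limitin X s' z sequentially"
    and \<epsilon>: "\<epsilon> > 0"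
  shows "\<exists>n0. \<forall>i\<ge>n0. \<forall>j\<ge>n0. dP (s i) (s' j) < \<epsilon>"
proof -
  \<comment> \<open>\<open>\<epsilon>\<close> may be infinite; a strictly smaller number is finite
    and can be taken real.\<close>
  obtain d where d: "0 < d" "d < \<epsilon>" using dense[OF \<epsilon>] by blast
  then obtain \<delta> where \<delta>: "0 < \<delta>" "ennreal \<delta> < \<epsilon>" by (cases d) auto
  obtain t where t: "0 < t" "t * norm e \<le> r / 2" "2 * vconst * t powr (1 - A / 2) < \<delta> / 2"
    using scale_small[of "\<delta> / 2"] \<delta>(1) by auto
  define C where "C = hconst * t powr (- A / 2)"
  have C: "0 < C" using const_nonneg(2)[OF A2] t(1) by (simp add: C_def)
  have \<gamma>: "0 < \<delta> / (4 * C)" using C \<delta> by simp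
  let ?near = "\<lambda>n. (s n \<in> M \<and> s n \<in> chart_dom c \<and> \<phi> (s n) \<in> cball x0 (r / 2))
      \<and> norm (\<phi> (s n) - \<phi> z) < \<delta> / (4 * C)
      \<and> (s' n \<in> M \<and> s' n \<in> chart_dom c \<and> \<phi> (s' n) \<in> cball x0 (r / 2))
      \<and> norm (\<phi> (s' n) - \<phi> z) < \<delta> / (4 * C)"
  have "\<forall>\<^sub>F n in sequentially. ?near n"
    using eventually_in_half[OF s(2) z(2,3) s(1)] eventually_in_half[OF s'(2) z(2,3) s'(1)]
      eventually_near[OF s(2) z(2) \<gamma>] eventually_near[OF s'(2) z(2) \<gamma>]
    by eventually_elim blast
  then obtain n0 where n0: "\<And>n. n \<ge> n0 \<Longrightarrow> ?near n"
    unfolding eventually_sequentially by blast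
  have "dP (s i) (s' j) < \<epsilon>" if ij: "i \<ge> n0" "j \<ge> n0" for i j
  proof -
    have "norm (\<phi> (s' j) - \<phi> (s i)) \<le>
        norm (\<phi> (s' j) - \<phi> z) + norm (\<phi> (s i) - \<phi> z)"
      using norm_triangle_ineq4[of "\<phi> (s' j) - \<phi> z" "\<phi> (s i) - \<phi> z"] by simp
    also have "\<dots> \<le> \<delta> / (4 * C) + \<delta> / (4 * C)" using n0[OF ij(1)] n0[OF ij(2)] by (intro add_mono) auto
    also have "\<dots> = \<delta> / (2 * C)" using C by (simp add: field_simps)
    finally have "C * norm (\<phi> (s' j) - \<phi> (s i)) \<le> C * (\<delta> / (2 * C))"
      using C by (intro mult_left_mono) auto
    then have small: "C * norm (\<phi> (s' j) - \<phi> (s i)) \<le> \<delta> / 2" using C by simp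
    have "dP (s i) (s' j) \<le> ennreal (detour t (norm (\<phi> (s' j) - \<phi> (s i))))"
      by (rule dP_upper[OF A2 _ _ _ _ _ _ t(1,2)]) (use n0[OF ij(1)] n0[OF ij(2)] in auto)
    also have "\<dots> \<le> ennreal \<delta>"
      using small t(3) unfolding C_def by (intro ennreal_leI) linarith
    finally show ?thesis using \<delta>(2) by simp
  qed
  then show ?thesis by blast
qed

text \<open>Both definite descriptions behind \<open>boundary_dist\<close> are discharged here; from
  now on it is a limit along freely chosen interior sequences.\<close>

lemma boundary_dist_limit:
  assumes z: "z \<in> face" "z \<in> chart_dom c" "\<phi> z \<in> ball x0 (r / 2)"
    and z': "z' \<in> face" "z' \<in> chart_dom c" "\<phi> z' \<in> ball x0 (r / 2)"
    and s: "range s \<subseteq> M" "limitin X s z sequentially" and s': "range s' \<subseteq> M" "limitin X s' z' sequentially"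
  shows "(\<lambda>n. dP (s n) (s' n)) \<longlonglongrightarrow> boundary_dist X M dP z z'"
proof -
  have 1: "cauchy_seq M dP s" "completion_point X M dP z = cauchy_equiv M dP `` {s}"
    by (rule interior_metric.completion_point_eq[OF s], rule jointly_Cauchy[OF z], assumption+)+
  have 2: "cauchy_seq M dP s'" "completion_point X M dP z' = cauchy_equiv M dP `` {s'}"
    by (rule interior_metric.completion_point_eq[OF s'], rule jointly_Cauchy[OF z'], assumption+)+
  show ?thesis unfolding boundary_dist_def 1(2) 2(2)
    by (rule interior_metric.completion_dist_tendsto[OF 1(1) 2(1)])
qed

lemma chart_tendsto:
  assumes "limitin X s z sequentially" "z \<in> chart_dom c"
  shows "(\<lambda>n. \<phi> (s n)) \<longlonglongrightarrow> \<phi> z"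
proof (rule tendstoI)
  fix \<epsilon> :: real assume "0 < \<epsilon>"
  from eventually_near[OF assms this]
  show "\<forall>\<^sub>F n in sequentially. dist (\<phi> (s n)) (\<phi> z) < \<epsilon>"
    by eventually_elim (simp add: dist_norm)
qed

lemma boundary_dist_upper:
  assumes z: "z \<in> face" "z \<in> chart_dom c" "\<phi> z \<in> ball x0 (r / 2)"
    and z': "z' \<in> face" "z' \<in> chart_dom c" "\<phi> z' \<in> ball x0 (r / 2)"
    and t: "0 < t" "t * norm e \<le> r / 2"
  shows "boundary_dist X M dP z z' \<le>
    ennreal (detour t (norm (\<phi> z' - \<phi> z)))"
proof -
  obtain s where s: "range s \<subseteq> M" "limitin X s z sequentially"
    by (rule interior_sequence[OF z(1,2)]) (use z(3) in auto)
  obtain s' where s': "range s' \<subseteq> M" "limitin X s' z' sequentially"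
    by (rule interior_sequence[OF z'(1,2)]) (use z'(3) in auto)
  show ?thesis
  proof (rule tendsto_le[OF sequentially_bot _ boundary_dist_limit[OF z z' s s']])
    show "(\<lambda>n. ennreal (detour t (norm (\<phi> (s' n) - \<phi> (s n)))))
       \<longlonglongrightarrow> ennreal (detour t (norm (\<phi> z' - \<phi> z)))"
      by (intro tendsto_intros tendsto_ennrealI chart_tendsto[OF s(2) z(2)] chart_tendsto[OF s'(2) z'(2)])
    show "\<forall>\<^sub>F n in sequentially. dP (s n) (s' n) \<le> ennreal (detour t (norm (\<phi> (s' n) - \<phi> (s n))))"
      using eventually_in_half[OF s(2) z(2,3) s(1)] eventually_in_half[OF s'(2) z'(2,3) s'(1)]
      by eventually_elim (intro dP_upper[OF A2 _ _ _ _ _ _ t]; blast)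
  qed
qed

text \<open>\<open>\<kappa>\<close> is strictly below the coordinate distance, so that late terms of
  \<open>s'\<close> are still outside the ball of radius \<open>\<kappa>\<close> around
  \<open>z\<close>.\<close>

lemma boundary_dist_lower:
  assumes z: "z \<in> face" "z \<in> chart_dom c" "\<phi> z \<in> ball x0 (r / 2)"
    and z': "z' \<in> face" "z' \<in> chart_dom c" "\<phi> z' \<in> ball x0 (r / 2)"
    and \<kappa>: "0 < \<kappa>" "\<kappa> \<le> r / 2" "\<kappa> < norm (\<phi> z' - \<phi> z)"
  shows "ennreal (sqrt k * m / 2 * \<kappa> powr (1 - A / 2)) \<le> boundary_dist X M dP z z'"
proof -
  obtain s where s: "range s \<subseteq> M" "limitin X s z sequentially"
    by (rule interior_sequence[OF z(1,2)]) (use z(3) in auto)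
  obtain s' where s': "range s' \<subseteq> M" "limitin X s' z' sequentially"
    by (rule interior_sequence[OF z'(1,2)]) (use z'(3) in auto)
  have "(\<lambda>n. norm (\<phi> (s' n) - \<phi> z)) \<longlonglongrightarrow> norm (\<phi> z' - \<phi> z)"
    by (intro tendsto_intros chart_tendsto[OF s'(2) z'(2)])
  then have far: "\<forall>\<^sub>F n in sequentially. \<kappa> < norm (\<phi> (s' n) - \<phi> z)"
    by (rule order_tendstoD(1)) (rule \<kappa>(3))
  have k2: "0 < \<kappa> / 2" using \<kappa>(1) by simp
  show ?thesis
  proof (rule tendsto_le[OF sequentially_bot boundary_dist_limit[OF z z' s s'] tendsto_const])
    show "\<forall>\<^sub>F n in sequentially. ennreal (sqrt k * m / 2 * \<kappa> powr (1 - A / 2)) \<le> dP (s n) (s' n)"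
      using far eventually_near[OF s(2) z(2) k2]
    proof eventually_elim
      case (elim n)
      show ?case
        by (rule dP_lower[OF z(1,2) _ \<kappa>(1,2)]) (use elim z(3) in auto)
    qed
  qed
qed

text \<open>Any two points of \<open>nbhd\<close> have coordinate distance below
  \<open>2 * radius\<close>. The factor 4 makes this at most \<open>r / 2\<close>, as the exit
  estimates demand, and the factor \<open>norm e + 1\<close> admits this distance as the height of a
  detour.\<close>

definition radius :: real where "radius = r / (4 * (norm e + 1))"

definition nbhd :: "'a set" where "nbhd = {q \<in> face \<inter> chart_dom c. \<phi> q \<in> ball x0 radius}"

lemma radius: "0 < radius" "radius \<le> r / 4" "2 * radius * norm e \<le> r / 2"
proof -
  have ne: "0 < norm e + 1" by (simp add: add_nonneg_pos)
  show p: "0 < radius" using r_pos ne by (simp add: radius_def)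
  have eq: "radius * (norm e + 1) = r / 4" using ne by (simp add: radius_def field_simps)
  have "radius \<le> radius * (norm e + 1)" "radius * norm e \<le> radius * (norm e + 1)" using p by (simp_all add: algebra_simps)
  then show "radius \<le> r / 4" "2 * radius * norm e \<le> r / 2" using eq by linarith+
qed

lemma nbhd_face:
  assumes "z \<in> nbhd"
  shows "z \<in> face" "z \<in> chart_dom c" "\<phi> z \<in> ball x0 (r / 2)" "\<phi> z \<in> ball x0 r"
  using assms radius(2) r_pos by (auto simp: nbhd_def)

text \<open>Both distances are compared with the coordinate distance \<open>len\<close>. The exit
  radius is \<open>len\<close> for \<open>dF\<close>, but \<open>len / 2\<close> for
  \<open>boundary_dist\<close>, where it must be strictly smaller than \<open>len\<close>. The case
  \<open>len = 0\<close> is separate, as radii and heights must be positive.\<close>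

lemma nbhd_comparison:
  assumes z: "z \<in> nbhd" and z': "z' \<in> nbhd"
  defines "L \<equiv> enn2real (dF z z')" and "len \<equiv> norm (\<phi> z' - \<phi> z)"
  shows "m * len / 2 \<le> L" "L \<le> m' * len"
    "ennreal (sqrt k * m / 2 * (len / 2) powr (1 - A / 2)) \<le> boundary_dist X M dP z z'"
    "boundary_dist X M dP z z' \<le> ennreal ((2 * vconst + hconst) * len powr (1 - A / 2))"
proof -
  note a = nbhd_face[OF z] nbhd_face[OF z']
  have up: "dF z z' \<le> ennreal (m' * len)" unfolding len_def by (rule dF_upper) (use a in auto)
  have len_nonneg: "0 \<le> len" by (simp add: len_def)
  show "L \<le> m' * len" unfolding L_def using up m len_nonneg by (intro enn2real_leI) auto
  \<comment> \<open>The upper bound is finite, so \<open>enn2real\<close> loses nothing.\<close>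
  have Leq: "dF z z' = ennreal L" unfolding L_def
    using up by (metis ennreal_enn2real ennreal_less_top order_le_less_trans)
  have lt: "len < 2 * radius"
  proof -
    have "len \<le> dist x0 (\<phi> z') + dist x0 (\<phi> z)"
      unfolding len_def using dist_triangle3[of "\<phi> z'" "\<phi> z" x0] by (simp add: dist_norm)
    then show ?thesis using z z' by (simp add: nbhd_def)
  qed
  show "m * len / 2 \<le> L"
  proof (cases "len = 0")
    case False
    then have "ennreal (m * len / 2) \<le> dF z z'"
      using a lt radius len_nonneg by (intro dF_lower) (auto simp: len_def)
    then show ?thesis unfolding Leq by (simp add: L_def)
  qed (simp add: L_def)
  show "ennreal (sqrt k * m / 2 * (len / 2) powr (1 - A / 2)) \<le> boundary_dist X M dP z z'"
  proof (cases "len = 0")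
    case False
    then show ?thesis using a lt radius len_nonneg by (intro boundary_dist_lower) (auto simp: len_def)
  qed simp
  show "boundary_dist X M dP z z' \<le> ennreal ((2 * vconst + hconst) * len powr (1 - A / 2))"
  proof (cases "len = 0")
    case True
    \<comment> \<open>The right-hand side is 0 as \<open>0 powr _ = 0\<close>, so the distance
      itself must vanish; detours at heights tending to zero show this.\<close>
    have "boundary_dist X M dP z z' \<le> 0 + ennreal \<epsilon>" if \<epsilon>: "0 < \<epsilon>" for \<epsilon>
    proof -
      obtain t where t: "0 < t" "t * norm e \<le> r / 2" "2 * vconst * t powr (1 - A / 2) < \<epsilon>"
        using scale_small[OF \<epsilon>] .
      have "boundary_dist X M dP z z' \<le> ennreal (detour t len)"
        unfolding len_def by (rule boundary_dist_upper[OF a(1,2,3) a(5,6,7) t(1,2)])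
      also have "\<dots> \<le> ennreal \<epsilon>" using t(3) True by (intro ennreal_leI) simp
      finally show ?thesis by simp
    qed
    then have "boundary_dist X M dP z z' \<le> 0" by (rule ennreal_le_epsilon)
    then show ?thesis by simp
  next
    case False
    then have len: "0 < len" using len_nonneg by simp
    have "len * norm e \<le> 2 * radius * norm e" using lt by (intro mult_right_mono) auto
    then have t: "len * norm e \<le> r / 2" using radius(3) by linarith
    have "boundary_dist X M dP z z' \<le> ennreal (2 * vconst * len powr (1 - A / 2) + hconst * len powr (- A / 2) * len)"
      using boundary_dist_upper[OF a(1,2,3) a(5,6,7) len t] by (simp add: len_def)
    also have "hconst * len powr (- A / 2) * len = hconst * len powr (1 - A / 2)"
      using powr_half_mult[OF len] by (simp add: mult_ac)
    finally show ?thesis by (simp add: algebra_simps)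
  qed
qed

lemma nbhd_openin: "openin (subtopology X face) nbhd"
proof -
  have "nbhd = face \<inter> {q \<in> chart_dom c. \<phi> q \<in> ball x0 radius}" by (auto simp: nbhd_def)
  then show ?thesis
    using openin_subtopology_Int2[OF openin_chart_preimage[OF c open_ball], of face x0 radius] by simp
qed

text \<open>The closed coordinate ball, cut by the equations of the face, is compact. By flatness
  its image lies in the face, and the closure of \<open>nbhd\<close> cannot leave this closed
  image.\<close>

lemma nbhd_compact: "compactin (subtopology X face) (subtopology X face closure_of nbhd)"
proof -
  let ?D = "cball x0 radius \<inter> corner K \<inter> {x. \<forall>j\<in>J. x $ j = 0}"
  let ?Q = "\<psi> ` ?D"
  have Dp: "?D \<subseteq> patch r" using radius(2) r_pos by auto
  have "closed {x :: real^'n. \<forall>j\<in>J. x $ j = 0}"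
  proof -
    have "{x :: real^'n. \<forall>j\<in>J. x $ j = 0} = (\<Inter>j\<in>J. {x. x $ j = 0})" by auto
    then show ?thesis by (auto intro!: closed_INT closed_Collect_eq continuous_intros)
  qed
  then have "compact ?D" by (intro compact_Int_closed compact_cball closed_corner)
  then have QX: "compactin X ?Q"
    using compactin_chart_inv_image[OF c] Dp patch_image[OF r(1)] by blast
  have QF: "?Q \<subseteq> face"
  proof clarify
    fix x assume x: "x \<in> cball x0 radius" "x \<in> corner K" "\<forall>j\<in>J. x $ j = 0"
    then have xp: "x \<in> patch r" using Dp by blast
    have "x \<in> ball x0 r" using x(1) radius(2) r_pos by auto
    then show "\<psi> x \<in> face" using flat[OF patch_inv(1)[OF xp]] patch_inv(2)[OF xp] x(3) by simp
  qed
  have Q: "compactin (subtopology X face) ?Q" using QX QF by (simp add: compactin_subtopology)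
  have "Hausdorff_space (subtopology X face)" using Hausdorff Hausdorff_space_subtopology by blast
  then have Qc: "closedin (subtopology X face) ?Q" using Q compactin_imp_closedin by blast
  have "nbhd \<subseteq> ?Q"
  proof
    fix q assume q: "q \<in> nbhd"
    note a = nbhd_face[OF q]
    have "\<phi> q \<in> ?D"
      using q flat[OF a(2,4)] a(1) image_corner[OF c map_in_image[OF a(2)]] by (auto simp: nbhd_def)
    then have "\<psi> (\<phi> q) \<in> ?Q" by (rule imageI)
    then show "q \<in> ?Q" using inv_map[OF c a(2)] by simp
  qed
  then have "subtopology X face closure_of nbhd \<subseteq> ?Q" using Qc by (rule closure_of_minimal)
  then show ?thesis using closed_compactin[OF Q _ closedin_closure_of] by blast
qed

lemma p_nbhd: "p \<in> nbhd"
  using pF pc radius(1) by (simp add: nbhd_def)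

lemma face_distance_comparison:
  obtains c1 C1 where "0 < c1" "c1 \<le> C1" "\<And>z z'. z \<in> nbhd \<Longrightarrow> z' \<in> nbhd \<Longrightarrow>
    ennreal (c1 * enn2real (dF z z') powr (1 - A / 2)) \<le> boundary_dist X M dP z z' \<and>
    boundary_dist X M dP z z' \<le> ennreal (C1 * enn2real (dF z z') powr (1 - A / 2))"
proof -
  let ?\<beta> = "1 - A / 2"
  have \<beta>: "0 < ?\<beta>" using A2 by simp
  \<comment> \<open>\<open>L \<le> m' * len\<close> at the exit radius \<open>len / 2\<close> gives
    the factor \<open>1 / (2 * m')\<close>; \<open>len \<le> 2 * L / m\<close> gives the one in
    \<open>C0\<close>.\<close>
  define c1 where "c1 = sqrt k * m / 2 * (1 / (2 * m')) powr ?\<beta>"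
  define C0 where "C0 = (2 * vconst + hconst) * (2 / m) powr ?\<beta>"
  have c1: "0 < c1" using k m by (simp add: c1_def)
  have h0: "0 < 2 * vconst + hconst" using const_nonneg[OF A2] by linarith
  show ?thesis
  \<comment> \<open>The maximum secures the required order of the two constants.\<close>
  proof (rule that[OF c1, of "max c1 C0"])
    fix z z' assume zz: "z \<in> nbhd" "z' \<in> nbhd"
    define L where "L = enn2real (dF z z')"
    define len where "len = norm (\<phi> z' - \<phi> z)"
    note b = nbhd_comparison[OF zz, folded L_def len_def]
    have L0: "0 \<le> L" by (simp add: L_def)
    have l0: "0 \<le> len" by (simp add: len_def)
    have "L * (1 / (2 * m')) \<le> len / 2" using b(2) m by (simp add: field_simps)
    then have "(L * (1 / (2 * m'))) powr ?\<beta> \<le> (len / 2) powr ?\<beta>"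
      using L0 m \<beta> by (intro powr_mono2) auto
    then have "L powr ?\<beta> * (1 / (2 * m')) powr ?\<beta> \<le> (len / 2) powr ?\<beta>"
      using L0 m by (simp only: powr_mult)
    then have "sqrt k * m / 2 * (L powr ?\<beta> * (1 / (2 * m')) powr ?\<beta>) \<le> sqrt k * m / 2 * (len / 2) powr ?\<beta>"
      using k m by (intro mult_left_mono) auto
    then have "c1 * L powr ?\<beta> \<le> sqrt k * m / 2 * (len / 2) powr ?\<beta>" by (simp add: c1_def mult_ac)
    then have lower: "ennreal (c1 * L powr ?\<beta>) \<le> boundary_dist X M dP z z'"
      using b(3) by (meson ennreal_leI order_trans)
    have "len \<le> L * (2 / m)" using b(1) m by (simp add: field_simps)
    then have "len powr ?\<beta> \<le> (L * (2 / m)) powr ?\<beta>" using l0 \<beta> by (intro powr_mono2) auto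
    also have "\<dots> = L powr ?\<beta> * (2 / m) powr ?\<beta>" by (rule powr_mult)
    finally have "(2 * vconst + hconst) * len powr ?\<beta> \<le> (2 * vconst + hconst) * (L powr ?\<beta> * (2 / m) powr ?\<beta>)"
      using h0 by (intro mult_left_mono) auto
    also have "\<dots> = C0 * L powr ?\<beta>" by (simp add: C0_def)
    also have "\<dots> \<le> max c1 C0 * L powr ?\<beta>" by (intro mult_right_mono) auto
    finally have "boundary_dist X M dP z z' \<le> ennreal (max c1 C0 * L powr ?\<beta>)"
      using b(4) by (meson ennreal_leI order_trans)
    with lower show "ennreal (c1 * enn2real (dF z z') powr ?\<beta>) \<le> boundary_dist X M dP z z' \<and>
        boundary_dist X M dP z z' \<le> ennreal (max c1 C0 * enn2real (dF z z') powr ?\<beta>)"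
      by (simp add: L_def)
  qed simp
qed

end

end

theorem theorem6p5:
  fixes X :: "'a topology"
    and \<A> :: "('a, 'n::finite) chart set"
    and N :: nat
    and H :: "nat \<Rightarrow> 'a set"
    and \<rho> :: "nat \<Rightarrow> 'a \<Rightarrow> real"
    and g0 :: "('a, 'n) tensor2"
    and \<alpha> :: "nat \<Rightarrow> real"
    and I :: "nat set"
  defines "M \<equiv> mf_interior X \<A>"
    and "dPi \<equiv> riemannian_distance X \<A> (product_conformal_metric N \<rho> \<alpha> g0) (mf_interior X \<A>)"
    and "F \<equiv> open_face X N H I"
    and "dF \<equiv> riemannian_distance X \<A> g0 (open_face X N H I)"
    and "A \<equiv> (\<Sum>i\<in>I. \<alpha> i)"
  assumes "manifold_with_corners X \<A>" and "compact_space X"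
    and "bij_betw H {1..N} (boundary_hypersurfaces X \<A>)"
    and "\<forall>i\<in>{1..N}. embedded_hypersurface X \<A> (H i)"
    and "\<forall>i\<in>{1..N}. boundary_defining_function X \<A> (H i) (\<rho> i)"
    and "smooth_riemannian_metric \<A> g0"
    and "\<forall>i\<in>{1..N}. 0 \<le> \<alpha> i"
    and "I \<noteq> {}" and "I \<subseteq> {1..N}"
    and "accessible_face X M dPi F"
  shows "\<forall>p\<in>F. \<exists>V. openin (subtopology X F) V \<and> p \<in> V \<and>
           compactin (subtopology X F) (subtopology X F closure_of V) \<and>
           (\<exists>c C \<eta>. 0 < c \<and> c \<le> C \<and> 0 < \<eta> \<and>
              (\<forall>z\<in>V. \<forall>z'\<in>V. dF z z' < ennreal \<eta> \<longrightarrow>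
                 ennreal (c * enn2real (dF z z') powr (1 - A / 2))
                   \<le> boundary_dist X M dPi z z' \<and>
                 boundary_dist X M dPi z z'
                   \<le> ennreal (C * enn2real (dF z z') powr (1 - A / 2))))"
proof
  fix p assume p: "p \<in> F"
  interpret corner_manifold X \<A> by unfold_locales fact
  have "p \<in> topspace X" using p by (simp add: F_def open_face_def)
  then obtain c where c: "c \<in> \<A>" "p \<in> chart_dom c" using covered by blast
  interpret conformal_face X \<A> N H \<rho> I p c g0 \<alpha>
    by unfold_locales (use assms p c in auto)
  obtain r m m' k k' where "face_estimates X \<A> N H \<rho> I p c g0 \<alpha> r m m' k k'"
    using face_estimates_exist by blast
  then interpret face_estimates X \<A> N H \<rho> I p c g0 \<alpha> r m m' k k' .
  have "accessible_point X M dPi p"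
    using \<open>accessible_face X M dPi F\<close> p by (simp add: accessible_face_def)
  then have A2: "sum \<alpha> I < 2"
    using accessible_exponent[OF \<open>I \<noteq> {}\<close>] by (simp add: M_def dPi_def)
  obtain c1 C1 where "0 < c1" "c1 \<le> C1" "\<And>z z'. z \<in> nbhd \<Longrightarrow> z' \<in> nbhd \<Longrightarrow>
    ennreal (c1 * enn2real (dF z z') powr (1 - A / 2)) \<le> boundary_dist X M dPi z z' \<and>
    boundary_dist X M dPi z z' \<le> ennreal (C1 * enn2real (dF z z') powr (1 - A / 2))"
    unfolding M_def dPi_def dF_def A_def by (rule face_distance_comparison[OF A2]) blast
  \<comment> \<open>The comparison holds on all of \<open>nbhd\<close>, so any positive
    \<open>\<eta>\<close> serves.\<close>
  then have "\<exists>c C \<eta>. 0 < c \<and> c \<le> C \<and> 0 < \<eta> \<and>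
      (\<forall>z\<in>nbhd. \<forall>z'\<in>nbhd. dF z z' < ennreal \<eta> \<longrightarrow>
        ennreal (c * enn2real (dF z z') powr (1 - A / 2)) \<le> boundary_dist X M dPi z z' \<and>
        boundary_dist X M dPi z z' \<le> ennreal (C * enn2real (dF z z') powr (1 - A / 2)))"
    by (intro exI[of _ c1] exI[of _ C1] exI[of _ 1]) auto
  then show "\<exists>V. openin (subtopology X F) V \<and> p \<in> V \<and>
           compactin (subtopology X F) (subtopology X F closure_of V) \<and>
           (\<exists>c C \<eta>. 0 < c \<and> c \<le> C \<and> 0 < \<eta> \<and>
              (\<forall>z\<in>V. \<forall>z'\<in>V. dF z z' < ennreal \<eta> \<longrightarrow>
                 ennreal (c * enn2real (dF z z') powr (1 - A / 2))
                   \<le> boundary_dist X M dPi z z' \<and>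
                 boundary_dist X M dPi z z'
                   \<le> ennreal (C * enn2real (dF z z') powr (1 - A / 2))))"
    using nbhd_openin[OF A2] nbhd_compact[OF A2] p_nbhd[OF A2] unfolding F_def by blast
qed

end
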